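(* Fix $\epsilon_1>0$. For positive integers $N$ and coprime integers $s>t\ge 10$ with $$s>4\sqrt{N}\qquad\text{and}\qquad 2t\le \frac{8\pi}{\left(\frac{1}{2}+\epsilon_1\right)\log N}\sqrt{\frac{tN}{t-1}},$$ there exist real numbers $\delta_7,\delta_8,\delta_9,\delta_{10}\in(1,1.01)$ (possibly depending on $N,s,t$) such that $$\bar{p}_{s,t}(N)=\frac{1}{2\sqrt{2t}\,N^{3/4}}\left(1-\frac{1}{t}\right)^{1/4}\exp\left(\pi \sqrt{N\left(1-\frac{1}{t}\right)}\right)E_5(N,s,t)\left(1+O\left(N^{-1/2}\right)\right),$$ where $$\begin{aligned} E_5(N,s,t)=&\exp\left(2\delta_7\exp\left(-\frac{\pi s}{2}\sqrt{\frac{t(t-1)}{N}}\left(1+O\left(N^{-1/2}\right)\right)\right)-\delta_8\exp\left(-\pi s\sqrt{\frac{t(t-1)}{N}}\left(1+O\left(N^{-1/2}\right)\right)\right)\right)\\ &\times \exp\left(\delta_9\exp\left(-\pi s\sqrt{\frac{t-1}{tN}}\left(1+O\left(N^{-1/2}\right)\right)\right)-2\delta_{10}\exp\left(-\frac{\pi s}{2}\sqrt{\frac{t-1}{tN}}\left(1+O\left(N^{-1/2}\right)\right)\right)\right), \end{aligned}$$ as $N\to\infty$, with implied constants depending only on $\epsilon_1$.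
   Context: An overpartition of $N$ is a partition of $N$ in which the first occurrence of each distinct part may be overlined. $\bar p_{s,t}(N)$ is the number of overpartitions of $N$ none of whose parts is divisible by $s$ or by $t$. Each occurrence of $O(N^{-1/2})$ denotes some real quantity (depending on $N,s,t$, possibly different at each occurrence) bounded in absolute value by $CN^{-1/2}$ for all $N\ge N_0$, where $C,N_0$ depend only on $\epsilon_1$. *)

theory Defs
  imports "HOL-Analysis.Analysis" "HOL-Library.Multiset"
begin

text \<open>
  An overpartition is encoded as a pair (P, V): the multiset P of its parts, and the set V
  of those values whose first occurrence in P is overlined.
\<close>
definition overpartitions :: "nat \<Rightarrow> (nat multiset \<times> nat set) set" where
  "overpartitions N = {(P, V). 0 \<notin># P \<and> sum_mset P = N \<and> V \<subseteq> set_mset P}"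

definition pbar :: "nat \<Rightarrow> nat \<Rightarrow> nat \<Rightarrow> nat" where
  "pbar s t N = card {(P, V) \<in> overpartitions N. \<forall>m \<in># P. \<not> s dvd m \<and> \<not> t dvd m}"

lemma size_le_sum_mset: "0 \<notin># P \<Longrightarrow> size P \<le> sum_mset (P :: nat multiset)"
  by (induction P) auto

lemma finite_overpartitions: "finite (overpartitions N)"
proof (rule finite_subset)
  show "overpartitions N \<subseteq> (\<Union>k\<le>N. multisets_of_size {..N} k) \<times> Pow {..N}"
  proof
    fix x assume "x \<in> overpartitions N"
    then obtain P V where x: "x = (P, V)" and P: "0 \<notin># P" "sum_mset P = N" and V: "V \<subseteq> set_mset P"
      by (auto simp: overpartitions_def)
    have le: "m \<le> N" if "m \<in># P" for m
      using sum_mset.remove[OF that] P by simp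
    have "P \<in> multisets_of_size {..N} (size P)"
      using le by (auto simp: multisets_of_size_def)
    moreover have "size P \<le> N"
      using size_le_sum_mset P by blast
    ultimately show "x \<in> (\<Union>k\<le>N. multisets_of_size {..N} k) \<times> Pow {..N}"
      using V le by (auto simp: x)
  qed
qed auto

text \<open>
  The arguments d7, ..., d10 are the constants \<delta>; e1, ..., e4 are the values of the
  four occurrences of the error term, in the order in which they appear.
\<close>
definition E5 ::
  "nat \<Rightarrow> nat \<Rightarrow> nat \<Rightarrow> real \<Rightarrow> real \<Rightarrow> real \<Rightarrow> real \<Rightarrow> real \<Rightarrow> real \<Rightarrow> real \<Rightarrow> real \<Rightarrow> real" where
  "E5 N s t d7 d8 d9 d10 e1 e2 e3 e4 =
     exp (2 * d7 * exp (- (pi * real s / 2) * sqrt (real t * (real t - 1) / real N) * (1 + e1))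
            - d8 * exp (- (pi * real s) * sqrt (real t * (real t - 1) / real N) * (1 + e2)))
   * exp (d9 * exp (- (pi * real s) * sqrt ((real t - 1) / (real t * real N)) * (1 + e3))
            - 2 * d10 * exp (- (pi * real s / 2) * sqrt ((real t - 1) / (real t * real N)) * (1 + e4)))"

end

theory Submission
  imports Defs "HOL-Complex_Analysis.Complex_Analysis" "HOL-Probability.Probability" "HOL-Real_Asymp.Real_Asymp"
begin

text \<open>
  Write \<theta>(q) for the series 1 + 2 \<Sum> (-1)^n q^(n^2), n \<ge> 1. By Gauss, 1 / \<theta>(q) is the generating
  function of all overpartitions, the product of (1 + q^m) / (1 - q^m). Since s and t are coprime,
  dropping the parts divisible by s or by t gives
    F(q) = \<Sum> pbar(N) q^N = (\<theta>(q^t) / \<theta>(q)) (\<theta>(q^s) / \<theta>(q^(st)))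
  (\<open>over_prod_tendsto\<close>, \<open>pbar_sums\<close>). The coefficient of q^N is an integral of F(exp(-z)) exp(N z)
  over the vertical line Re z = x, |Im z| \<le> \<pi>.

  The inversion formula \<open>theta4_inversion\<close> turns \<theta>(exp(-z)) into a multiple of
  z^(-1/2) exp(-\<pi>^2 / (4z)) whose remaining factor is 1 + O(exp(-2 \<pi>^2 Re(1/z))). In the first
  quotient the square roots cancel, so the integrand is t^(-1/2) exp(N z + A / z), with
  A = (\<pi>^2 / 4) (1 - 1/t), up to a factor close to 1 and the second quotient. The exponent has its
  saddle point at x = sqrt(A / N) = (\<pi> / 2) sqrt((1 - 1/t) / N), and M = N x, of order sqrt N, is the
  large parameter there. The upper bound on t says that exp(-2 \<pi>^2 / (t x)) is at most
  N^(-1/2 - \<epsilon>), so that inverting \<theta>(exp(-t z)) costs an acceptable relative error. The lower bound on s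
  makes s x larger than 5.68, so the second quotient is a power series at a tiny argument; along the
  line its logarithm changes to first order by an imaginary amount, which cancels by symmetry, and its
  second order change is again O(1/M). Integrating over |Im z| \<le> x therefore gives a Gaussian
  integral with relative error O(1/M) = O(N^(-1/2)) (\<open>major_arc_pointwise\<close>, \<open>gaussian_comparison\<close>).

  For |Im z| > x it is enough to compare 1 / \<theta>(q) with its value at |q|, keeping only the linear
  term of each logarithm: this gains a factor exp(-0.48 / x), while replacing \<theta>(q^t) by a polynomial
  bound loses only exp(\<pi>^2 / (4 t x)), at most exp(0.4 / x) because t \<ge> 10
  (\<open>pbar_gf_minor_arc\<close>).

  What remains at the saddle point is \<theta>(exp(-s x)) / \<theta>(exp(-s t x)). As both arguments are at most
  1/256, this is E5 with all four inner error terms equal to 0 and a suitable choice of the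
  constants \<delta> (\<open>E5_eq_theta4_quotient\<close>); only the outer error term is nonzero.
\<close>

section \<open>Theta series and the product of Gauss\<close>

text \<open>
  The Jacobi theta constant \<theta>_4; the terms of index n and -n are merged.
\<close>
definition theta4 :: "'a::{real_normed_field,banach} \<Rightarrow> 'a" where
  "theta4 q = (\<Sum>n. (if n = 0 then 1 else 2) * (-1) ^ n * q ^ (n^2))"

definition over_prod :: "nat \<Rightarrow> 'a::field \<Rightarrow> 'a" where
  "over_prod n q = (\<Prod>k=1..n. (1 + q ^ k) / (1 - q ^ k))"

lemma over_prod_0 [simp]: "over_prod 0 q = 1"
  and over_prod_Suc: "over_prod (Suc n) q = over_prod n q * ((1 + q ^ Suc n) / (1 - q ^ Suc n))"
  by (simp_all add: over_prod_def)

lemma power_ne_one: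
  fixes q :: "'a::real_normed_field"
  assumes "norm q < 1" "k > 0"
  shows "q ^ k \<noteq> 1" "q ^ k \<noteq> - 1"
proof -
  have "norm (q ^ k) < 1"
    using assms by (simp add: norm_power power_less_one_iff)
  thus "q ^ k \<noteq> 1" "q ^ k \<noteq> - 1" by auto
qed

text \<open>
  Write h(s) = (-1)^s R_s 2 q^((s+1)m), where R_s is \<open>over_prod s q\<close>. The bracket equals
  -(1 - q^s) - q^m (1 + q^s), and (1 - q^s) / (1 + q^s) carries R_s to R_(s-1); hence each summand is
  h(s-1) - h(s). The sum is the change of the right-hand side below when n grows by 1.
\<close>
lemma shanks_telescope:
  fixes q :: "'a::real_normed_field"
  assumes q: "norm q < 1"
  shows "(\<Sum>s\<le>n. (-1) ^ s * over_prod s q * 2 * q ^ (s * m) / (1 + q ^ s)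
                   * (q ^ s * (1 - q ^ m) - (1 + q ^ m)))
         = - ((-1) ^ n * over_prod n q * 2 * q ^ (Suc n * m))"
proof (induction n)
  case 0
  show ?case by (simp add: algebra_simps)
next
  case (Suc n)
  have ne: "1 + q ^ Suc n \<noteq> 0" "1 - q ^ Suc n \<noteq> 0"
    using power_ne_one[OF q, of "Suc n"] by (auto simp: add_eq_0_iff)
  have "(-1) ^ Suc n * over_prod (Suc n) q * 2 * q ^ (Suc n * m) / (1 + q ^ Suc n)
              * (q ^ Suc n * (1 - q ^ m) - (1 + q ^ m)) - (-1) ^ n * over_prod n q * 2 * q ^ (Suc n * m)
        = - ((-1) ^ Suc n * over_prod (Suc n) q * 2 * q ^ (Suc (Suc n) * m))"
  proof -
    define Q where "Q = q ^ Suc n"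
    define R where "R = over_prod n q"
    define Z where "Z = q ^ (Suc n * m)"
    define e :: 'a where "e = (-1) ^ n"
    have Z': "q ^ (Suc (Suc n) * m) = Z * q ^ m" by (simp add: Z_def power_add [symmetric] algebra_simps)
    have e': "(-1::'a) ^ Suc n = - e" by (simp add: e_def)
    have Q: "1 + Q \<noteq> 0" "1 - Q \<noteq> 0" using ne by (simp_all add: Q_def)
    show ?thesis
      unfolding over_prod_Suc e' Z' Q_def[symmetric] R_def[symmetric] Z_def[symmetric] e_def[symmetric]
      using Q by (simp add: divide_simps) (simp add: algebra_simps)
  qed
  thus ?case unfolding sum.atMost_Suc Suc.IH by (simp only: diff_conv_add_uminus add.commute)
qed

text \<open>
  A finite form, in the style of Shanks, of Gauss's identity. On the right the term s = 0 is 1, and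
  all the others contain a power of q of exponent at least n + 1.
\<close>
lemma shanks_identity:
  fixes q :: "'a::real_normed_field"
  assumes q: "norm q < 1"
  shows "over_prod n q * (\<Sum>k\<le>n. (if k = 0 then 1 else 2) * (-1) ^ k * q ^ (k^2))
         = (\<Sum>s\<le>n. (-1) ^ s * over_prod s q * 2 * q ^ (s * Suc n) / (1 + q ^ s))"
proof (induction n)
  case (Suc n)
  define m where "m = Suc n"
  define U where "U = (\<Sum>s\<le>n. (-1) ^ s * over_prod s q * 2 * q ^ (s * m) / (1 + q ^ s))"
  define U' where "U' = (\<Sum>s\<le>n. (-1) ^ s * over_prod s q * 2 * q ^ (s * Suc m) / (1 + q ^ s))"
  define R where "R = over_prod n q"
  define S where "S = (\<Sum>k\<le>n. (if k = 0 then 1 else 2) * (-1) ^ k * q ^ (k^2))"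
  have IH: "R * S = U" using Suc.IH by (simp add: R_def S_def U_def m_def)
  have ne: "1 + q ^ m \<noteq> 0" "1 - q ^ m \<noteq> 0"
    using power_ne_one[OF q, of m] by (auto simp: add_eq_0_iff m_def)
  have "U' * (1 - q ^ m) - (1 + q ^ m) * U = (\<Sum>s\<le>n. (-1) ^ s * over_prod s q * 2 * q ^ (s * m) / (1 + q ^ s)
                   * (q ^ s * (1 - q ^ m) - (1 + q ^ m)))"
    unfolding U_def U'_def sum_distrib_right sum_distrib_left sum_subtractf [symmetric]
    by (intro sum.cong refl) (simp add: power_add algebra_simps diff_divide_distrib add_divide_distrib)
  also have "... = (-1) ^ m * R * 2 * q ^ (m^2)"
    by (subst shanks_telescope[OF q]) (simp add: m_def R_def power2_eq_square)
  finally have *: "U' * (1 - q ^ m) = (1 + q ^ m) * U + (-1) ^ m * R * 2 * q ^ (m^2)"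
    by (simp add: algebra_simps)
  have R': "over_prod m q = R * ((1 + q ^ m) / (1 - q ^ m))"
    by (simp add: m_def over_prod_Suc R_def)
  have mm: "q ^ (m * Suc m) = q ^ (m^2) * q ^ m" by (simp add: power_add[symmetric] power2_eq_square add.commute)
  define Q where "Q = q ^ m"
  define Z where "Z = q ^ (m^2)"
  define e :: 'a where "e = (-1) ^ m"
  have U': "U' = ((1 + Q) * (R * S) + e * R * 2 * Z) / (1 - Q)"
    using * ne by (simp add: Q_def Z_def e_def IH eq_divide_eq)
  have "over_prod m q * (S + 2 * (-1) ^ m * q ^ (m^2))
        = U' + (-1) ^ m * over_prod m q * 2 * q ^ (m * Suc m) / (1 + q ^ m)"
    unfolding R' mm U' Q_def[symmetric] Z_def[symmetric] e_def[symmetric]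
    using ne unfolding Q_def[symmetric] by (simp add: divide_simps) (simp add: algebra_simps)
  thus ?case by (simp add: S_def U'_def m_def)
qed auto

lemma norm_over_factor_le:
  fixes q :: "'a::real_normed_field"
  assumes "norm q < 1"
  shows "norm ((1 + q) / (1 - q)) \<le> (1 + norm q) / (1 - norm q)"
proof -
  have "norm (1 + q) \<le> 1 + norm q" "norm (1 - q) \<ge> 1 - norm q"
    using norm_triangle_ineq[of 1 q] norm_triangle_ineq2[of 1 q] by auto
  thus ?thesis using assms by (auto simp: norm_divide intro!: frac_le)
qed

lemma over_prod_nonneg: "0 \<le> r \<Longrightarrow> r < 1 \<Longrightarrow> over_prod n (r::real) \<ge> 0"
  unfolding over_prod_def by (intro prod_nonneg ballI divide_nonneg_nonneg) (auto simp: power_le_one)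

lemma norm_over_prod_le:
  fixes q :: "'a::real_normed_field"
  assumes "norm q < 1"
  shows "norm (over_prod n q) \<le> over_prod n (norm q)"
  unfolding over_prod_def prod_norm[symmetric]
proof (intro prod_mono conjI)
  fix k assume "k \<in> {1..n}"
  hence "norm (q ^ k) < 1" using assms by (simp add: norm_power power_less_one_iff)
  thus "norm ((1 + q ^ k) / (1 - q ^ k)) \<le> (1 + norm q ^ k) / (1 - norm q ^ k)"
    using norm_over_factor_le[of "q ^ k"] by (simp add: norm_power)
qed auto

text \<open>
  Each factor is 1 + 2 r^k / (1 - r^k), and r^k \<le> r in the denominator leaves a geometric series in the exponent.
\<close>
lemma over_prod_bounded:
  fixes r :: real
  assumes r: "0 \<le> r" "r < 1"
  shows "over_prod n r \<le> exp (2 / (1 - r)^2)"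
proof -
  have "over_prod n r \<le> (\<Prod>k=1..n. exp (2 * r ^ k / (1 - r)))"
    unfolding over_prod_def
  proof (intro prod_mono conjI)
    fix k assume k: "k \<in> {1..n}"
    have rk: "r ^ k \<le> r" using k r power_decreasing[of 1 k r] by auto
    have "(1 + r ^ k) / (1 - r ^ k) = 1 + 2 * r ^ k / (1 - r ^ k)"
      using rk r by (simp add: field_simps)
    also have "... \<le> 1 + 2 * r ^ k / (1 - r)" using rk r by (auto intro!: divide_left_mono)
    also have "... \<le> exp (2 * r ^ k / (1 - r))" by (rule exp_ge_add_one_self)
    finally show "(1 + r ^ k) / (1 - r ^ k) \<le> exp (2 * r ^ k / (1 - r))" .
    show "0 \<le> (1 + r ^ k) / (1 - r ^ k)" using rk r by auto
  qed
  also have "... = exp ((\<Sum>k=1..n. r ^ k) * (2 / (1 - r)))"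
    by (simp add: exp_sum[symmetric] sum_distrib_left sum_distrib_right sum_divide_distrib mult_ac)
  also have "... \<le> exp ((1 / (1 - r)) * (2 / (1 - r)))"
  proof -
    have "(\<Sum>k=1..n. r ^ k) \<le> (\<Sum>k. r ^ k)"
      using r by (intro sum_le_suminf) (auto simp: summable_geometric)
    also have "... = 1 / (1 - r)" using r by (simp add: suminf_geometric)
    finally have "(\<Sum>k=1..n. r ^ k) * (2 / (1 - r)) \<le> (1 / (1 - r)) * (2 / (1 - r))"
      using r by (intro mult_right_mono) auto
    thus ?thesis by (simp only: exp_le_cancel_iff)
  qed
  finally show ?thesis by (simp add: power2_eq_square)
qed

lemma summable_theta4:
  fixes q :: "'a::{real_normed_field,banach}"
  assumes "norm q < 1"
  shows "summable (\<lambda>n. norm ((if n = 0 then 1 else 2) * (-1) ^ n * q ^ (n^2)))"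
proof (rule summable_comparison_test')
  show "summable (\<lambda>n. 2 * norm q ^ n)" using assms by (intro summable_mult summable_geometric) auto
  fix n :: nat assume "n \<ge> 0"
  have "norm q ^ (n^2) \<le> norm q ^ n"
    using assms by (intro power_decreasing) (auto simp: power2_eq_square)
  thus "norm (norm ((if n = 0 then 1 else 2) * (-1) ^ n * q ^ (n^2))) \<le> 2 * norm q ^ n"
    by (auto simp: norm_mult norm_power)
qed

text \<open>
  Gauss's identity. The finite identity says that the product times a partial sum of \<theta>_4 tends to 1.
  As the product is bounded, this forces \<theta>_4 to be nonzero inside the unit disc as well.
\<close>
theorem over_prod_tendsto:
  fixes q :: "'a::{real_normed_field,banach}"
  assumes q: "norm q < 1"
  shows "theta4 q \<noteq> 0" "(\<lambda>n. over_prod n q) \<longlonglongrightarrow> 1 / theta4 q"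
proof -
  define r where "r = norm q"
  have r: "0 \<le> r" "r < 1" using q by (auto simp: r_def)
  define K where "K = exp (2 / (1 - r)^2)"
  define S where "S n = (\<Sum>k\<le>n. (if k = 0 then 1 else 2) * (-1) ^ k * q ^ (k^2))" for n
  have S: "S \<longlonglongrightarrow> theta4 q"
    unfolding S_def theta4_def using summable_norm_cancel[OF summable_theta4[OF q]]
    by (rule summable_LIMSEQ')
  have K: "norm (over_prod n q) \<le> K" for n
    using norm_over_prod_le[OF q, of n] over_prod_bounded[OF r, of n] by (simp add: r_def K_def)
  have bd: "norm (over_prod n q * S n - 1) \<le> 2 * K / (1 - r)^2 * r ^ Suc n" for n
  proof -
    have "over_prod n q * S n = (\<Sum>s\<in>insert 0 {1..n}. (-1) ^ s * over_prod s q * 2 * q ^ (s * Suc n) / (1 + q ^ s))"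
      unfolding S_def shanks_identity[OF q] by (intro sum.cong) auto
    also have "... = 1 + (\<Sum>s=1..n. (-1) ^ s * over_prod s q * 2 * q ^ (s * Suc n) / (1 + q ^ s))"
      by (subst sum.insert) auto
    finally have "norm (over_prod n q * S n - 1)
        \<le> (\<Sum>s=1..n. norm ((-1) ^ s * over_prod s q * 2 * q ^ (s * Suc n) / (1 + q ^ s)))"
      by (simp add: norm_sum)
    also have "... \<le> (\<Sum>s=1..n. (K * 2 * r ^ Suc n / (1 - r)) * r ^ (s - 1))"
    proof (intro sum_mono)
      fix s assume s: "s \<in> {1..n}"
      have "1 - r \<le> 1 - norm (q ^ s)"
        using s r power_decreasing[of 1 s r] by (auto simp: norm_power r_def)
      also have "... \<le> norm (1 + q ^ s)"
        using norm_triangle_ineq2[of 1 "- (q ^ s)"] by simp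
      finally have d: "1 - r \<le> norm (1 + q ^ s)" .
      have "r ^ (s * Suc n) \<le> r ^ (Suc n + (s - 1))"
        using s r by (intro power_decreasing) (auto simp: algebra_simps Suc_le_eq gr0_conv_Suc)
      hence e: "r ^ (s * Suc n) \<le> r ^ Suc n * r ^ (s - 1)" by (simp add: power_add)
      have "norm ((-1) ^ s * over_prod s q * 2 * q ^ (s * Suc n) / (1 + q ^ s))
         = norm (over_prod s q) * 2 * r ^ (s * Suc n) / norm (1 + q ^ s)"
        by (simp add: norm_mult norm_power norm_divide r_def del: power_Suc mult_Suc_right)
      also have "... \<le> K * 2 * (r ^ Suc n * r ^ (s - 1)) / (1 - r)"
        using d e K[of s] r by (intro frac_le mult_mono) (auto simp: K_def)
      finally show "norm ((-1) ^ s * over_prod s q * 2 * q ^ (s * Suc n) / (1 + q ^ s))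
          \<le> (K * 2 * r ^ Suc n / (1 - r)) * r ^ (s - 1)" by (simp add: mult_ac)
    qed
    also have "... = (K * 2 * r ^ Suc n / (1 - r)) * (\<Sum>s<n. r ^ s)"
      unfolding sum_distrib_left by (rule sum.reindex_bij_witness[of _ Suc "\<lambda>s. s - 1"]) auto
    also have "... \<le> (K * 2 * r ^ Suc n / (1 - r)) * (1 / (1 - r))"
    proof (intro mult_left_mono)
      have "(\<Sum>s<n. r ^ s) \<le> (\<Sum>k. r ^ k)"
        using r by (intro sum_le_suminf) (auto simp: summable_geometric)
      also have "... = 1 / (1 - r)" using r by (simp add: suminf_geometric)
      finally show "(\<Sum>s<n. r ^ s) \<le> 1 / (1 - r)" .
    qed (use r in \<open>auto simp: K_def\<close>)
    finally show ?thesis by (simp add: power2_eq_square mult_ac)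
  qed
  have "(\<lambda>n. over_prod n q * S n - 1) \<longlonglongrightarrow> 0"
  proof (rule Lim_null_comparison)
    show "\<forall>\<^sub>F n in sequentially. norm (over_prod n q * S n - 1) \<le> 2 * K / (1 - r)^2 * r ^ Suc n"
      by (intro always_eventually allI bd)
    show "(\<lambda>n. 2 * K / (1 - r)^2 * r ^ Suc n) \<longlonglongrightarrow> 0"
      using r by (intro tendsto_mult_right_zero LIMSEQ_Suc LIMSEQ_power_zero) auto
  qed
  hence one: "(\<lambda>n. over_prod n q * S n) \<longlonglongrightarrow> 1" by (rule LIM_zero_cancel)
  show nz: "theta4 q \<noteq> 0"
  proof
    assume "theta4 q = 0"
    hence "S \<longlonglongrightarrow> 0" using S by simp
    hence 1: "(\<lambda>n. K * norm (S n)) \<longlonglongrightarrow> 0"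
      by (intro tendsto_mult_right_zero tendsto_norm_zero)
    have 2: "norm (over_prod n q * S n) \<le> K * norm (S n)" for n
      unfolding norm_mult by (intro mult_right_mono K) auto
    have "(\<lambda>n. over_prod n q * S n) \<longlonglongrightarrow> 0"
      by (rule Lim_null_comparison[OF always_eventually 1]) (use 2 in blast)
    from LIMSEQ_unique[OF this one] show False by simp
  qed
  have "(\<lambda>n. over_prod n q * S n / S n) \<longlonglongrightarrow> 1 / theta4 q"
    using tendsto_divide[OF one S nz] .
  moreover have "\<forall>\<^sub>F n in sequentially. S n \<noteq> 0" using tendsto_imp_eventually_ne[OF S nz] .
  hence "\<forall>\<^sub>F n in sequentially. over_prod n q * S n / S n = over_prod n q"
    by eventually_elim simp
  ultimately show "(\<lambda>n. over_prod n q) \<longlonglongrightarrow> 1 / theta4 q" by (rule Lim_transform_eventually)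
qed

section \<open>The generating function\<close>

definition overpartitions_in :: "nat set \<Rightarrow> nat \<Rightarrow> (nat multiset \<times> nat set) set" where
  "overpartitions_in S n = {(P, V) \<in> overpartitions n. set_mset P \<subseteq> S}"

lemma finite_overpartitions_in: "finite (overpartitions_in S n)"
  by (rule finite_subset[OF _ finite_overpartitions[of n]]) (auto simp: overpartitions_in_def)

lemma pbar_eq_overpartitions_in:
  "pbar s t n = card (overpartitions_in {m. \<not> s dvd m \<and> \<not> t dvd m} n)"
  unfolding pbar_def overpartitions_in_def by (rule arg_cong[of _ _ card]) auto

lemma overpartitions_in_empty: "overpartitions_in {} n = (if n = 0 then {({#}, {})} else {})"
  by (auto simp: overpartitions_in_def overpartitions_def)

text \<open>
  Deleting the c copies of m loses only the information whether m was overlined, hence the factor 2.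
\<close>
lemma overpartitions_in_fibre:
  assumes m: "m > 0" "m \<notin> S" and c: "c > 0" "m * c \<le> n"
  shows "card {(P, V) \<in> overpartitions_in (insert m S) n. count P m = c}
         = 2 * card (overpartitions_in S (n - m * c))"
proof -
  define f where "f = (\<lambda>((P, V), b). (P + replicate_mset c m, if b then insert m V else V :: nat set))"
  have inj: "inj_on f (overpartitions_in S (n - m * c) \<times> (UNIV :: bool set))"
  proof (rule inj_onI)
    fix x y assume x: "x \<in> overpartitions_in S (n - m * c) \<times> (UNIV :: bool set)"
      and y: "y \<in> overpartitions_in S (n - m * c) \<times> (UNIV :: bool set)" and eq: "f x = f y"
    obtain P V b P' V' b' where xy: "x = ((P, V), b)" "y = ((P', V'), b')" by (metis prod.collapse)
    have V: "m \<notin> V" "m \<notin> V'"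
      using x y m by (auto simp: xy overpartitions_in_def overpartitions_def)
    show "x = y" using eq V by (auto simp: xy f_def split: if_splits)
  qed
  have "{(P, V) \<in> overpartitions_in (insert m S) n. count P m = c}
        = f ` (overpartitions_in S (n - m * c) \<times> UNIV)" (is "?L = ?R")
  proof (intro equalityI subsetI)
    fix x assume "x \<in> ?L"
    then obtain P V where x: "x = (P, V)" and PV: "(P, V) \<in> overpartitions_in (insert m S) n"
      and cnt: "count P m = c" by auto
    define P' where "P' = filter_mset (\<lambda>a. a \<noteq> m) P"
    have P: "P = P' + replicate_mset c m"
      by (rule multiset_eqI) (auto simp: P'_def cnt)
    have "sum_mset P = sum_mset P' + m * c" by (subst P) (simp add: mult.commute)
    hence "(P', V - {m}) \<in> overpartitions_in S (n - m * c)"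
      using PV by (auto simp: overpartitions_in_def overpartitions_def P'_def)
    moreover have "x = f ((P', V - {m}), m \<in> V)"
      using P by (auto simp: f_def x)
    ultimately show "x \<in> ?R" by blast
  next
    fix x assume "x \<in> ?R"
    then obtain P V b where x: "x = f ((P, V), b)" and PV: "(P, V) \<in> overpartitions_in S (n - m * c)"
      by auto
    have "count P m = 0" using PV m by (auto simp: overpartitions_in_def not_in_iff[symmetric])
    thus "x \<in> ?L"
      using PV m c by (auto simp: x f_def overpartitions_in_def overpartitions_def mult.commute)
  qed
  hence "card ?L = card (overpartitions_in S (n - m * c) \<times> (UNIV :: bool set))"
    using card_image[OF inj] by simp
  thus ?thesis by (simp add: card_cartesian_product)
qed

text \<open>
  The coefficient of q^i in (1 + q^m) / (1 - q^m).
\<close>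
definition part_weight :: "nat \<Rightarrow> nat \<Rightarrow> nat" where
  "part_weight m i = (if i = 0 then 1 else if m dvd i then 2 else 0)"

lemma card_overpartitions_in_insert:
  assumes m: "m > 0" "m \<notin> S"
  shows "card (overpartitions_in (insert m S) n)
         = (\<Sum>i\<le>n. part_weight m i * card (overpartitions_in S (n - i)))"
proof -
  define B where "B i = {(P, V) \<in> overpartitions_in (insert m S) n. m * count P m = i}" for i
  have fin: "finite (B i)" for i
    unfolding B_def by (rule finite_subset[OF _ finite_overpartitions_in[of "insert m S" n]]) auto
  have "overpartitions_in (insert m S) n = (\<Union>i\<le>n. B i)"
  proof (intro equalityI subsetI)
    fix x assume x: "x \<in> overpartitions_in (insert m S) n"
    obtain P V where PV: "x = (P, V)" by force
    have "P = filter_mset (\<lambda>a. a \<noteq> m) P + replicate_mset (count P m) m"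
      by (rule multiset_eqI) auto
    hence "sum_mset P = sum_mset (filter_mset (\<lambda>a. a \<noteq> m) P) + m * count P m"
      by (metis sum_mset.union sum_mset_replicate_mset mult.commute of_nat_id)
    hence "m * count P m \<le> n" using x by (auto simp: PV overpartitions_in_def overpartitions_def)
    thus "x \<in> (\<Union>i\<le>n. B i)" using x by (auto simp: B_def PV)
  qed (auto simp: B_def)
  also have "card ... = (\<Sum>i\<le>n. card (B i))"
    by (rule card_UN_disjoint) (use fin in auto, auto simp: B_def)
  also have "... = (\<Sum>i\<le>n. part_weight m i * card (overpartitions_in S (n - i)))"
  proof (rule sum.cong)
    fix i assume i: "i \<in> {..n}"
    consider "i = 0" | c where "i = m * c" "c > 0" | "\<not> m dvd i" by (metis dvdE gr0I mult_0_right)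
    thus "card (B i) = part_weight m i * card (overpartitions_in S (n - i))"
    proof cases
      case 1
      have "B 0 = overpartitions_in S n"
        using m by (auto simp: B_def overpartitions_in_def count_eq_zero_iff)
      thus ?thesis by (simp add: 1 part_weight_def)
    next
      case 2
      have "B i = {(P, V) \<in> overpartitions_in (insert m S) n. count P m = c}"
        using m by (auto simp: B_def 2)
      thus ?thesis using overpartitions_in_fibre[OF m, of c n] i 2 m by (simp add: part_weight_def)
    next
      case 3
      hence "B i = {}" by (auto simp: B_def)
      moreover have "i \<noteq> 0" using 3 by (metis dvd_0_right)
      ultimately show ?thesis using 3 by (simp add: part_weight_def)
    qed
  qed simp
  finally show ?thesis .
qed

lemma part_weight_sums:
  fixes q :: "'a::{real_normed_field,banach}"
  assumes "norm q < 1" and m: "m > 0"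
  shows "summable (\<lambda>i. norm (of_nat (part_weight m i) * q ^ i))"
    and "(\<lambda>i. of_nat (part_weight m i) * q ^ i) sums ((1 + q ^ m) / (1 - q ^ m))"
proof -
  show "summable (\<lambda>i. norm (of_nat (part_weight m i) * q ^ i))"
  proof (rule summable_comparison_test')
    show "summable (\<lambda>n. 2 * norm q ^ n)" using assms by (intro summable_mult summable_geometric) auto
    show "norm (norm (of_nat (part_weight m n) * q ^ n)) \<le> 2 * norm q ^ n" for n
      by (auto simp: part_weight_def norm_mult norm_power)
  qed
  have qm: "norm (q ^ m) < 1" using assms by (simp add: norm_power power_less_one_iff)
  have ne: "1 - q ^ m \<noteq> 0" using qm by auto
  have "(\<lambda>j. 2 * (q ^ m) ^ j - (if j = 0 then 1 else 0)) sums (2 * (1 / (1 - q ^ m)) - 1)"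
    by (intro sums_diff sums_mult geometric_sums qm sums_single)
  also have "2 * (1 / (1 - q ^ m)) - 1 = (1 + q ^ m) / (1 - q ^ m)"
    using ne by (simp add: field_simps)
  also have "(\<lambda>j. 2 * (q ^ m) ^ j - (if j = 0 then 1 else 0))
       = (\<lambda>j. of_nat (part_weight m (m * j)) * q ^ (m * j))"
    using m by (auto simp: fun_eq_iff part_weight_def power_mult)
  finally have *: "(\<lambda>j. of_nat (part_weight m (m * j)) * q ^ (m * j)) sums ((1 + q ^ m) / (1 - q ^ m))" .
  show "(\<lambda>i. of_nat (part_weight m i) * q ^ i) sums ((1 + q ^ m) / (1 - q ^ m))"
  proof (subst sums_mono_reindex[symmetric, where g = "\<lambda>j. m * j"])
    show "strict_mono (\<lambda>j. m * j)" using m by (auto simp: strict_mono_def)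
    show "of_nat (part_weight m i) * q ^ i = 0" if "i \<notin> range ((*) m)" for i
      using that by (auto simp: part_weight_def)
  qed (use * in auto)
qed

lemma card_overpartitions_in_insert_power:
  fixes q :: "'a::{real_normed_field,banach}"
  assumes "m > 0" "m \<notin> S"
  shows "of_nat (card (overpartitions_in (insert m S) n)) * q ^ n
    = (\<Sum>i\<le>n. (of_nat (part_weight m i) * q ^ i) * (of_nat (card (overpartitions_in S (n - i))) * q ^ (n - i)))"
  unfolding card_overpartitions_in_insert[OF assms] of_nat_sum sum_distrib_right
  by (intro sum.cong refl) (simp add: mult_ac flip: power_add)

lemma summable_overpartitions_in:
  fixes q :: "'a::{real_normed_field,banach}"
  assumes q: "norm q < 1" and S: "finite S" "0 \<notin> S"
  shows "summable (\<lambda>n. norm (of_nat (card (overpartitions_in S n)) * q ^ n))"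
proof -
  define r where "r = norm q"
  have r: "norm r < 1" using q by (simp add: r_def)
  have "summable (\<lambda>n. real (card (overpartitions_in S n)) * r ^ n)"
    using S
  proof (induction S rule: finite_induct)
    case empty
    show ?case by (rule summable_finite[of "{0}"]) (auto simp: overpartitions_in_empty)
  next
    case (insert m S)
    have "summable (\<lambda>n. \<Sum>i\<le>n. (real (part_weight m i) * r ^ i) * (real (card (overpartitions_in S (n - i))) * r ^ (n - i)))"
      using insert part_weight_sums(1)[OF r, of m]
      by (intro summable_Cauchy_product) (auto simp: r_def)
    thus ?case using insert by (subst card_overpartitions_in_insert_power) auto
  qed
  thus ?thesis by (simp add: norm_mult norm_power r_def)
qed

lemma overpartitions_in_sums:
  fixes q :: "'a::{real_normed_field,banach}"
  assumes q: "norm q < 1" and "finite S" "0 \<notin> S"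
  shows "(\<lambda>n. of_nat (card (overpartitions_in S n)) * q ^ n) sums (\<Prod>m\<in>S. (1 + q ^ m) / (1 - q ^ m))"
  using assms(2,3)
proof (induction S rule: finite_induct)
  case empty
  have "(\<lambda>n. of_nat (card (overpartitions_in {} n)) * q ^ n) = (\<lambda>n. if n = 0 then 1 else 0)"
    by (auto simp: overpartitions_in_empty)
  thus ?case using sums_single[of 0 "\<lambda>_. 1 :: 'a"] by simp
next
  case (insert m S)
  have m: "m > 0" "m \<notin> S" using insert by auto
  have "(\<lambda>n. \<Sum>i\<le>n. (of_nat (part_weight m i) * q ^ i) * (of_nat (card (overpartitions_in S (n - i))) * q ^ (n - i)))
     sums ((\<Sum>i. of_nat (part_weight m i) * q ^ i) * (\<Sum>i. of_nat (card (overpartitions_in S i)) * q ^ i))"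
    using insert m by (intro Cauchy_product_sums part_weight_sums summable_overpartitions_in q) auto
  thus ?case
    using insert m sums_unique[OF part_weight_sums(2)[OF q m(1)]] sums_unique[OF insert.IH]
    by (subst card_overpartitions_in_insert_power) auto
qed

lemma prod_multiples:
  fixes f :: "nat \<Rightarrow> 'a::comm_monoid_mult"
  assumes "d > 0"
  shows "(\<Prod>m\<in>{m\<in>{1..d * k}. d dvd m}. f m) = (\<Prod>j=1..k. f (d * j))"
  by (rule prod.reindex_bij_witness[of _ "\<lambda>j. d * j" "\<lambda>m. m div d"]) (use assms in \<open>auto simp: Suc_le_eq\<close>)

text \<open>
  Inclusion and exclusion: by coprimality the common multiples of s and t are the multiples of st,
  and the multiples of d up to d k contribute the overpartition product in q^d.
\<close>
lemma prod_nonmultiples: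
  fixes q :: "'a::real_normed_field"
  assumes q: "norm q < 1" and st: "coprime s t" "s > 0" "t > 0"
  shows "(\<Prod>m\<in>{m\<in>{1..s * t * k}. \<not> s dvd m \<and> \<not> t dvd m}. (1 + q ^ m) / (1 - q ^ m))
    = over_prod (s * t * k) q * over_prod k (q ^ (s * t)) / (over_prod (t * k) (q ^ s) * over_prod (s * k) (q ^ t))"
proof -
  define f where "f m = (1 + q ^ m) / (1 - q ^ m)" for m
  have f0: "f m \<noteq> 0" if "m > 0" for m
    using power_ne_one[OF q that] by (auto simp: f_def add_eq_0_iff)
  define A where "A d = {m\<in>{1..s * t * k}. d dvd m}" for d
  have A: "(\<Prod>m\<in>A d. f m) = over_prod j (q ^ d)" if "d > 0" "s * t * k = d * j" for d j
    unfolding A_def that(2) by (subst prod_multiples) (auto simp: that over_prod_def f_def power_mult)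
  have As: "(\<Prod>m\<in>A s. f m) = over_prod (t * k) (q ^ s)" by (rule A) (use st in auto)
  have At: "(\<Prod>m\<in>A t. f m) = over_prod (s * k) (q ^ t)" by (rule A) (use st in auto)
  have Ast: "(\<Prod>m\<in>A (s * t). f m) = over_prod k (q ^ (s * t))" by (rule A) (use st in auto)
  have int: "A s \<inter> A t = A (s * t)"
    using st by (auto simp: A_def intro: divides_mult)
  have nz: "(\<Prod>m\<in>A d. f m) \<noteq> 0" for d
    by (auto simp: A_def f0)
  define X where "X = (\<Prod>m\<in>{m\<in>{1..s * t * k}. \<not> s dvd m \<and> \<not> t dvd m}. f m)"
  have 1: "X * (\<Prod>m\<in>A s \<union> A t. f m) = over_prod (s * t * k) q"
  proof -
    have "X * (\<Prod>m\<in>A s \<union> A t. f m) = (\<Prod>m\<in>{m\<in>{1..s * t * k}. \<not> s dvd m \<and> \<not> t dvd m} \<union> (A s \<union> A t). f m)"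
      unfolding X_def by (rule prod.union_disjoint[symmetric]) (auto simp: A_def)
    also have "... = (\<Prod>m\<in>{1..s * t * k}. f m)"
      by (rule prod.cong) (auto simp: A_def)
    finally show ?thesis by (simp add: over_prod_def f_def)
  qed
  have 2: "(\<Prod>m\<in>A s \<union> A t. f m) * (\<Prod>m\<in>A (s * t). f m) = (\<Prod>m\<in>A s. f m) * (\<Prod>m\<in>A t. f m)"
    unfolding int[symmetric] by (rule prod.union_inter) (auto simp: A_def)
  define U where "U = (\<Prod>m\<in>A s \<union> A t. f m)"
  have "X * (over_prod (t * k) (q ^ s) * over_prod (s * k) (q ^ t))
        = over_prod (s * t * k) q * over_prod k (q ^ (s * t))"
    unfolding As[symmetric] At[symmetric] Ast[symmetric] 1[symmetric] 2[symmetric] by (simp add: mult_ac)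
  thus ?thesis
    using nz[of s] nz[of t] unfolding As At X_def[symmetric] f_def[symmetric] by (simp add: eq_divide_eq)
qed

text \<open>
  Parts are first restricted to at most s t k. The coefficients then increase with k and are
  eventually constant, so they are dominated by the final ones, whose series converges because its
  partial sums are bounded by \<open>over_prod_bounded\<close>; Tannery's theorem lets k tend to infinity.
\<close>
theorem pbar_sums:
  fixes q :: "'a::{real_normed_field,banach}"
  assumes q: "norm q < 1" and st: "coprime s t" "s > 0" "t > 0"
  shows "summable (\<lambda>n. real (pbar s t n) * norm q ^ n)"
    and "(\<lambda>n. of_nat (pbar s t n) * q ^ n) sums
           (theta4 (q ^ s) * theta4 (q ^ t) / (theta4 q * theta4 (q ^ (s * t))))"
proof -
  define r where "r = norm q"
  have r: "0 \<le> r" "r < 1" using q by (auto simp: r_def)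
  define S where "S k = {m\<in>{1..s * t * k}. \<not> s dvd m \<and> \<not> t dvd m}" for k
  define c where "c k n = card (overpartitions_in (S k) n)" for k n
  have S: "finite (S k)" "0 \<notin> S k" for k by (auto simp: S_def)
  have c_le: "c k n \<le> pbar s t n" for k n
    unfolding c_def pbar_eq_overpartitions_in
    by (rule card_mono[OF finite_overpartitions_in]) (auto simp: overpartitions_in_def S_def)
  have c_eq: "c k n = pbar s t n" if "n \<le> k" for k n
  proof -
    have k: "k \<le> s * t * k" using st by auto
    have "m \<le> s * t * k" if m: "m \<in># P" "sum_mset P = n" for m P
    proof -
      have "m \<le> n" using sum_mset.remove[OF m(1)] m(2) by linarith
      thus ?thesis using \<open>n \<le> k\<close> k by linarith
    qed
    moreover have "m \<ge> 1" if "\<not> s dvd m" for m using that by (cases m) auto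
    ultimately have "(P, V) \<in> overpartitions_in (S k) n \<longleftrightarrow>
        (P, V) \<in> overpartitions_in {m. \<not> s dvd m \<and> \<not> t dvd m} n" for P V
      unfolding overpartitions_in_def overpartitions_def S_def subset_iff by auto
    hence "overpartitions_in (S k) n = overpartitions_in {m. \<not> s dvd m \<and> \<not> t dvd m} n" by auto
    thus ?thesis unfolding c_def pbar_eq_overpartitions_in by simp
  qed
  show sm: "summable (\<lambda>n. real (pbar s t n) * norm q ^ n)"
    unfolding r_def[symmetric]
  proof (rule bounded_imp_summable)
    fix n
    have "(\<Sum>i\<le>n. real (pbar s t i) * r ^ i) = (\<Sum>i\<le>n. real (c n i) * r ^ i)"
      by (intro sum.cong) (auto simp: c_eq)
    also have "... \<le> (\<Sum>i. real (c n i) * r ^ i)"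
      using summable_overpartitions_in[of r "S n"] r S[of n] by (intro sum_le_suminf) (auto simp: c_def)
    also have "... = (\<Prod>m\<in>S n. (1 + r ^ m) / (1 - r ^ m))"
      using sums_unique[OF overpartitions_in_sums[of r "S n"]] r S[of n] by (simp add: c_def)
    also have "... \<le> over_prod (s * t * n) r"
      unfolding over_prod_def
    proof (rule prod_mono2)
      fix b assume b: "b \<in> {1..s * t * n} - S n"
      have "r ^ b < 1" using b r by (simp add: power_less_one_iff)
      moreover have "r ^ b \<ge> 0" using r by simp
      ultimately show "1 \<le> (1 + r ^ b) / (1 - r ^ b)" by (simp add: field_simps)
    next
      fix b assume "b \<in> S n"
      thus "0 \<le> (1 + r ^ b) / (1 - r ^ b)" using r by (auto intro!: divide_nonneg_nonneg simp: power_le_one)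
    qed (auto simp: S_def)
    also have "... \<le> exp (2 / (1 - r)^2)" by (rule over_prod_bounded[OF r])
    finally show "(\<Sum>i\<le>n. real (pbar s t i) * r ^ i) \<le> exp (2 / (1 - r)^2)" .
  qed (use r in auto)
  define F where "F = theta4 (q ^ s) * theta4 (q ^ t) / (theta4 q * theta4 (q ^ (s * t)))"
  have lim: "(\<lambda>k. \<Sum>n. of_nat (c k n) * q ^ n) \<longlonglongrightarrow> F"
  proof -
    have qs: "norm (q ^ d) < 1" if "d > 0" for d
      using q that by (simp add: norm_power power_less_one_iff)
    have L: "(\<lambda>k. over_prod (d * k) (q ^ e)) \<longlonglongrightarrow> 1 / theta4 (q ^ e)" if "d > 0" "e > 0" for d e
      using LIMSEQ_subseq_LIMSEQ[OF over_prod_tendsto(2)[OF qs[OF that(2)]], of "\<lambda>k. d * k"] that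
      by (simp add: o_def strict_mono_def)
    have nz: "theta4 (q ^ e) \<noteq> 0" if "e > 0" for e using over_prod_tendsto(1)[OF qs[OF that]] .
    have "(\<lambda>k. over_prod (s * t * k) q * over_prod k (q ^ (s * t)) / (over_prod (t * k) (q ^ s) * over_prod (s * k) (q ^ t)))
      \<longlonglongrightarrow> (1 / theta4 q) * (1 / theta4 (q ^ (s * t))) / ((1 / theta4 (q ^ s)) * (1 / theta4 (q ^ t)))"
      using L[of "s * t" 1] L[of 1 "s * t"] L[of t s] L[of s t] nz[of s] nz[of t] st
      by (intro tendsto_divide tendsto_mult) auto
    also have "(1 / theta4 q) * (1 / theta4 (q ^ (s * t))) / ((1 / theta4 (q ^ s)) * (1 / theta4 (q ^ t))) = F"
      by (simp add: F_def)
    finally show ?thesis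
      unfolding c_def using sums_unique[OF overpartitions_in_sums[OF q S]] prod_nonmultiples[OF q st]
      by (simp add: S_def)
  qed
  have "(\<lambda>k. \<Sum>n. of_nat (c k n) * q ^ n) \<longlonglongrightarrow> (\<Sum>n. of_nat (pbar s t n) * q ^ n)"
  proof (rule tannerys_theorem[THEN conjunct2, THEN conjunct2])
    fix n
    have "\<forall>\<^sub>F k in sequentially. of_nat (pbar s t n) * q ^ n = of_nat (c k n) * q ^ n"
      using eventually_ge_at_top[of n] by eventually_elim (simp add: c_eq)
    thus "(\<lambda>k. of_nat (c k n) * q ^ n) \<longlonglongrightarrow> of_nat (pbar s t n) * q ^ n"
      by (rule Lim_transform_eventually[OF tendsto_const])
  next
    show "\<forall>\<^sub>F (n, k) in sequentially \<times>\<^sub>F sequentially. norm (of_nat (c k n) * q ^ n) \<le> real (pbar s t n) * norm q ^ n"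
      by (rule always_eventually) (auto simp: norm_mult norm_power c_le intro!: mult_right_mono)
  qed (use sm in auto)
  hence "(\<Sum>n. of_nat (pbar s t n) * q ^ n) = F" using LIMSEQ_unique lim by blast
  moreover have "summable (\<lambda>n. of_nat (pbar s t n) * q ^ n)"
    using sm by (intro summable_norm_cancel[of "\<lambda>n. of_nat (pbar s t n) * q ^ n"]) (simp add: norm_mult norm_power)
  ultimately show "(\<lambda>n. of_nat (pbar s t n) * q ^ n) sums
           (theta4 (q ^ s) * theta4 (q ^ t) / (theta4 q * theta4 (q ^ (s * t))))"
    by (simp add: F_def sums_iff)
qed

section \<open>Polya's finite theta identity\<close>

lemma sum_centred:
  fixes g :: "nat \<Rightarrow> 'a::comm_monoid_add"
  shows "(\<Sum>k\<le>2 * m. g k) = g m + (\<Sum>j=1..m. g (m + j) + g (m - j))"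
proof -
  have "{..2 * m} = {m} \<union> ({m + 1..2 * m} \<union> {..<m})" by auto
  hence "(\<Sum>k\<le>2 * m. g k) = (\<Sum>k\<in>{m} \<union> ({m + 1..2 * m} \<union> {..<m}). g k)" by simp
  also have "... = g m + ((\<Sum>k\<in>{m + 1..2 * m}. g k) + (\<Sum>k<m. g k))"
    by (subst sum.union_disjoint; (subst sum.union_disjoint)?; auto)
  also have "(\<Sum>k\<in>{m + 1..2 * m}. g k) = (\<Sum>j=1..m. g (m + j))"
    by (rule sum.reindex_bij_witness[of _ "\<lambda>j. m + j" "\<lambda>k. k - m"]) auto
  also have "(\<Sum>k<m. g k) = (\<Sum>j=1..m. g (m - j))"
    by (rule sum.reindex_bij_witness[of _ "\<lambda>j. m - j" "\<lambda>k. m - k"]) auto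
  finally show ?thesis by (simp add: sum.distrib)
qed

lemma two_cos_power_even:
  "(2 * cos \<theta>) ^ (2 * m) = real (2 * m choose m) + 2 * (\<Sum>j=1..m. real (2 * m choose (m + j)) * cos (2 * real j * \<theta>))"
proof -
  have "complex_of_real ((2 * cos \<theta>) ^ (2 * m)) = (cis \<theta> + cis (- \<theta>)) ^ (2 * m)"
    by (simp add: complex_eq_iff)
  also have "... = (\<Sum>k\<le>2 * m. of_nat (2 * m choose k) * cis \<theta> ^ k * cis (- \<theta>) ^ (2 * m - k))"
    by (rule binomial_ring)
  also have "... = (\<Sum>k\<le>2 * m. of_nat (2 * m choose k) * cis ((2 * real k - 2 * real m) * \<theta>))"
    by (intro sum.cong refl) (simp add: Complex.DeMoivre cis_mult mult.assoc of_nat_diff algebra_simps)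
  finally have "Re (complex_of_real ((2 * cos \<theta>) ^ (2 * m))) = Re (\<Sum>k\<le>2 * m. of_nat (2 * m choose k) * cis ((2 * real k - 2 * real m) * \<theta>))"
    by (rule arg_cong)
  hence "(2 * cos \<theta>) ^ (2 * m) = (\<Sum>k\<le>2 * m. real (2 * m choose k) * cos ((2 * real k - 2 * real m) * \<theta>))"
    by simp
  also have "... = real (2 * m choose m) + (\<Sum>j=1..m. real (2 * m choose (m + j)) * cos (2 * real j * \<theta>) * 2)"
    unfolding sum_centred
  proof (intro arg_cong2[of _ _ _ _ "(+)"] sum.cong)
    fix j assume j: "j \<in> {1..m}"
    have "2 * m choose (m - j) = 2 * m choose (m + j)"
      using j by (subst binomial_symmetric) (auto intro!: arg_cong2[of _ _ _ _ binomial])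
    moreover have "cos ((2 * real (m - j) - 2 * real m) * \<theta>) = cos (2 * real j * \<theta>)"
    proof -
      have "(2 * real (m - j) - 2 * real m) * \<theta> = - (2 * real j * \<theta>)"
        using j by (simp add: of_nat_diff algebra_simps)
      thus ?thesis by simp
    qed
    ultimately show "real (2 * m choose (m + j)) * cos ((2 * real (m + j) - 2 * real m) * \<theta>)
          + real (2 * m choose (m - j)) * cos ((2 * real (m - j) - 2 * real m) * \<theta>)
        = real (2 * m choose (m + j)) * cos (2 * real j * \<theta>) * 2"
      by simp
  qed auto
  finally show ?thesis by (simp add: sum_distrib_left mult_ac)
qed

text \<open>
  If l does not divide j, multiplying by 2 sin(\<pi> j / l) makes the sum telescope to sin(2 \<pi> j) = 0.
\<close>
lemma sum_cos_odd_multiples: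
  assumes "l > 0"
  shows "(\<Sum>\<nu><l. cos (pi * (2 * real \<nu> + 1) * real j / real l))
         = (if l dvd j then real l * (-1) ^ (j div l) else 0)"
proof (cases "l dvd j")
  case True
  then obtain i where j: "j = l * i" by blast
  have "cos (pi * (2 * real \<nu> + 1) * real j / real l) = (-1) ^ i" for \<nu>
  proof -
    have "pi * (2 * real \<nu> + 1) * real j / real l = real ((2 * \<nu> + 1) * i) * pi"
      using assms by (simp add: j field_simps)
    hence "cos (pi * (2 * real \<nu> + 1) * real j / real l) = (-1) ^ ((2 * \<nu> + 1) * i)"
      by (simp only: cos_npi)
    also have "... = ((-1) ^ (2 * \<nu> + 1)) ^ i" by (rule power_mult)
    finally show ?thesis by simp
  qed
  thus ?thesis using assms by (simp add: j)
next
  case False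
  define a where "a = pi * real j / real l"
  have "2 * sin a * (\<Sum>\<nu><l. cos (pi * (2 * real \<nu> + 1) * real j / real l))
      = (\<Sum>\<nu><l. sin (2 * real (Suc \<nu>) * a) - sin (2 * real \<nu> * a))"
    unfolding sum_distrib_left
  proof (intro sum.cong refl)
    fix \<nu>
    define b where "b = pi * (2 * real \<nu> + 1) * real j / real l"
    have "2 * real (Suc \<nu>) * a = b + a" "2 * real \<nu> * a = b - a"
      using assms by (simp_all add: a_def b_def field_simps)
    thus "2 * sin a * cos b = sin (2 * real (Suc \<nu>) * a) - sin (2 * real \<nu> * a)"
      by (simp add: sin_add sin_diff)
  qed
  also have "... = sin (2 * real l * a) - sin (2 * real 0 * a)"
    by (rule sum_lessThan_telescope)
  also have "2 * real l * a = 2 * real j * pi" using assms by (simp add: a_def)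
  finally have "2 * sin a * (\<Sum>\<nu><l. cos (pi * (2 * real \<nu> + 1) * real j / real l)) = 0"
    by (metis diff_self mult_zero_right mult_zero_left of_nat_0 sin_zero sin_2npi mult.commute mult.left_commute)
  moreover have "sin a \<noteq> 0"
  proof
    assume "sin a = 0"
    then obtain i :: int where "a = of_int i * pi" by (auto simp: sin_zero_iff_int2)
    hence "real j = of_int i * real l" using assms by (simp add: a_def field_simps)
    hence "int j = i * int l" by (metis of_int_eq_iff of_int_mult of_int_of_nat_eq)
    hence "int l dvd int j" by simp
    thus False using False by simp
  qed
  ultimately show ?thesis using False by simp
qed

text \<open>
  Binomial coefficients near the centre, normalised by the central one; they approximate exp(-k^2 / m).
\<close>
definition binom_ratio :: "nat \<Rightarrow> nat \<Rightarrow> real" where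
  "binom_ratio m k = real (2 * m choose (m + k)) / real (2 * m choose m)"

text \<open>
  Polya's route to the theta inversion: expand (w + 1/w)^(2m) and sum over the l-th roots w^2 of -1.
  Only the exponents divisible by l survive, with alternating signs. If m and l grow with
  l^2 / m fixed, the left-hand side becomes a theta series and so does the right-hand side.
\<close>
lemma polya_identity:
  assumes l: "l > 0"
  shows "(\<Sum>i. (if i = 0 then 1 else 2) * (-1) ^ i * binom_ratio m (l * i))
       = 4 ^ m / (real l * real (2 * m choose m)) * (\<Sum>\<nu><l. cos (pi * (2 * real \<nu> + 1) / (2 * real l)) ^ (2 * m))"
proof -
  define C where "C = real (2 * m choose m)"
  have C: "C > 0" by (simp add: C_def)
  have "4 ^ m * (\<Sum>\<nu><l. cos (pi * (2 * real \<nu> + 1) / (2 * real l)) ^ (2 * m))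
      = (\<Sum>\<nu><l. (2 * cos (pi * (2 * real \<nu> + 1) / (2 * real l))) ^ (2 * m))"
    by (simp add: sum_distrib_left power_mult power_mult_distrib)
  also have "... = (\<Sum>\<nu><l. C + 2 * (\<Sum>j=1..m. real (2 * m choose (m + j)) * cos (pi * (2 * real \<nu> + 1) * real j / real l)))"
    unfolding two_cos_power_even C_def using l
    by (intro sum.cong arg_cong2[of _ _ _ _ "(+)"] arg_cong2[of _ _ _ _ "(*)"] refl arg_cong[of _ _ cos]) (simp add: field_simps)
  also have "... = real l * C + 2 * (\<Sum>j=1..m. real (2 * m choose (m + j)) * (\<Sum>\<nu><l. cos (pi * (2 * real \<nu> + 1) * real j / real l)))"
    unfolding sum_distrib_left by (subst sum.swap) (simp add: sum.distrib sum_distrib_left)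
  also have "... = real l * C + 2 * (\<Sum>j=1..m. if l dvd j then real (2 * m choose (m + j)) * real l * (-1) ^ (j div l) else 0)"
    unfolding sum_cos_odd_multiples[OF l] by (intro arg_cong2[of _ _ _ _ "(+)"] arg_cong2[of _ _ _ _ "(*)"] refl sum.cong) auto
  also have "(\<Sum>j=1..m. if l dvd j then real (2 * m choose (m + j)) * real l * (-1) ^ (j div l) else 0)
      = (\<Sum>j\<in>{j\<in>{1..l * m}. l dvd j}. real (2 * m choose (m + j)) * real l * (-1) ^ (j div l))"
    unfolding sum.If_cases[OF finite_atLeastAtMost] sum.neutral_const add_0_right
  proof (rule sum.mono_neutral_left)
    show "{1..m} \<inter> {j. l dvd j} \<subseteq> {j \<in> {1..l * m}. l dvd j}"
    proof -
      have "m \<le> l * m" using l by simp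
      thus ?thesis by (auto intro: order_trans[of _ m])
    qed
  qed auto
  also have "... = (\<Sum>i=1..m. real (2 * m choose (m + l * i)) * real l * (-1) ^ i)"
    by (rule sum.reindex_bij_witness[of _ "\<lambda>i. l * i" "\<lambda>j. j div l"]) (use l in \<open>auto simp: Suc_le_eq\<close>)
  finally have *: "4 ^ m * (\<Sum>\<nu><l. cos (pi * (2 * real \<nu> + 1) / (2 * real l)) ^ (2 * m))
       = real l * C + 2 * (\<Sum>i=1..m. real (2 * m choose (m + l * i)) * real l * (-1) ^ i)" .
  have "(\<Sum>i. (if i = 0 then 1 else 2) * (-1) ^ i * binom_ratio m (l * i))
      = (\<Sum>i\<in>insert 0 {1..m}. (if i = 0 then 1 else 2) * (-1) ^ i * binom_ratio m (l * i))"
  proof (rule suminf_finite)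
    fix i assume "i \<notin> insert 0 {1..m}"
    hence "i > m" by auto
    moreover have "i \<le> l * i" using l by simp
    ultimately have "m + l * i > 2 * m" by linarith
    thus "(if i = 0 then 1 else 2) * (-1) ^ i * binom_ratio m (l * i) = 0"
      by (simp add: binom_ratio_def)
  qed auto
  also have "... = 1 + 2 * (\<Sum>i=1..m. real (2 * m choose (m + l * i)) * (-1) ^ i) / C"
    using C by (subst sum.insert) (auto simp: binom_ratio_def C_def sum_distrib_left sum_divide_distrib intro!: sum.cong)
  also have "... = (real l * C + 2 * (\<Sum>i=1..m. real (2 * m choose (m + l * i)) * real l * (-1) ^ i)) / (real l * C)"
  proof -
    have "(\<Sum>i=1..m. real (2 * m choose (m + l * i)) * real l * (-1) ^ i) = real l * (\<Sum>i=1..m. real (2 * m choose (m + l * i)) * (-1) ^ i)"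
      unfolding sum_distrib_left by (intro sum.cong) auto
    thus ?thesis using C l by (simp add: field_simps)
  qed
  finally show ?thesis unfolding *[symmetric] by (simp add: C_def)
qed

lemma binom_ratio_eq_prod:
  assumes "k \<le> m"
  shows "binom_ratio m k = (\<Prod>j=1..k. 1 - real k / real (m + j))"
proof -
  have "binom_ratio m k = (fact m * fact m) / (fact (m + k) * fact (m - k))"
    using assms by (simp add: binom_ratio_def binomial_fact)
  also have "fact (m + k) = (fact m * (\<Prod>j=1..k. real (m + j)) :: real)"
    by (induction k) (auto simp: algebra_simps)
  also have "(fact m :: real) = fact (m - k) * (\<Prod>j=1..k. real (m - k + j))"
  proof -
    have "fact (m' + k) = (fact m' * (\<Prod>j=1..k. real (m' + j)) :: real)" for m'
      by (induction k) (auto simp: algebra_simps)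
    from this[of "m - k"] show ?thesis using assms by simp
  qed
  finally have "binom_ratio m k = (fact (m - k) * (\<Prod>j=1..k. real (m - k + j)) * fact m) / ((fact m * (\<Prod>j=1..k. real (m + j))) * fact (m - k))"
    by (simp add: binom_ratio_def)
  hence "binom_ratio m k = (\<Prod>j=1..k. real (m - k + j)) / (\<Prod>j=1..k. real (m + j))" by simp
  also have "... = (\<Prod>j=1..k. 1 - real k / real (m + j))"
    unfolding prod_dividef[symmetric] using assms
    by (intro prod.cong refl) (auto simp: field_simps of_nat_diff)
  finally show ?thesis .
qed

text \<open>
  Both bounds estimate the factors 1 - k / (m + j): the upper one at j = k, the lower one by 1 - k / m.
\<close>
lemma binom_ratio_bounds:
  assumes k: "k \<le> m" and m: "m > 0"
  shows "binom_ratio m k \<le> exp (- (real k ^ 2 / (real m + real k)))"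
    and "2 * k \<le> m \<Longrightarrow> exp (- (real k ^ 2 / real m) - 2 * real k ^ 3 / real m ^ 2) \<le> binom_ratio m k"
proof -
  have "binom_ratio m k \<le> (\<Prod>j=1..k. exp (- (real k / (real m + real k))))"
    unfolding binom_ratio_eq_prod[OF k]
  proof (intro prod_mono conjI)
    fix j assume j: "j \<in> {1..k}"
    show "0 \<le> 1 - real k / real (m + j)" using k m by (simp add: field_simps)
    have "1 - real k / real (m + j) \<le> 1 - real k / (real m + real k)"
      using j m by (intro diff_left_mono divide_left_mono) (auto intro!: mult_pos_pos)
    also have "... \<le> exp (- (real k / (real m + real k)))"
      using exp_ge_add_one_self[of "- (real k / (real m + real k))"] by simp
    finally show "1 - real k / real (m + j) \<le> exp (- (real k / (real m + real k)))" .
  qed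
  also have "... = exp (- (real k ^ 2 / (real m + real k)))"
    by (simp add: exp_of_nat_mult[symmetric] power2_eq_square)
  finally show "binom_ratio m k \<le> exp (- (real k ^ 2 / (real m + real k)))" .
  assume k2: "2 * k \<le> m"
  define v where "v = real k / real m"
  have v: "0 \<le> v" "v \<le> 1 / 2" using k2 m by (auto simp: v_def field_simps)
  have "exp (- (real k ^ 2 / real m) - 2 * real k ^ 3 / real m ^ 2) = (\<Prod>j=1..k. exp (- v - 2 * v^2))"
    using m by (simp add: exp_of_nat_mult[symmetric] v_def power2_eq_square power3_eq_cube field_simps)
  also have "... \<le> binom_ratio m k"
    unfolding binom_ratio_eq_prod[OF k]
  proof (intro prod_mono conjI)
    fix j assume j: "j \<in> {1..k}"
    have "exp (- v - 2 * v^2) \<le> exp (ln (1 - v))"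
      using ln_one_minus_pos_lower_bound[OF v] by simp
    also have "... = 1 - v" using v by simp
    also have "... \<le> 1 - real k / real (m + j)"
      using j m unfolding v_def by (intro diff_left_mono divide_left_mono) (auto intro!: mult_pos_pos)
    finally show "exp (- v - 2 * v^2) \<le> 1 - real k / real (m + j)" .
  qed auto
  finally show "exp (- (real k ^ 2 / real m) - 2 * real k ^ 3 / real m ^ 2) \<le> binom_ratio m k" .
qed

lemma binom_ratio_nonneg: "binom_ratio m k \<ge> 0" by (simp add: binom_ratio_def)

text \<open>
  With W = 4^m / (2m choose m), the partial products of Wallis are W^2 / (2m + 1).
\<close>
lemma central_binomial_tendsto:
  "(\<lambda>m. 4 ^ m / (real (2 * m choose m) * sqrt (real m))) \<longlonglongrightarrow> sqrt pi"
proof -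
  define W where "W m = 4 ^ m / real (2 * m choose m)" for m :: nat
  have W_Suc: "W (Suc m) = W m * (2 * real m + 2) / (2 * real m + 1)" for m
  proof -
    have "real (Suc m) * real (2 * Suc m choose Suc m) = 2 * (2 * real m + 1) * real (2 * m choose m)"
    proof -
      have b: "real (2 * m choose m) = fact (2 * m) / (fact m * fact m)"
        by (simp add: binomial_fact)
      have c: "real (2 * Suc m choose Suc m) = fact (2 * Suc m) / (fact (Suc m) * fact (Suc m))"
        using binomial_fact[of "Suc m" "2 * Suc m", where ?'a = real] by simp
      have f: "fact (2 * Suc m) = (2 * real m + 2) * (2 * real m + 1) * fact (2 * m)"
        by (simp add: algebra_simps)
      have g: "fact (Suc m) = (real m + 1) * fact m" by (simp add: algebra_simps)
      have h: "(real m + 1) * ((2 * M + 2) * N * F / ((M + 1) * f * ((M + 1) * f))) = 2 * N * (F / (f * f))"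
        if "M = real m" "f > 0" for M N F f :: real
        using that by (simp add: divide_simps)
      have "real (Suc m) = real m + 1" by simp
      thus ?thesis unfolding b c f g by (simp only: h fact_gt_zero)
    qed
    hence B: "real (2 * Suc m choose Suc m) = 2 * (2 * real m + 1) * real (2 * m choose m) / (real m + 1)"
      by (metis add.commute mult.commute nonzero_mult_div_cancel_right of_nat_Suc of_nat_neq_0)
    have "4 * y / (2 * (2 * M + 1) * C / (M + 1)) = y / C * (2 * M + 2) / (2 * M + 1)"
      if "C > 0" "M \<ge> 0" for y C M :: real using that by (simp add: divide_simps) (simp add: algebra_simps)
    from this[of "real (2 * m choose m)" "real m" "4 ^ m"] show ?thesis
      unfolding W_def B by simp
  qed
  have wallis: "(\<Prod>k=1..m. (4*real k^2) / (4*real k^2 - 1)) = W m ^ 2 / (2 * real m + 1)" for m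
  proof (induction m)
    case (Suc m)
    have d: "4 * (real m + 1)^2 - 1 = (2 * real m + 1) * (2 * real m + 3)"
      by (simp add: power2_eq_square algebra_simps)
    have "(\<Prod>k=1..Suc m. (4*real k^2) / (4*real k^2 - 1)) = W m ^ 2 / (2 * real m + 1) * (4 * (real m + 1)^2 / ((2 * real m + 1) * (2 * real m + 3)))"
      using Suc d by (simp add: add.commute)
    also have "... = (W m * (2 * real m + 2) / (2 * real m + 1)) ^ 2 / (2 * real m + 3)"
      by (simp add: power2_eq_square field_simps)
    finally show ?case by (simp add: W_Suc)
  qed (simp add: W_def)
  have "(\<lambda>m. W m ^ 2 / (2 * real m + 1)) \<longlonglongrightarrow> pi / 2"
    using Gamma_Function.wallis unfolding wallis .
  moreover have "(\<lambda>m. (2 * real m + 1) / real m) \<longlonglongrightarrow> 2" by real_asymp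
  ultimately have "(\<lambda>m. sqrt (W m ^ 2 / (2 * real m + 1) * ((2 * real m + 1) / real m))) \<longlonglongrightarrow> sqrt (pi / 2 * 2)"
    by (intro tendsto_real_sqrt tendsto_mult)
  also have "(\<lambda>m. sqrt (W m ^ 2 / (2 * real m + 1) * ((2 * real m + 1) / real m))) = (\<lambda>m. W m / sqrt (real m))"
  proof
    fix m
    have "W m ^ 2 / (2 * real m + 1) * ((2 * real m + 1) / real m) = W m ^ 2 / real m" by simp
    moreover have "W m \<ge> 0" by (simp add: W_def)
    ultimately show "sqrt (W m ^ 2 / (2 * real m + 1) * ((2 * real m + 1) / real m)) = W m / sqrt (real m)"
      by (simp add: real_sqrt_divide)
  qed
  finally show ?thesis by (simp add: W_def)
qed

text \<open>
  This bound only has to dominate the cosine powers summably, so the rate 1/5 (from 1 + \<theta>^2 \<le> 5) is enough.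
\<close>
lemma cos_squared_le_exp:
  assumes "0 \<le> \<theta>" "\<theta> < pi / 2"
  shows "cos \<theta> ^ 2 \<le> exp (- (\<theta>^2) / 5)"
proof -
  have "cos \<theta> > 0" using assms by (intro cos_gt_zero_pi) auto
  have "\<theta>^2 \<le> tan \<theta> ^ 2" by (rule abs_le_square_iff[THEN iffD1, OF abs_tan_ge]) (use assms in auto)
  have "cos \<theta> ^ 2 = 1 / (1 + tan \<theta> ^ 2)"
    using \<open>cos \<theta> > 0\<close> tan_sec[of \<theta>] by (simp add: inverse_eq_divide power_one_over)
  also have "... \<le> 1 / (1 + \<theta>^2)"
    using \<open>\<theta>^2 \<le> tan \<theta> ^ 2\<close> by (intro divide_left_mono) (auto intro!: mult_pos_pos add_pos_nonneg)
  also have "... = 1 + (- (\<theta>^2 / (1 + \<theta>^2)))" by (simp add: field_simps add_nonneg_eq_0_iff)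
  also have "... \<le> exp (- (\<theta>^2 / (1 + \<theta>^2)))" by (rule exp_ge_add_one_self)
  also have "... \<le> exp (- (\<theta>^2) / 5)"
  proof -
    have "\<theta> \<le> 2" using assms pi_less_4 by simp
    hence "\<theta>^2 \<le> 4" using assms power_mono[of \<theta> 2 2] by simp
    hence "\<theta>^2 / 5 \<le> \<theta>^2 / (1 + \<theta>^2)"
      by (intro divide_left_mono) (auto intro!: mult_pos_pos add_pos_nonneg)
    thus ?thesis by simp
  qed
  finally show ?thesis .
qed

section \<open>Inversion of the theta series\<close>

text \<open>
  The Jacobi theta constant \<theta>_2 with its leading factor 2 w^(1/4) removed, so that its value at 0 is 1.
\<close>
definition theta_psi :: "'a::{real_normed_field,banach} \<Rightarrow> 'a" where
  "theta_psi w = (\<Sum>n. w ^ (n * (n + 1)))"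

lemma summable_theta_psi:
  fixes w :: "'a::{real_normed_field,banach}"
  assumes "norm w < 1"
  shows "summable (\<lambda>n. norm (w ^ (n * (n + 1))))"
proof (rule summable_comparison_test')
  show "summable (\<lambda>n. norm w ^ n)" using assms by (intro summable_geometric) auto
  show "norm (norm (w ^ (n * (n + 1)))) \<le> norm w ^ n" for n
    using assms by (auto simp: norm_power intro!: power_decreasing)
qed

text \<open>
  For x = a / b take l = 2 a n and m = 4 a b n^2. Then l^2 / m is exactly x for every n, so no
  rounding enters; l is even because the cosine sum is to be folded in two halves.
\<close>
lemma binom_ratio_tendsto:
  fixes a b :: nat
  assumes ab: "a > 0" "b > 0"
  shows "(\<lambda>n. binom_ratio (4 * a * b * n^2) (2 * a * n * i)) \<longlonglongrightarrow> exp (- (real a / real b)) ^ (i^2)"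
proof -
  define x where "x = real a / real b"
  have lo: "(\<lambda>n. exp (- (x * real i ^ 2) - x * real i ^ 2 * real i / (real b * real n))) \<longlonglongrightarrow> exp (- (x * real i ^ 2) - 0)"
    using ab by (intro tendsto_exp tendsto_diff tendsto_const) real_asymp
  have up: "(\<lambda>n. exp (- (x * real i ^ 2 / (1 + real i / (2 * real b * real n))))) \<longlonglongrightarrow> exp (- (x * real i ^ 2 / (1 + 0)))"
    using ab by (intro tendsto_exp tendsto_minus tendsto_divide tendsto_add tendsto_const; (real_asymp | simp))
  have ev: "\<forall>\<^sub>F n in sequentially. n \<ge> Suc i" by (rule eventually_ge_at_top)
  have "(\<lambda>n. binom_ratio (4 * a * b * n^2) (2 * a * n * i)) \<longlonglongrightarrow> exp (- (x * real i ^ 2))"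
  proof (rule tendsto_sandwich)
    show "\<forall>\<^sub>F n in sequentially. exp (- (x * real i ^ 2) - x * real i ^ 2 * real i / (real b * real n)) \<le> binom_ratio (4 * a * b * n^2) (2 * a * n * i)"
      using ev
    proof eventually_elim
      case (elim n)
      have n: "n > 0" using elim by auto
      have "i \<le> b * n" using elim ab by (auto intro: order_trans[of i n])
      hence "4 * a * n * i \<le> 4 * a * n * (b * n)" by (rule mult_le_mono2)
      hence le: "2 * (2 * a * n * i) \<le> 4 * a * b * n^2" by (simp add: power2_eq_square mult_ac)
      have "exp (- (real (2 * a * n * i) ^ 2 / real (4 * a * b * n^2)) - 2 * real (2 * a * n * i) ^ 3 / real (4 * a * b * n^2) ^ 2)
          \<le> binom_ratio (4 * a * b * n^2) (2 * a * n * i)"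
        using le ab n by (intro binom_ratio_bounds(2)) (linarith, simp, assumption)
      moreover have "real (2 * a * n * i) ^ 2 / real (4 * a * b * n^2) = x * real i ^ 2"
        using ab n by (simp add: x_def power2_eq_square field_simps)
      moreover have "2 * real (2 * a * n * i) ^ 3 / real (4 * a * b * n^2) ^ 2 = x * real i ^ 2 * real i / (real b * real n)"
        using ab n by (simp add: x_def power2_eq_square power3_eq_cube field_simps)
      ultimately show ?case by simp
    qed
    show "\<forall>\<^sub>F n in sequentially. binom_ratio (4 * a * b * n^2) (2 * a * n * i) \<le> exp (- (x * real i ^ 2 / (1 + real i / (2 * real b * real n))))"
      using ev
    proof eventually_elim
      case (elim n)
      have n: "n > 0" using elim by auto
      have "i \<le> 2 * (b * n)" using elim ab by (auto intro: order_trans[of i n])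
      hence "2 * a * n * i \<le> 2 * a * n * (2 * (b * n))" by (rule mult_le_mono2)
      hence le: "2 * a * n * i \<le> 4 * a * b * n^2" by (simp only: power2_eq_square mult_ac)
      have "binom_ratio (4 * a * b * n^2) (2 * a * n * i) \<le> exp (- (real (2 * a * n * i) ^ 2 / (real (4 * a * b * n^2) + real (2 * a * n * i))))"
        using le ab n by (intro binom_ratio_bounds) auto
      also have "real (4 * a * b * n^2) + real (2 * a * n * i) = real (4 * a * b * n^2) * (1 + real i / (2 * real b * real n))"
        using ab n by (simp add: power2_eq_square field_simps)
      also have "real (2 * a * n * i) ^ 2 / (real (4 * a * b * n^2) * (1 + real i / (2 * real b * real n))) = x * real i ^ 2 / (1 + real i / (2 * real b * real n))"
      proof -
        have "real (2 * a * n * i) ^ 2 / real (4 * a * b * n^2) = x * real i ^ 2"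
          using ab n by (simp add: x_def power2_eq_square field_simps)
        thus ?thesis by (simp flip: divide_divide_eq_left)
      qed
      finally show ?case .
    qed
  qed (use lo up in simp_all)
  thus ?thesis by (simp add: x_def exp_of_nat_mult[symmetric] mult_ac)
qed

lemma binom_ratio_dominated:
  fixes a b n :: nat
  assumes ab: "a > 0" "b > 0" and n: "n > 0"
  shows "binom_ratio (4 * a * b * n^2) (2 * a * n * i) \<le> exp (- (real a / real b / 2)) ^ i"
proof (cases "2 * a * n * i \<le> 4 * a * b * n^2")
  case True
  have "binom_ratio (4 * a * b * n^2) (2 * a * n * i) \<le> exp (- (real (2 * a * n * i) ^ 2 / (real (4 * a * b * n^2) + real (2 * a * n * i))))"
    using True ab n by (intro binom_ratio_bounds) auto
  also have "... \<le> exp (- (real (2 * a * n * i) ^ 2 / (2 * real (4 * a * b * n^2))))"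
  proof -
    have "real (2 * a * n * i) \<le> real (4 * a * b * n^2)" using True by (simp only: of_nat_le_iff)
    moreover have "real (4 * a * b * n^2) > 0" using ab n by simp
    ultimately have "real (2 * a * n * i) ^ 2 / (2 * real (4 * a * b * n^2)) \<le> real (2 * a * n * i) ^ 2 / (real (4 * a * b * n^2) + real (2 * a * n * i))"
      by (intro divide_left_mono mult_pos_pos add_pos_nonneg) auto
    thus ?thesis by simp
  qed
  also have "real (2 * a * n * i) ^ 2 / (2 * real (4 * a * b * n^2)) = real a / real b / 2 * real i ^ 2"
    using ab n by (simp add: power2_eq_square field_simps)
  also have "exp (- (real a / real b / 2 * real i ^ 2)) \<le> exp (- (real a / real b / 2 * real i))"
  proof -
    have "i \<le> i * i" by simp
    hence "real i \<le> real i ^ 2" by (metis of_nat_le_iff of_nat_mult power2_eq_square)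
    hence "real a / real b / 2 * real i \<le> real a / real b / 2 * real i ^ 2" by (intro mult_left_mono) auto
    thus ?thesis by simp
  qed
  also have "... = exp (- (real a / real b / 2)) ^ i"
    by (simp add: exp_of_nat_mult[symmetric] mult_ac)
  finally show ?thesis .
next
  case False
  hence "binom_ratio (4 * a * b * n^2) (2 * a * n * i) = 0"
    unfolding binom_ratio_def by (subst binomial_eq_0) simp_all
  thus ?thesis by simp
qed

lemma theta4_polya_limit:
  fixes a b :: nat
  assumes ab: "a > 0" "b > 0"
  shows "(\<lambda>n. \<Sum>i. (if i = 0 then 1 else 2) * (-1) ^ i * binom_ratio (4 * a * b * n^2) (2 * a * n * i))
     \<longlonglongrightarrow> theta4 (exp (- (real a / real b)))"
  unfolding theta4_def
proof (rule tannerys_theorem[THEN conjunct2, THEN conjunct2])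
  fix i
  show "(\<lambda>n. (if i = 0 then 1 else 2) * (-1) ^ i * binom_ratio (4 * a * b * n^2) (2 * a * n * i))
     \<longlonglongrightarrow> (if i = 0 then 1 else 2) * (-1) ^ i * exp (- (real a / real b)) ^ (i^2)"
    by (intro tendsto_mult tendsto_const binom_ratio_tendsto ab)
next
  have "\<forall>\<^sub>F (i, n) in at_top \<times>\<^sub>F sequentially. True \<and> n > (0::nat)"
    using eventually_prodI[of "\<lambda>_. True" at_top "\<lambda>n. n > (0::nat)" sequentially]
    by (simp add: eventually_gt_at_top case_prod_unfold)
  thus "\<forall>\<^sub>F (i, n) in at_top \<times>\<^sub>F sequentially. norm ((if i = 0 then 1 else 2) * (-1) ^ i * binom_ratio (4 * a * b * n^2) (2 * a * n * i))
     \<le> 2 * exp (- (real a / real b / 2)) ^ i"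
  proof eventually_elim
    case (elim y)
    obtain i n where y: "y = (i, n)" by force
    have "n > 0" using elim by (simp add: y)
    have "norm ((if i = 0 then 1 else 2) * (-1) ^ i * binom_ratio (4 * a * b * n^2) (2 * a * n * i))
         \<le> 2 * binom_ratio (4 * a * b * n^2) (2 * a * n * i)"
      using binom_ratio_nonneg[of "4 * a * b * n^2" "2 * a * n * i"] by (auto simp: abs_mult)
    also have "... \<le> 2 * exp (- (real a / real b / 2)) ^ i"
      using binom_ratio_dominated[OF ab \<open>n > 0\<close>, of i] by simp
    finally show ?case by (simp add: y)
  qed
next
  show "summable (\<lambda>i. 2 * exp (- (real a / real b / 2)) ^ i)"
    using ab by (intro summable_mult summable_geometric) simp
qed simp

lemma cos_power_tendsto:
  assumes c: "c > 0"
  shows "(\<lambda>n. cos (c / real n) ^ (2 * (k * n^2))) \<longlonglongrightarrow> exp (- (real k * c^2))"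
proof -
  have "(\<lambda>n. real n ^ 2 * ln (cos (c / real n))) \<longlonglongrightarrow> - (c * c / 2)"
    using c by real_asymp
  hence "(\<lambda>n. real n ^ 2 * ln (cos (c / real n))) \<longlonglongrightarrow> - (c^2 / 2)"
    by (simp only: power2_eq_square)
  hence "(\<lambda>n. exp (2 * real k * (real n ^ 2 * ln (cos (c / real n))))) \<longlonglongrightarrow> exp (2 * real k * (- (c^2 / 2)))"
    by (intro tendsto_intros)
  moreover have "\<forall>\<^sub>F n in sequentially. cos (c / real n) > 0" using c by real_asymp
  hence "\<forall>\<^sub>F n in sequentially. exp (2 * real k * (real n ^ 2 * ln (cos (c / real n)))) = cos (c / real n) ^ (2 * (k * n^2))"
  proof eventually_elim
    case (elim n)
    have "cos (c / real n) ^ (2 * (k * n^2)) = exp (ln (cos (c / real n))) ^ (2 * (k * n^2))"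
      using elim by simp
    also have "... = exp (real (2 * (k * n^2)) * ln (cos (c / real n)))" by (rule exp_of_nat_mult[symmetric])
    also have "real (2 * (k * n^2)) * ln (cos (c / real n)) = 2 * real k * (real n ^ 2 * ln (cos (c / real n)))" by simp
    finally show ?case by simp
  qed
  ultimately have "(\<lambda>n. cos (c / real n) ^ (2 * (k * n^2))) \<longlonglongrightarrow> exp (2 * real k * (- (c^2 / 2)))"
    by (rule Lim_transform_eventually)
  thus ?thesis by simp
qed

text \<open>
  Since m / l^2 = 1 / x, the term of index \<nu> tends to exp(-\<pi>^2 (\<nu> + 1/2)^2 / x), and
  (\<nu> + 1/2)^2 = \<nu> (\<nu> + 1) + 1/4 accounts for the factor in front.
\<close>
lemma cos_sum_polya_limit:
  fixes a b :: nat
  assumes ab: "a > 0" "b > 0"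
  shows "(\<lambda>n. \<Sum>\<nu><a * n. cos (pi * (2 * real \<nu> + 1) / (2 * real (2 * a * n))) ^ (2 * (4 * a * b * n^2)))
     \<longlonglongrightarrow> exp (- (pi^2 / (4 * (real a / real b)))) * theta_psi (exp (- (pi^2 / (real a / real b))))"
proof -
  define x where "x = real a / real b"
  have x: "x > 0" using ab by (simp add: x_def)
  define f where "f \<nu> n = (if \<nu> < a * n then cos (pi * (2 * real \<nu> + 1) / (2 * real (2 * a * n))) ^ (2 * (4 * a * b * n^2)) else 0)" for \<nu> n
  define g where "g \<nu> = exp (- (pi^2 / (4 * x))) * exp (- (pi^2 / x)) ^ (\<nu> * (\<nu> + 1))" for \<nu> :: nat
  have "(\<lambda>n. \<Sum>\<nu>. f \<nu> n) \<longlonglongrightarrow> (\<Sum>\<nu>. g \<nu>)"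
  proof (rule tannerys_theorem[THEN conjunct2, THEN conjunct2])
    fix \<nu>
    define c where "c = pi * (2 * real \<nu> + 1) / (4 * real a)"
    have "(\<lambda>n. cos (c / real n) ^ (2 * (4 * a * b * n^2))) \<longlonglongrightarrow> exp (- (real (4 * a * b) * c^2))"
      using ab by (intro cos_power_tendsto) (auto simp: c_def intro!: divide_pos_pos mult_pos_pos add_nonneg_pos)
    also have "real (4 * a * b) * c^2 = pi^2 / (4 * x) + real (\<nu> * (\<nu> + 1)) * (pi^2 / x)"
      using ab by (simp add: c_def x_def power2_eq_square field_simps)
    also have "exp (- (pi^2 / (4 * x) + real (\<nu> * (\<nu> + 1)) * (pi^2 / x))) = g \<nu>"
      unfolding g_def exp_of_nat_mult[symmetric] exp_add[symmetric] by (simp add: algebra_simps)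
    finally have lim: "(\<lambda>n. cos (c / real n) ^ (2 * (4 * a * b * n^2))) \<longlonglongrightarrow> g \<nu>" .
    have "\<forall>\<^sub>F n in sequentially. cos (c / real n) ^ (2 * (4 * a * b * n^2)) = f \<nu> n"
      using eventually_gt_at_top[of \<nu>]
    proof eventually_elim
      case (elim n)
      have "n \<le> a * n" using ab by simp
      hence "\<nu> < a * n" using elim by linarith
      moreover have "c / real n = pi * (2 * real \<nu> + 1) / (2 * real (2 * a * n))"
        by (simp add: c_def field_simps)
      ultimately show ?case by (simp add: f_def)
    qed
    with lim show "f \<nu> \<longlonglongrightarrow> g \<nu>" by (rule Lim_transform_eventually)
  next
    have "norm (f \<nu> n) \<le> exp (- (1 / x)) ^ \<nu>" for \<nu> n
    proof (cases "\<nu> < a * n")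
      case True
      hence n: "n > 0" by (cases n) auto
      define \<theta> where "\<theta> = pi * (2 * real \<nu> + 1) / (2 * real (2 * a * n))"
      have "2 * real \<nu> + 1 < 2 * real (a * n)"
      proof -
        have "2 * \<nu> + 1 < 2 * (a * n)" using True by linarith
        hence "real (2 * \<nu> + 1) < real (2 * (a * n))" by (simp only: of_nat_less_iff)
        thus ?thesis by simp
      qed
      hence "(2 * real \<nu> + 1) / (2 * real (a * n)) < 1"
        using ab n by (subst divide_less_eq_1_pos) auto
      hence "pi / 2 * ((2 * real \<nu> + 1) / (2 * real (a * n))) < pi / 2 * 1"
        by (rule mult_strict_left_mono) simp
      moreover have "\<theta> = pi / 2 * ((2 * real \<nu> + 1) / (2 * real (a * n)))"
        by (simp add: \<theta>_def)
      ultimately have "\<theta> < pi / 2" by linarith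
      hence th: "0 \<le> \<theta>" "\<theta> < pi / 2" by (auto simp: \<theta>_def)
      have "cos \<theta> ^ (2 * (4 * a * b * n^2)) = (cos \<theta> ^ 2) ^ (4 * a * b * n^2)" by (rule power_mult)
      also have "... \<le> exp (- (\<theta>^2) / 5) ^ (4 * a * b * n^2)"
        by (intro power_mono cos_squared_le_exp th) auto
      also have "... = exp (real (4 * a * b * n^2) * (- (\<theta>^2) / 5))" by (rule exp_of_nat_mult[symmetric])
      also have "real (4 * a * b * n^2) * (- (\<theta>^2) / 5) = - (1 / x * (pi^2 * (2 * real \<nu> + 1)^2 / 20))"
        using ab n by (simp add: \<theta>_def x_def power2_eq_square divide_simps)
      also have "... \<le> - (1 / x * real \<nu>)"
      proof -
        have "20 * real \<nu> \<le> 9 * (2 * real \<nu> + 1)^2"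
          by (simp add: power2_eq_square algebra_simps)
        also have "... \<le> pi^2 * (2 * real \<nu> + 1)^2"
          using power_mono[of 3 pi 2] pi_gt3 by (intro mult_right_mono) auto
        finally have "real \<nu> \<le> pi^2 * (2 * real \<nu> + 1)^2 / 20" by simp
        hence "1 / x * real \<nu> \<le> 1 / x * (pi^2 * (2 * real \<nu> + 1)^2 / 20)"
          using x by (intro mult_left_mono) auto
        thus ?thesis by simp
      qed
      finally have "cos \<theta> ^ (2 * (4 * a * b * n^2)) \<le> exp (- (1 / x * real \<nu>))" by simp
      also have "... = exp (- (1 / x)) ^ \<nu>" by (simp add: exp_of_nat_mult[symmetric] mult_ac)
      finally show ?thesis using True by (simp add: f_def \<theta>_def power_mult)
    qed (simp add: f_def)
    thus "\<forall>\<^sub>F (\<nu>, n) in sequentially \<times>\<^sub>F sequentially. norm (f \<nu> n) \<le> exp (- (1 / x)) ^ \<nu>"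
      by (intro always_eventually) auto
  next
    show "summable (\<lambda>\<nu>. exp (- (1 / x)) ^ \<nu>)" using x by (intro summable_geometric) simp
  qed simp
  moreover have "(\<Sum>\<nu>. f \<nu> n) = (\<Sum>\<nu><a * n. cos (pi * (2 * real \<nu> + 1) / (2 * real (2 * a * n))) ^ (2 * (4 * a * b * n^2)))" for n
    by (subst suminf_finite[of "{..<a * n}"]) (auto simp: f_def)
  moreover have "(\<Sum>\<nu>. g \<nu>) = exp (- (pi^2 / (4 * x))) * theta_psi (exp (- (pi^2 / x)))"
    unfolding g_def theta_psi_def using x
    by (intro suminf_mult summable_norm_cancel[OF summable_theta_psi]) simp
  ultimately show ?thesis by (simp add: x_def)
qed

lemma theta4_inversion_rational:
  fixes a b :: nat
  assumes ab: "a > 0" "b > 0"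
  defines "x \<equiv> real a / real b"
  shows "theta4 (exp (- x)) = 2 * sqrt (pi / x) * exp (- (pi^2 / (4 * x))) * theta_psi (exp (- (pi^2 / x)))"
proof -
  define m where "m n = 4 * a * b * n^2" for n
  define l where "l n = 2 * a * n" for n
  define S where "S n = (\<Sum>\<nu><a * n. cos (pi * (2 * real \<nu> + 1) / (2 * real (l n))) ^ (2 * m n))" for n
  have x: "x > 0" using ab by (simp add: x_def)
  have lim1: "S \<longlonglongrightarrow> exp (- (pi^2 / (4 * x))) * theta_psi (exp (- (pi^2 / x)))"
    using cos_sum_polya_limit[OF ab] by (simp add: S_def[abs_def] m_def l_def x_def)
  have fold: "(\<Sum>\<nu><l n. cos (pi * (2 * real \<nu> + 1) / (2 * real (l n))) ^ (2 * m n)) = 2 * S n" for n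
  proof -
    define h where "h = a * n"
    define f where "f \<nu> = cos (pi * (2 * real \<nu> + 1) / (2 * real (l n))) ^ (2 * m n)" for \<nu>
    have "{..<l n} = {..<h} \<union> {h..<2 * h}" by (auto simp: l_def h_def)
    hence "(\<Sum>\<nu><l n. f \<nu>) = (\<Sum>\<nu>\<in>{..<h} \<union> {h..<2 * h}. f \<nu>)"
      by (rule arg_cong)
    also have "... = (\<Sum>\<nu><h. f \<nu>) + (\<Sum>\<nu>\<in>{h..<2 * h}. f \<nu>)"
      by (rule sum.union_disjoint) auto
    also have "(\<Sum>\<nu>\<in>{h..<2 * h}. f \<nu>) = (\<Sum>\<nu><h. f \<nu>)"
    proof (rule sum.reindex_bij_witness[of _ "\<lambda>\<nu>. 2 * h - 1 - \<nu>" "\<lambda>\<nu>. 2 * h - 1 - \<nu>"])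
      fix \<nu> assume \<nu>: "\<nu> \<in> {h..<2 * h}"
      have "pi * (2 * real (2 * h - 1 - \<nu>) + 1) / (2 * real (l n)) = pi - pi * (2 * real \<nu> + 1) / (2 * real (l n))"
      proof -
        have e: "real (2 * h - 1 - \<nu>) = real (l n) - 1 - real \<nu>"
          using \<nu> by (simp add: of_nat_diff l_def h_def)
        have "h > 0" using \<nu> by (cases h) auto
        hence "real (l n) > 0" by (simp add: l_def h_def)
        thus ?thesis unfolding e by (simp add: field_simps)
      qed
      thus "f (2 * h - 1 - \<nu>) = f \<nu>" by (simp add: f_def power_mult)
    qed auto
    finally show ?thesis by (simp add: f_def S_def h_def)
  qed
  have "filterlim m at_top sequentially"
  proof (rule filterlim_at_top_mono[OF filterlim_ident])
    show "\<forall>\<^sub>F n in sequentially. n \<le> m n"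
    proof (intro always_eventually allI)
      fix n :: nat
      have "n \<le> n^2" by (simp add: power2_eq_square)
      also have "... \<le> m n" using ab by (simp add: m_def)
      finally show "n \<le> m n" .
    qed
  qed
  hence "(\<lambda>n. 4 ^ m n / (real (2 * m n choose m n) * sqrt (real (m n)))) \<longlonglongrightarrow> sqrt pi"
    by (rule filterlim_compose[OF central_binomial_tendsto])
  hence "(\<lambda>n. 4 ^ m n / (real (2 * m n choose m n) * sqrt (real (m n))) * (1 / sqrt x) * (2 * S n)) \<longlonglongrightarrow>
      sqrt pi * (1 / sqrt x) * (2 * (exp (- (pi^2 / (4 * x))) * theta_psi (exp (- (pi^2 / x)))))"
    by (intro tendsto_mult tendsto_const lim1)
  moreover have "\<forall>\<^sub>F n in sequentially. 4 ^ m n / (real (2 * m n choose m n) * sqrt (real (m n))) * (1 / sqrt x) * (2 * S n)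
      = (\<Sum>i. (if i = 0 then 1 else 2) * (-1) ^ i * binom_ratio (m n) (l n * i))"
    using eventually_gt_at_top[of 0]
  proof eventually_elim
    case (elim n)
    have l: "l n > 0" using elim ab by (simp add: l_def)
    have "real (m n) * x = real (l n) ^ 2"
      using ab by (simp add: m_def l_def x_def power2_eq_square)
    hence "sqrt (real (m n)) * sqrt x = real (l n)" by (simp flip: real_sqrt_mult)
    thus ?case unfolding polya_identity[OF l] fold by (simp add: mult_ac)
  qed
  ultimately have "(\<lambda>n. \<Sum>i. (if i = 0 then 1 else 2) * (-1) ^ i * binom_ratio (m n) (l n * i)) \<longlonglongrightarrow>
      sqrt pi * (1 / sqrt x) * (2 * (exp (- (pi^2 / (4 * x))) * theta_psi (exp (- (pi^2 / x)))))"
    by (rule Lim_transform_eventually)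
  moreover have "(\<lambda>n. \<Sum>i. (if i = 0 then 1 else 2) * (-1) ^ i * binom_ratio (m n) (l n * i)) \<longlonglongrightarrow> theta4 (exp (- x))"
    using theta4_polya_limit[OF ab] by (simp add: m_def l_def x_def)
  ultimately have "theta4 (exp (- x)) = sqrt pi * (1 / sqrt x) * (2 * (exp (- (pi^2 / (4 * x))) * theta_psi (exp (- (pi^2 / x)))))"
    by (intro LIMSEQ_unique)
  thus ?thesis by (simp add: real_sqrt_divide)
qed

text \<open>
  A series in w^(g n) is a power series whose missing coefficients are 0.
\<close>
lemma holomorphic_lacunary:
  fixes c :: "nat \<Rightarrow> complex"
  assumes g: "strict_mono g" and sums: "\<And>w. norm w < 1 \<Longrightarrow> (\<lambda>n. c n * w ^ g n) sums f w"
  shows "f holomorphic_on ball 0 1"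
proof (rule power_series_holomorphic)
  define a where "a k = (if k \<in> range g then c (inv g k) else 0)" for k
  fix w :: complex assume "w \<in> ball 0 1"
  hence "(\<lambda>n. c n * w ^ g n) sums f w" by (intro sums) auto
  also have "(\<lambda>n. c n * w ^ g n) = (\<lambda>n. a (g n) * w ^ g n)"
    using strict_mono_imp_inj_on[OF g] by (auto simp: a_def)
  finally show "(\<lambda>k. a k * (w - 0) ^ k) sums f w"
    by (subst sums_mono_reindex[OF g, symmetric]) (auto simp: a_def)
qed

lemma holomorphic_theta4: "theta4 holomorphic_on ball (0::complex) 1"
proof (rule holomorphic_lacunary)
  show "strict_mono (\<lambda>n::nat. n^2)" by (auto simp: strict_mono_def power_strict_mono)
  fix w :: complex assume "norm w < 1"
  thus "(\<lambda>n. ((if n = 0 then 1 else 2) * (-1) ^ n) * w ^ n^2) sums theta4 w"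
    unfolding theta4_def by (intro summable_sums summable_norm_cancel[OF summable_theta4])
qed

lemma holomorphic_theta_psi: "theta_psi holomorphic_on ball (0::complex) 1"
proof (rule holomorphic_lacunary)
  show "strict_mono (\<lambda>n::nat. n * (n + 1))"
    by (auto simp: strict_mono_Suc_iff)
  fix w :: complex assume "norm w < 1"
  thus "(\<lambda>n. 1 * w ^ (n * (n + 1))) sums theta_psi w"
    unfolding theta_psi_def using summable_norm_cancel[OF summable_theta_psi[of w]]
    by (simp add: summable_sums)
qed

lemma theta4_of_real:
  assumes "\<bar>r\<bar> < 1"
  shows "theta4 (of_real r :: 'a::{real_normed_field,banach}) = of_real (theta4 r)"
proof -
  have "of_real (theta4 r) = (\<Sum>n. of_real ((if n = 0 then 1 else 2) * (-1) ^ n * r ^ n^2) :: 'a)"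
    unfolding theta4_def using assms
    by (intro suminf_of_real summable_norm_cancel[OF summable_theta4]) simp
  also have "(\<lambda>n. of_real ((if n = 0 then 1 else 2) * (-1) ^ n * r ^ n^2) :: 'a) = (\<lambda>n. (if n = 0 then 1 else 2) * (-1) ^ n * of_real r ^ n^2)"
    by auto
  finally show ?thesis by (simp add: theta4_def)
qed

lemma theta_psi_of_real:
  assumes "\<bar>r\<bar> < 1"
  shows "theta_psi (of_real r :: 'a::{real_normed_field,banach}) = of_real (theta_psi r)"
proof -
  have "of_real (theta_psi r) = (\<Sum>n. of_real (r ^ (n * (n + 1))) :: 'a)"
    unfolding theta_psi_def using assms
    by (intro suminf_of_real summable_norm_cancel[OF summable_theta_psi]) simp
  thus ?thesis by (simp add: theta_psi_def)
qed

lemma Re_inverse_pos: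
  assumes "Re z > 0" "c > 0"
  shows "Re (of_real c / z) > 0"
proof -
  have "z \<noteq> 0" using assms by auto
  hence "(cmod z)^2 > 0" by simp
  thus ?thesis using assms by (simp add: Re_divide cmod_power2)
qed

text \<open>
  Both sides are holomorphic in the right half-plane and agree at the points (n + 2) / (n + 1), which accumulate at 1.
\<close>
theorem theta4_inversion:
  assumes z: "Re z > 0"
  shows "theta4 (exp (- z)) = 2 * csqrt (of_real pi / z) * exp (- (of_real (pi^2 / 4) / z)) * theta_psi (exp (- (of_real (pi^2) / z)))"
proof -
  define S where "S = {z. Re z > 0}"
  define f where "f z = theta4 (exp (- z)) - 2 * csqrt (of_real pi / z) * exp (- (of_real (pi^2 / 4) / z)) * theta_psi (exp (- (of_real (pi^2) / z)))" for z
  define U where "U = (\<lambda>n. complex_of_real (real (n + 2) / real (n + 1))) ` (UNIV :: nat set)"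
  have "f z = 0"
  proof (rule analytic_continuation[where f = f and w = z and S = S and U = U and \<xi> = 1])
    have S0: "z \<noteq> 0" if "z \<in> S" for z using that by (auto simp: S_def)
    have h1: "(\<lambda>z. theta4 (exp (- z))) holomorphic_on S"
      by (rule holomorphic_on_compose_gen[OF _ holomorphic_theta4, unfolded o_def, where f = "\<lambda>z. exp (- z)"])
         (auto simp: S_def intro!: holomorphic_intros)
    have h2: "(\<lambda>z. theta_psi (exp (- (of_real (pi^2) / z)))) holomorphic_on S"
    proof (rule holomorphic_on_compose_gen[OF _ holomorphic_theta_psi, unfolded o_def, where f = "\<lambda>z. exp (- (of_real (pi^2) / z))"])
      show "(\<lambda>z. exp (- (complex_of_real (pi^2) / z))) holomorphic_on S"
        using S0 by (intro holomorphic_intros) auto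
      show "(\<lambda>z. exp (- (complex_of_real (pi^2) / z))) ` S \<subseteq> ball 0 1"
        using Re_inverse_pos[of _ "pi^2"] by (auto simp: S_def)
    qed
    have h3: "(\<lambda>z. csqrt (of_real pi / z)) holomorphic_on S"
    proof (rule holomorphic_on_csqrt')
      show "(\<lambda>z. complex_of_real pi / z) holomorphic_on S" using S0 by (intro holomorphic_intros) auto
      show "of_real pi / z \<notin> \<real>\<^sub>\<le>\<^sub>0" if "z \<in> S" for z
        using Re_inverse_pos[of z pi] that by (auto simp: S_def complex_nonpos_Reals_iff)
    qed
    show "f holomorphic_on S"
      unfolding f_def[abs_def] using S0 by (intro holomorphic_intros h1 h2 h3) auto
    show "open S" unfolding S_def by (rule open_halfspace_Re_gt)
    show "connected S" unfolding S_def by (intro convex_connected convex_halfspace_Re_gt)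
    show "U \<subseteq> S" by (auto simp: U_def S_def)
    show "1 \<in> S" by (simp add: S_def)
    show "z \<in> S" using z by (simp add: S_def)
    show "(1::complex) islimpt U"
      unfolding islimpt_sequential
    proof (intro exI conjI allI)
      show "complex_of_real (real (n + 2) / real (n + 1)) \<in> U - {1}" for n
      proof -
        have "real (n + 2) / real (n + 1) \<noteq> 1" by (simp add: field_simps)
        hence "complex_of_real (real (n + 2) / real (n + 1)) \<noteq> 1" by (metis of_real_eq_1_iff)
        thus ?thesis by (auto simp: U_def)
      qed
      have "(\<lambda>n. real (n + 2) / real (n + 1)) \<longlonglongrightarrow> 1" by real_asymp
      thus "(\<lambda>n. complex_of_real (real (n + 2) / real (n + 1))) \<longlonglongrightarrow> 1"
        using tendsto_of_real[of _ 1 sequentially, where 'a = complex] by fastforce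
    qed
  next
    fix w assume "w \<in> U"
    then obtain n where w: "w = complex_of_real (real (n + 2) / real (n + 1))" by (auto simp: U_def)
    define x where "x = real (n + 2) / real (n + 1)"
    have x: "x > 0" by (simp add: x_def)
    have e1: "exp (- complex_of_real x) = of_real (exp (- x))"
      by (subst exp_of_real[symmetric]) simp
    have e2: "exp (- (complex_of_real (pi^2 / 4) / complex_of_real x)) = of_real (exp (- (pi^2 / (4 * x))))"
      by (subst exp_of_real[symmetric]) simp
    have e3: "exp (- (complex_of_real (pi^2) / complex_of_real x)) = of_real (exp (- (pi^2 / x)))"
      by (subst exp_of_real[symmetric]) simp
    have e4: "csqrt (complex_of_real pi / complex_of_real x) = of_real (sqrt (pi / x))"
      using x by (simp flip: of_real_divide)
    have "theta4 (exp (- x)) = 2 * sqrt (pi / x) * exp (- (pi^2 / (4 * x))) * theta_psi (exp (- (pi^2 / x)))"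
      using theta4_inversion_rational[of "n + 2" "n + 1"] by (simp add: x_def)
    thus "f w = 0"
      unfolding f_def w x_def[symmetric] e1 e2 e3 e4 using x
      by (simp add: theta4_of_real theta_psi_of_real del: of_real_exp)
  qed
  thus ?thesis by (simp add: f_def)
qed

section \<open>Coefficients as integrals and local expansions\<close>

lemma integral_exp_int:
  "((\<lambda>y. exp (of_int k * (\<i> * of_real y))) has_integral (if k = 0 then 2 * pi else 0)) {-pi..pi}"
proof (cases "k = 0")
  case True
  thus ?thesis using has_integral_const_real[of "1::complex" "-pi" pi] by (simp add: scaleR_conv_of_real)
next
  case False
  define c where "c = of_int k * \<i>"
  have c: "c \<noteq> 0" using False by (simp add: c_def)
  have "((\<lambda>y. exp (c * of_real y)) has_integral (exp (c * of_real pi) / c - exp (c * of_real (-pi)) / c)) {-pi..pi}"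
  proof (rule fundamental_theorem_of_calculus)
    fix y :: real assume "y \<in> {-pi..pi}"
    have "((\<lambda>y. exp (c * y) / c) has_field_derivative exp (c * of_real y)) (at (of_real y))"
      using c by (auto intro!: derivative_eq_intros)
    thus "((\<lambda>y. exp (c * of_real y) / c) has_vector_derivative exp (c * of_real y)) (at y within {-pi..pi})"
      by (rule has_vector_derivative_real_field)
  qed simp
  also have "exp (c * of_real pi) = exp (c * of_real (-pi))"
  proof -
    have "c * of_real pi = c * of_real (-pi) + 2 * of_int k * of_real pi * \<i>"
      by (simp add: c_def)
    also have "exp ... = exp (c * of_real (-pi))"
      by (simp only: exp_plus_2pin mult.commute mult.left_commute mult.assoc) 
    finally show ?thesis .
  qed
  finally show ?thesis using False by (simp add: c_def mult_ac)
qed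

text \<open>
  Cauchy's coefficient formula on the circle of radius exp(-x), written in the variable z = x + iy of q = exp(-z).
\<close>
lemma coefficient_integral:
  fixes a :: "nat \<Rightarrow> real"
  assumes a: "summable (\<lambda>n. \<bar>a n\<bar> * exp (- x) ^ n)"
    and F: "\<And>y. (\<lambda>n. of_real (a n) * exp (- Complex x y) ^ n) sums F y"
  shows "((\<lambda>y. F y * exp (of_nat N * Complex x y)) has_integral (2 * pi * a N)) {-pi..pi}"
proof -
  define f where "f n y = of_real (a n) * exp (- Complex x y) ^ n * exp (of_nat N * Complex x y)" for n y
  have f_eq: "f n y = of_real (a n * exp (- x) ^ n * exp (real N * x)) * exp (of_int (int N - int n) * (\<i> * of_real y))" for n y
    by (simp add: f_def Complex_eq exp_of_nat_mult[symmetric] exp_of_real[symmetric] exp_add[symmetric] algebra_simps)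

  have f_int: "(f n has_integral (if n = N then 2 * pi * a N else 0)) {-pi..pi}" for n
  proof -
    have "(f n has_integral of_real (a n * exp (- x) ^ n * exp (real N * x)) * of_real (if int N - int n = 0 then 2 * pi else 0)) {-pi..pi}"
      unfolding f_eq using integral_exp_int[of "int N - int n"] by (intro has_integral_mult_right) (simp split: if_splits)
    also have "of_real (a n * exp (- x) ^ n * exp (real N * x)) * of_real (if int N - int n = 0 then 2 * pi else 0) = complex_of_real (if n = N then 2 * pi * a N else 0)"
    proof (cases "n = N")
      case True
      have "exp (- x) ^ N * exp (real N * x) = 1"
        by (simp add: exp_of_nat_mult[symmetric] exp_add[symmetric])
      thus ?thesis using True by (simp add: mult.assoc)
    qed simp
    finally show ?thesis .
  qed
  have cont: "continuous_on {-pi..pi} (f n)" for n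
    unfolding f_eq by (intro continuous_intros)
  have unif: "uniform_limit (cbox (-pi) pi) (\<lambda>K y. \<Sum>n<K. f n y) (\<lambda>y. F y * exp (of_nat N * Complex x y)) sequentially"
  proof -
    have "uniform_limit (cbox (-pi) pi) (\<lambda>K y. \<Sum>n<K. f n y) (\<lambda>y. \<Sum>n. f n y) sequentially"
    proof (rule Weierstrass_m_test)
      show "summable (\<lambda>n. \<bar>a n\<bar> * exp (- x) ^ n * exp (real N * x))"
        by (intro summable_mult2 a)
      show "norm (f n y) \<le> \<bar>a n\<bar> * exp (- x) ^ n * exp (real N * x)" for n y
        unfolding f_def norm_mult norm_power norm_exp_eq_Re by simp
    qed
    moreover have "(\<Sum>n. f n y) = F y * exp (of_nat N * Complex x y)" for y
      using sums_mult2[OF F[of y], of "exp (of_nat N * Complex x y)"] by (simp add: sums_iff f_def)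
    ultimately show ?thesis by simp
  qed
  have "\<And>K. continuous_on (cbox (-pi) pi) (\<lambda>y. \<Sum>n<K. f n y)"
    using cont by (intro continuous_on_sum) auto
  then obtain I J where I: "\<And>K. ((\<lambda>y. \<Sum>n<K. f n y) has_integral I K) (cbox (-pi) pi)"
    and J: "((\<lambda>y. F y * exp (of_nat N * Complex x y)) has_integral J) (cbox (-pi) pi)" and lim: "I \<longlonglongrightarrow> J"
    by (rule uniform_limit_integral_cbox[OF unif]) auto
  have "I K = 2 * pi * a N" if "K > N" for K
  proof -
    have "((\<lambda>y. \<Sum>n<K. f n y) has_integral (\<Sum>n<K. of_real (if n = N then 2 * pi * a N else 0))) {-pi..pi}"
      by (intro has_integral_sum f_int) auto
    also have "(\<Sum>n<K. of_real (if n = N then 2 * pi * a N else 0)) = complex_of_real (2 * pi * a N)"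
      using that by (simp flip: of_real_sum)
    finally show ?thesis using I[of K] has_integral_unique by (metis box_real(2))
  qed
  hence "\<forall>\<^sub>F K in sequentially. I K = 2 * pi * a N"
    by (intro eventually_mono[OF eventually_gt_at_top[of N]])
  hence "I \<longlonglongrightarrow> complex_of_real (2 * pi * a N)" by (rule tendsto_eventually)
  with lim have "J = complex_of_real (2 * pi * a N)" by (rule LIMSEQ_unique)
  thus ?thesis using J by simp
qed

lemma norm_suminf_diff_one_le:
  fixes f :: "nat \<Rightarrow> 'a::banach" 
  assumes "summable g" and "\<And>n. norm (f (Suc n)) \<le> g n"
  shows "norm (suminf f - f 0) \<le> suminf g"
proof -
  have 1: "summable (\<lambda>n. norm (f (Suc n)))" by (rule summable_comparison_test'[OF assms(1), of 0]) (use assms in auto)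
  hence "summable f" using summable_Suc_iff summable_norm_cancel by blast
  hence "suminf f - f 0 = (\<Sum>n. f (Suc n))" by (simp add: suminf_split_head)
  also have "norm ... \<le> (\<Sum>n. norm (f (Suc n)))" by (rule summable_norm[OF 1])
  also have "... \<le> suminf g" by (rule suminf_le[OF assms(2) 1 assms(1)])
  finally show ?thesis .
qed

lemma theta_psi_near_one:
  fixes w :: "'a::{real_normed_field,banach}"
  assumes w: "norm w \<le> 1 / 2"
  shows "norm (theta_psi w - 1) \<le> 2 * norm w ^ 2"
proof -
  have "norm ((\<Sum>n. w ^ (n * (n + 1))) - w ^ (0 * (0 + 1))) \<le> (\<Sum>n. norm w ^ 2 * norm w ^ n)"
  proof (rule norm_suminf_diff_one_le)
    show "summable (\<lambda>n. norm w ^ 2 * norm w ^ n)" using w by (intro summable_mult summable_geometric) auto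
    show "norm (w ^ (Suc n * (Suc n + 1))) \<le> norm w ^ 2 * norm w ^ n" for n
      unfolding norm_power power_add[symmetric] using w by (intro power_decreasing) auto
  qed
  also have "... = norm w ^ 2 * (1 / (1 - norm w))"
    using w by (subst suminf_mult) (auto simp: suminf_geometric summable_geometric)
  also have "... \<le> norm w ^ 2 * 2" using w by (intro mult_left_mono) (auto simp: field_simps)
  finally show ?thesis by (simp add: theta_psi_def mult.commute)
qed

lemma theta4_near_one:
  fixes q :: "'a::{real_normed_field,banach}"
  assumes q: "norm q < 1"
  shows "norm (theta4 q - 1) \<le> 2 * norm q / (1 - norm q)"
proof -
  have "norm ((\<Sum>n. (if n = 0 then 1 else 2) * (-1) ^ n * q ^ (n^2)) - (if (0::nat) = 0 then 1 else 2) * (-1) ^ 0 * q ^ (0^2)) \<le> (\<Sum>n. 2 * norm q * norm q ^ n)"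
  proof (rule norm_suminf_diff_one_le)
    show "summable (\<lambda>n. 2 * norm q * norm q ^ n)" using q by (intro summable_mult summable_geometric) auto
    fix n :: nat
    have "norm q ^ ((Suc n)^2) \<le> norm q ^ Suc n"
      using q by (intro power_decreasing) (auto simp: power2_eq_square)
    thus "norm ((if Suc n = 0 then 1 else 2) * (-1) ^ Suc n * q ^ ((Suc n)^2)) \<le> 2 * norm q * norm q ^ n"
      by (simp add: norm_mult norm_power)
  qed
  also have "... = 2 * norm q * (1 / (1 - norm q))"
    using q by (subst suminf_mult) (auto simp: suminf_geometric summable_geometric)
  finally show ?thesis by (simp add: theta4_def)
qed

lemma norm_theta4_le:
  fixes q :: "'a::{real_normed_field,banach}"
  assumes q: "norm q < 1"
  shows "norm (theta4 q) \<le> 2 / (1 - norm q)"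
proof -
  have "norm (theta4 q) \<le> norm (theta4 q - 1) + 1" 
    using norm_triangle_ineq[of "theta4 q - 1" 1] by simp
  also have "... \<le> 2 * norm q / (1 - norm q) + 1" using theta4_near_one[OF q] by simp
  also have "... = (1 + norm q) / (1 - norm q)" using q by (simp add: field_simps)
  also have "... \<le> 2 / (1 - norm q)" using q by (intro divide_right_mono) auto
  finally show ?thesis .
qed

text \<open>
  w = 1 + i \<beta> + O(u^2) with \<beta> real and of order u. The class is closed under products and
  inverses. Taking real parts removes i \<beta>, which is how the first order term of a factor that is
  real on the real axis disappears from an integral along a vertical line.
\<close>
definition near_one :: "real \<Rightarrow> real \<Rightarrow> complex \<Rightarrow> bool" where
  "near_one C u w \<longleftrightarrow> (\<exists>\<beta>::real. \<bar>\<beta>\<bar> \<le> C * \<bar>u\<bar> \<and> norm (w - 1 - \<i> * of_real \<beta>) \<le> C * u^2)"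

lemma near_one_norm:
  assumes "near_one C u w" "\<bar>u\<bar> \<le> 1" "C \<ge> 0"
  shows "norm (w - 1) \<le> 2 * C * \<bar>u\<bar>"
proof -
  obtain \<beta> :: real where b: "\<bar>\<beta>\<bar> \<le> C * \<bar>u\<bar>" "norm (w - 1 - \<i> * of_real \<beta>) \<le> C * u^2"
    using assms(1) unfolding near_one_def by blast
  have "u^2 = \<bar>u\<bar> * \<bar>u\<bar>" by (simp add: power2_eq_square)
  also have "... \<le> \<bar>u\<bar> * 1" using assms(2) by (intro mult_left_mono) auto
  finally have "u^2 \<le> \<bar>u\<bar>" by simp
  hence "C * u^2 \<le> C * \<bar>u\<bar>" using assms(3) by (rule mult_left_mono)
  moreover have "norm (w - 1) \<le> norm (w - 1 - \<i> * of_real \<beta>) + norm (\<i> * of_real \<beta>)"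
    using norm_triangle_ineq[of "w - 1 - \<i> * of_real \<beta>" "\<i> * of_real \<beta>"] by simp
  ultimately show ?thesis using b by (simp add: norm_mult)
qed

lemma near_one_mult:
  assumes w: "near_one C u w" "near_one D u v" and u: "\<bar>u\<bar> \<le> 1" and CD: "C \<ge> 0" "D \<ge> 0"
  shows "near_one (C + D + 4 * (C * D)) u (w * v)"
proof -
  obtain \<beta> \<gamma> :: real where b: "\<bar>\<beta>\<bar> \<le> C * \<bar>u\<bar>" "norm (w - 1 - \<i> * of_real \<beta>) \<le> C * u^2"
    and c: "\<bar>\<gamma>\<bar> \<le> D * \<bar>u\<bar>" "norm (v - 1 - \<i> * of_real \<gamma>) \<le> D * u^2"
    using w unfolding near_one_def by blast
  define \<rho> where "\<rho> = w - 1 - \<i> * of_real \<beta>"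
  have eq: "w * v - 1 - \<i> * of_real (\<beta> + \<gamma>) = (w - 1) * (v - 1) + \<rho> + (v - 1 - \<i> * of_real \<gamma>)"
    by (simp add: \<rho>_def algebra_simps)
  have "norm ((w - 1) * (v - 1)) \<le> (2 * C * \<bar>u\<bar>) * (2 * D * \<bar>u\<bar>)"
    unfolding norm_mult using near_one_norm[OF w(1) u CD(1)] near_one_norm[OF w(2) u CD(2)] CD by (intro mult_mono) auto
  also have "... = 4 * (C * D) * u^2" by (simp add: power2_eq_square flip: abs_mult)
  finally have "norm (w * v - 1 - \<i> * of_real (\<beta> + \<gamma>)) \<le> 4 * (C * D) * u^2 + C * u^2 + D * u^2"
    unfolding eq using b c by (intro norm_triangle_le add_mono) (auto simp: \<rho>_def)
  moreover have "\<bar>\<beta> + \<gamma>\<bar> \<le> (C + D + 4 * (C * D)) * \<bar>u\<bar>"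
  proof -
    have "\<bar>\<beta> + \<gamma>\<bar> \<le> (C + D) * \<bar>u\<bar>" using b c by (simp add: algebra_simps)
    also have "... \<le> (C + D + 4 * (C * D)) * \<bar>u\<bar>" using CD by (intro mult_right_mono) auto
    finally show ?thesis .
  qed
  ultimately show ?thesis unfolding near_one_def by (intro exI[of _ "\<beta> + \<gamma>"]) (auto simp: algebra_simps)
qed

lemma near_one_inverse:
  assumes w: "near_one C u w" and u: "\<bar>u\<bar> \<le> 1" and C: "C \<ge> 0" and lower: "norm w \<ge> 1 / 4"
  shows "near_one (C + 16 * C^2) u (1 / w)"
proof -
  obtain \<beta> :: real where b: "\<bar>\<beta>\<bar> \<le> C * \<bar>u\<bar>" "norm (w - 1 - \<i> * of_real \<beta>) \<le> C * u^2"
    using w unfolding near_one_def by blast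
  have w0: "w \<noteq> 0" using lower by auto
  have eq: "1 / w - 1 - \<i> * of_real (- \<beta>) = (w - 1) ^ 2 / w - (w - 1 - \<i> * of_real \<beta>)"
    using w0 by (simp add: field_simps power2_eq_square)
  have "norm ((w - 1) ^ 2 / w) \<le> (2 * C * \<bar>u\<bar>) ^ 2 / (1 / 4)"
    unfolding norm_divide norm_power using near_one_norm[OF w u C] lower C by (intro frac_le power_mono) auto
  also have "... = 16 * C^2 * u^2" by (simp add: power_mult_distrib)
  finally have "norm (1 / w - 1 - \<i> * of_real (- \<beta>)) \<le> 16 * C^2 * u^2 + C * u^2"
    unfolding eq using b(2) norm_triangle_ineq4[of "(w - 1) ^ 2 / w" "w - 1 - \<i> * of_real \<beta>"] by linarith
  moreover have "\<bar>- \<beta>\<bar> \<le> (C + 16 * C^2) * \<bar>u\<bar>"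
    using b(1) mult_right_mono[of C "C + 16 * C^2" "\<bar>u\<bar>"] by simp
  ultimately show ?thesis unfolding near_one_def by (intro exI[of _ "- \<beta>"]) (auto simp: algebra_simps)
qed

text \<open>
  Term by term: with y = n^2 \<sigma>, the factor exp(-i y u) is 1 - i y u up to (y u)^2 / 2, and the moments
  y exp(-y) and y^2 exp(-y) are summable over n uniformly in \<sigma>. This uniformity in \<sigma> is essential,
  because \<sigma> = s x is not bounded from above.
\<close>
lemma theta4_vertical_expansion:
  fixes \<sigma> u :: real
  assumes \<sigma>: "\<sigma> \<ge> 5"
  shows "near_one 32 u (theta4 (exp (- (of_real \<sigma> * (1 + \<i> * of_real u)))) / of_real (theta4 (exp (- \<sigma>))))"
proof -
  define c :: "nat \<Rightarrow> real" where "c n = (if n = 0 then 1 else 2) * (-1) ^ n" for n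
  define y where "y n = real (n^2) * \<sigma>" for n
  define A where "A n = c n * exp (- y n)" for n
  define B where "B n = A n * y n" for n
  define D where "D n = of_real (A n) * (exp (- (\<i> * of_real (y n * u))) - 1 + \<i> * of_real (y n * u))" for n
  have c: "\<bar>c n\<bar> \<le> 2" for n by (auto simp: c_def abs_mult)
  have y0: "y n \<ge> 0" for n using \<sigma> by (simp add: y_def)
  have half: "exp (- (y n / 2)) \<le> (1 / 2) ^ n" for n
  proof -
    have "real n \<le> real (n^2)" by (simp add: power2_eq_square del: of_nat_mult)
    hence "real n * 2 \<le> y n" unfolding y_def using \<sigma> by (intro mult_mono) auto
    hence "exp (- (y n / 2)) \<le> exp (- real n)" by simp
    also have "... = exp (- 1) ^ n" by (simp add: exp_of_nat_mult[symmetric])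
    also have "... \<le> (1 / 2) ^ n"
      using exp_ge_add_one_self[of 1] by (intro power_mono) (auto simp: exp_minus field_simps)
    finally show ?thesis .
  qed
  have B: "\<bar>B n\<bar> \<le> 4 * (1 / 2) ^ n" for n
  proof -
    have "y n / 2 \<le> exp (y n / 2)" using exp_ge_add_one_self[of "y n / 2"] by linarith
    hence "y n * exp (- y n) \<le> 2 * exp (y n / 2) * exp (- y n)" by (intro mult_right_mono) auto
    also have "... = 2 * exp (- (y n / 2))" by (simp add: mult.assoc exp_add[symmetric])
    also have "... \<le> 2 * (1 / 2) ^ n" using half[of n] by simp
    finally have "\<bar>c n\<bar> * (y n * exp (- y n)) \<le> 2 * (2 * (1 / 2) ^ n)"
      by (rule mult_mono[OF c]) (use y0[of n] in auto)
    thus ?thesis using y0[of n] by (simp add: B_def A_def abs_mult mult_ac)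
  qed
  have D: "norm (D n) \<le> 8 * u^2 * (1 / 2) ^ n" for n
  proof -
    have "norm (exp (- (\<i> * of_real (y n * u))) - 1 + \<i> * of_real (y n * u)) \<le> (y n * u)^2 / 2"
      using iexp_approx1[of "- (y n * u)" 1] by (simp add: power2_eq_square algebra_simps)
    also have "... = y n ^ 2 / 2 * u^2" by (simp add: power_mult_distrib)
    finally have 1: "norm (exp (- (\<i> * of_real (y n * u))) - 1 + \<i> * of_real (y n * u)) \<le> y n ^ 2 / 2 * u^2" .
    have "(y n / 2) ^ 2 / 2 \<le> exp (y n / 2)"
      using exp_lower_Taylor_quadratic[of "y n / 2"] y0[of n] by simp
    hence "y n ^ 2 / 2 \<le> 4 * exp (y n / 2)" by (simp add: power_divide)
    hence "exp (- y n) * (y n ^ 2 / 2) \<le> exp (- y n) * (4 * exp (y n / 2))" by (intro mult_left_mono) auto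
    also have "... = 4 * exp (- (y n / 2))" by (simp add: mult_ac exp_add[symmetric])
    also have "... \<le> 4 * (1 / 2) ^ n" using half[of n] by simp
    finally have "\<bar>c n\<bar> * (exp (- y n) * (y n ^ 2 / 2)) \<le> 2 * (4 * (1 / 2) ^ n)"
      by (rule mult_mono[OF c]) auto
    hence 2: "\<bar>c n\<bar> * exp (- y n) * (y n ^ 2 / 2) * u^2 \<le> 8 * (1 / 2) ^ n * u^2"
      by (intro mult_right_mono) (auto simp: mult_ac)
    have "norm (D n) = \<bar>c n\<bar> * exp (- y n) * norm (exp (- (\<i> * of_real (y n * u))) - 1 + \<i> * of_real (y n * u))"
      by (simp add: D_def A_def norm_mult abs_mult)
    also have "... \<le> \<bar>c n\<bar> * exp (- y n) * (y n ^ 2 / 2 * u^2)" using 1 by (intro mult_left_mono) auto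
    also have "... \<le> 8 * u^2 * (1 / 2) ^ n" using 2 by (simp add: mult_ac)
    finally show ?thesis .
  qed
  have geo: "summable (\<lambda>n. k * (1 / 2 :: real) ^ n)" "(\<Sum>n. k * (1 / 2 :: real) ^ n) = 2 * k" for k
    by (intro summable_mult summable_geometric; simp) (subst suminf_mult; simp add: suminf_geometric summable_geometric)
  have sB: "summable (\<lambda>n. norm (B n))" by (rule summable_comparison_test'[OF geo(1)[of 4], of 0]) (use B in simp)
  have sD: "summable (\<lambda>n. norm (D n))" by (rule summable_comparison_test'[OF geo(1)[of "8 * u^2"], of 0]) (use D in simp)
  have nB: "\<bar>suminf B\<bar> \<le> 8"
  proof -
    have "norm (suminf B) \<le> (\<Sum>n. norm (B n))" by (rule summable_norm[OF sB])
    also have "... \<le> (\<Sum>n. 4 * (1 / 2) ^ n)" by (rule suminf_le[OF _ sB geo(1)]) (use B in simp)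
    finally show ?thesis by (simp add: geo(2))
  qed
  have nD: "norm (suminf D) \<le> 16 * u^2"
  proof -
    have "norm (suminf D) \<le> (\<Sum>n. norm (D n))" by (rule summable_norm[OF sD])
    also have "... \<le> (\<Sum>n. 8 * u^2 * (1 / 2) ^ n)" by (rule suminf_le[OF D sD geo(1)])
    finally show ?thesis by (simp add: geo(2))
  qed
  have q: "norm (exp (- \<sigma>)) < 1" using \<sigma> by simp
  have ex: "exp (- \<sigma>) ^ (n^2) = exp (- y n)" for n by (simp add: y_def exp_of_nat_mult[symmetric])
  have A: "A sums theta4 (exp (- \<sigma>))"
    using summable_sums[OF summable_norm_cancel[OF summable_theta4[OF q]]] unfolding theta4_def ex A_def c_def by simp
  define z where "z = of_real \<sigma> * (1 + \<i> * of_real u)"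
  have "norm (exp (- z)) < 1" using \<sigma> by (simp add: z_def)
  hence "(\<lambda>n. (if n = 0 then 1 else 2) * (-1) ^ n * exp (- z) ^ (n^2)) sums theta4 (exp (- z))"
    unfolding theta4_def by (intro summable_sums summable_norm_cancel[OF summable_theta4])
  also have "(\<lambda>n. (if n = 0 then 1 else 2) * (-1) ^ n * exp (- z) ^ (n^2)) = (\<lambda>n. of_real (A n) + (- (\<i> * of_real u)) * of_real (B n) + D n)"
  proof
    fix n
    have "exp (- z) ^ (n^2) = exp (of_nat (n^2) * (- z))" by (rule exp_of_nat_mult[symmetric])
    also have "of_nat (n^2) * (- z) = of_real (- y n) + (- (\<i> * of_real (y n * u)))"
      by (simp add: z_def y_def algebra_simps)
    also have "exp ... = of_real (exp (- y n)) * exp (- (\<i> * of_real (y n * u)))"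
      by (simp only: exp_add exp_of_real)
    finally have "(if n = 0 then 1 else 2) * (-1) ^ n * exp (- z) ^ (n^2) = of_real (A n) * exp (- (\<i> * of_real (y n * u)))"
      by (simp add: A_def c_def)
    thus "(if n = 0 then 1 else 2) * (-1) ^ n * exp (- z) ^ (n^2) = of_real (A n) + (- (\<i> * of_real u)) * of_real (B n) + D n"
      by (simp add: D_def B_def algebra_simps)
  qed
  finally have "(\<lambda>n. of_real (A n) + (- (\<i> * of_real u)) * of_real (B n) + D n) sums theta4 (exp (- z))" .
  moreover have "(\<lambda>n. of_real (A n) + (- (\<i> * of_real u)) * of_real (B n) + D n) sums
      (of_real (theta4 (exp (- \<sigma>))) + (- (\<i> * of_real u)) * of_real (suminf B) + suminf D)"
    by (intro sums_add sums_mult sums_of_real A summable_sums summable_norm_cancel[OF sB] summable_norm_cancel[OF sD])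
  ultimately have th: "theta4 (exp (- z)) = of_real (theta4 (exp (- \<sigma>))) + (- (\<i> * of_real u)) * of_real (suminf B) + suminf D"
    by (rule sums_unique2)
  define T where "T = theta4 (exp (- \<sigma>))"
  have T: "T \<ge> 1 / 2"
  proof -
    have "6 \<le> exp \<sigma>" using exp_ge_add_one_self[of \<sigma>] \<sigma> by linarith
    hence "exp (- \<sigma>) \<le> 1 / 6" by (simp add: exp_minus field_simps)
    hence "2 * exp (- \<sigma>) / (1 - exp (- \<sigma>)) \<le> 1 / 2" by (subst pos_divide_le_eq) (use \<sigma> in auto)
    thus ?thesis using theta4_near_one[OF q] by (simp add: T_def abs_le_iff)
  qed
  have eq: "theta4 (exp (- z)) / of_real T - 1 - \<i> * of_real (- (u * suminf B / T)) = suminf D / of_real T"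
    using T unfolding th T_def[symmetric] by (simp add: field_simps)
  show ?thesis unfolding near_one_def z_def[symmetric] T_def[symmetric]
  proof (intro exI conjI)
    show "norm (theta4 (exp (- z)) / of_real T - 1 - \<i> * of_real (- (u * suminf B / T))) \<le> 32 * u^2"
    proof -
      have "norm (suminf D / of_real T) \<le> 16 * u^2 / (1 / 2)"
        unfolding norm_divide using nD T by (intro frac_le) auto
      thus ?thesis unfolding eq by simp
    qed
    have "\<bar>u * suminf B / T\<bar> = \<bar>u\<bar> * \<bar>suminf B\<bar> / T" using T by (simp add: abs_mult)
    also have "... \<le> \<bar>u\<bar> * 8 / (1 / 2)" using nB T by (intro frac_le mult_left_mono) auto
    finally show "\<bar>- (u * suminf B / T)\<bar> \<le> 32 * \<bar>u\<bar>" by simp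
  qed
qed

section \<open>The minor arc\<close>

text \<open>
  The power series of log((1 + w) / (1 - w)) - 2 w has nonnegative coefficients, so its modulus at w
  is at most its value at |w|; only the linear term is kept exactly.
\<close>
lemma norm_over_factor_le_exp:
  fixes w :: complex
  assumes w: "norm w < 1"
  shows "norm ((1 + w) / (1 - w)) \<le> (1 + norm w) / (1 - norm w) * exp (2 * (Re w - norm w))"
proof -
  define c where "c n = (1 - (-1) ^ n) / real n" for n :: nat
  have c0: "c n \<ge> 0" for n unfolding c_def by (cases "even n") auto
  have c1: "c 1 = 2" by (simp add: c_def)
  have series: "(\<lambda>n. of_real (c n) * v ^ n) sums (Ln (1 + v) - Ln (1 - v))" if v: "norm v < 1" for v :: complex
  proof -
    have "(\<lambda>n. (-1) ^ Suc n / of_nat n * v ^ n - (-1) ^ Suc n / of_nat n * (- v) ^ n) sums (Ln (1 + v) - Ln (1 + (- v)))"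
      using v by (intro sums_diff Ln_series) auto
    also have "(\<lambda>n. (-1) ^ Suc n / of_nat n * v ^ n - (-1) ^ Suc n / of_nat n * (- v) ^ n) = (\<lambda>n. of_real (c n) * v ^ n)"
    proof
      fix n :: nat
      have "(- v) ^ n = (-1) ^ n * v ^ n" by (rule power_minus)
      thus "(-1) ^ Suc n / of_nat n * v ^ n - (-1) ^ Suc n / of_nat n * (- v) ^ n = of_real (c n) * v ^ n"
        by (cases "even n") (auto simp: c_def field_simps)
    qed
    finally show ?thesis by simp
  qed
  define d where "d n = (if n = 1 then 0 else c n)" for n
  have d0: "d n \<ge> 0" for n using c0 by (simp add: d_def)
  have series': "(\<lambda>n. of_real (d n) * v ^ n) sums (Ln (1 + v) - Ln (1 - v) - 2 * v)" if v: "norm v < 1" for v :: complex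
  proof -
    have "(\<lambda>n. of_real (c n) * v ^ n - (if n = 1 then 2 * v ^ n else 0)) sums (Ln (1 + v) - Ln (1 - v) - 2 * v ^ 1)"
      by (intro sums_diff series v sums_single)
    also have "(\<lambda>n. of_real (c n) * v ^ n - (if n = 1 then 2 * v ^ n else 0)) = (\<lambda>n. of_real (d n) * v ^ n)"
      using c1 by (auto simp: d_def fun_eq_iff)
    finally show ?thesis by simp
  qed
  have Re_eq: "Re (Ln (1 + v) - Ln (1 - v) - 2 * v) = ln (norm ((1 + v) / (1 - v))) - 2 * Re v" 
    and nz: "1 + v \<noteq> 0" "1 - v \<noteq> 0" if v: "norm v < 1" for v :: complex
  proof -
    show nz: "1 + v \<noteq> 0" "1 - v \<noteq> 0" using v by (auto simp: add_eq_0_iff)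
    thus "Re (Ln (1 + v) - Ln (1 - v) - 2 * v) = ln (norm ((1 + v) / (1 - v))) - 2 * Re v"
      by (simp add: norm_divide ln_div)
  qed
  define r where "r = norm w"
  have r: "0 \<le> r" "r < 1" using w by (auto simp: r_def)
  have "(\<lambda>n. Re (of_real (d n) * of_real r ^ n)) sums Re (Ln (1 + of_real r) - Ln (1 - of_real r) - 2 * of_real r)"
    using r by (intro sums_Re series') auto
  hence sr: "(\<lambda>n. d n * r ^ n) sums (ln (norm ((1 + of_real r) / (1 - of_real r :: complex))) - 2 * r)"
    using Re_eq[of "of_real r"] r by (simp flip: of_real_power of_real_mult)
  have "Re (Ln (1 + w) - Ln (1 - w) - 2 * w) \<le> norm (Ln (1 + w) - Ln (1 - w) - 2 * w)"
    by (rule complex_Re_le_cmod)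
  also have "... \<le> ln (norm ((1 + of_real r) / (1 - of_real r :: complex))) - 2 * r"
  proof (rule norm_sums_le)
    show "(\<lambda>n. of_real (d n) * w ^ n) sums (Ln (1 + w) - Ln (1 - w) - 2 * w)" by (rule series'[OF w])
    show "(\<lambda>n. d n * r ^ n) sums (ln (norm ((1 + of_real r) / (1 - of_real r :: complex))) - 2 * r)" by (rule sr)
    show "norm (of_real (d n) * w ^ n) \<le> d n * r ^ n" for n
      using d0[of n] by (simp add: norm_mult norm_power r_def)
  qed
  also have "(1 + of_real r) / (1 - of_real r :: complex) = of_real ((1 + r) / (1 - r))" by simp
  also have "norm (of_real ((1 + r) / (1 - r)) :: complex) = (1 + r) / (1 - r)"
    unfolding norm_of_real using r by simp
  finally have "ln (norm ((1 + w) / (1 - w))) \<le> ln ((1 + r) / (1 - r)) + 2 * (Re w - r)"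
    using Re_eq[OF w] by simp
  hence "exp (ln (norm ((1 + w) / (1 - w)))) \<le> exp (ln ((1 + r) / (1 - r)) + 2 * (Re w - r))" by simp
  moreover have "(1 + r) / (1 - r) > 0" using r by auto
  moreover have "norm ((1 + w) / (1 - w)) > 0" using nz[OF w] by simp
  ultimately show ?thesis by (simp add: exp_add r_def)
qed

lemma norm_over_prod_le_exp:
  fixes q :: complex
  assumes q: "norm q < 1"
  shows "norm (over_prod n q) \<le> over_prod n (norm q) * exp (2 * (Re (\<Sum>k=1..n. q ^ k) - (\<Sum>k=1..n. norm q ^ k)))"
proof -
  have "norm (over_prod n q) = (\<Prod>k=1..n. norm ((1 + q ^ k) / (1 - q ^ k)))"
    by (simp add: over_prod_def prod_norm)
  also have "... \<le> (\<Prod>k=1..n. (1 + norm q ^ k) / (1 - norm q ^ k) * exp (2 * (Re (q ^ k) - norm q ^ k)))"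
  proof (intro prod_mono conjI)
    fix k assume "k \<in> {1..n}"
    hence "norm (q ^ k) < 1" using q by (simp add: norm_power power_less_one_iff)
    from norm_over_factor_le_exp[OF this]
    show "norm ((1 + q ^ k) / (1 - q ^ k)) \<le> (1 + norm q ^ k) / (1 - norm q ^ k) * exp (2 * (Re (q ^ k) - norm q ^ k))"
      by (simp only: norm_power)
  qed simp
  also have "... = over_prod n (norm q) * exp (\<Sum>k=1..n. 2 * (Re (q ^ k) - norm q ^ k))"
    by (simp only: prod.distrib over_prod_def exp_sum finite_atLeastAtMost)
  also have "(\<Sum>k=1..n. 2 * (Re (q ^ k) - norm q ^ k)) = 2 * (Re (\<Sum>k=1..n. q ^ k) - (\<Sum>k=1..n. norm q ^ k))"
    by (simp only: sum_distrib_left[symmetric] sum_subtractf Re_sum)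
  finally show ?thesis .
qed

lemma sum_powers_tendsto:
  fixes q :: "'a::{real_normed_field,banach}"
  assumes "norm q < 1"
  shows "(\<lambda>n. \<Sum>k=1..n. q ^ k) \<longlonglongrightarrow> q / (1 - q)"
proof -
  have "(\<lambda>k. q * q ^ k) sums (q * (1 / (1 - q)))" by (intro sums_mult geometric_sums assms)
  hence "(\<lambda>n. \<Sum>k<n. q * q ^ k) \<longlonglongrightarrow> q / (1 - q)" by (simp add: sums_def)
  moreover have "(\<Sum>k<n. q * q ^ k) = (\<Sum>k=1..n. q ^ k)" for n
    by (rule sum.reindex_bij_witness[of _ "\<lambda>k. k - 1" Suc]) auto
  ultimately show ?thesis by simp
qed

lemma theta4_real_pos:
  assumes "0 \<le> r" "r < (1::real)"
  shows "theta4 r > 0"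
proof -
  have r: "norm r < 1" using assms by simp
  have "1 / theta4 r \<ge> 0"
    using over_prod_tendsto(2)[OF r] over_prod_nonneg[OF assms] by (intro LIMSEQ_le_const) auto
  with over_prod_tendsto(1)[OF r] show ?thesis by (simp add: less_le)
qed

text \<open>
  Multiplying the bound for one factor over all powers of q turns the linear terms into a geometric series.
\<close>
lemma inverse_theta4_le_exp:
  fixes q :: complex
  assumes q: "norm q < 1"
  shows "norm (1 / theta4 q) \<le> 1 / theta4 (norm q) * exp (2 * (Re (q / (1 - q)) - norm q / (1 - norm q)))"
proof (rule LIMSEQ_le)
  have r: "norm (norm q) < 1" using q by simp
  show "(\<lambda>n. norm (over_prod n q)) \<longlonglongrightarrow> norm (1 / theta4 q)"
    by (intro tendsto_norm over_prod_tendsto q)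
  show "(\<lambda>n. over_prod n (norm q) * exp (2 * (Re (\<Sum>k=1..n. q ^ k) - (\<Sum>k=1..n. norm q ^ k)))) \<longlonglongrightarrow> 1 / theta4 (norm q) * exp (2 * (Re (q / (1 - q)) - norm q / (1 - norm q)))"
    by (intro tendsto_mult over_prod_tendsto tendsto_exp tendsto_const tendsto_diff tendsto_Re sum_powers_tendsto q r)
  show "\<exists>N. \<forall>n\<ge>N. norm (over_prod n q) \<le> over_prod n (norm q) * exp (2 * (Re (\<Sum>k=1..n. q ^ k) - (\<Sum>k=1..n. norm q ^ k)))"
    using norm_over_prod_le_exp[OF q] by blast
qed

lemma theta_psi_ge_one: "0 \<le> w \<Longrightarrow> w < 1 \<Longrightarrow> theta_psi (w::real) \<ge> 1"
proof -
  assume w: "0 \<le> w" "w < 1"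
  have "summable (\<lambda>n. w ^ (n * (n + 1)))" using summable_norm_cancel[OF summable_theta_psi[of w]] w by simp
  from sum_le_suminf[OF this, of "{0}"] show ?thesis using w by (simp add: theta_psi_def)
qed

lemma theta4_inversion_real:
  assumes x: "x > 0"
  shows "theta4 (exp (- x)) = 2 * sqrt (pi / x) * exp (- (pi^2 / (4 * x))) * theta_psi (exp (- (pi^2 / x)))"
proof -
  have "theta4 (exp (- complex_of_real x)) = 2 * csqrt (of_real pi / of_real x) * exp (- (of_real (pi^2 / 4) / of_real x)) * theta_psi (exp (- (of_real (pi^2) / of_real x)))"
    by (rule theta4_inversion) (use x in simp)
  also have "exp (- complex_of_real x) = of_real (exp (- x))"
    by (subst exp_of_real[symmetric]) simp
  also have "exp (- (complex_of_real (pi^2 / 4) / complex_of_real x)) = of_real (exp (- (pi^2 / (4 * x))))"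
    by (subst exp_of_real[symmetric]) simp
  also have "exp (- (complex_of_real (pi^2) / complex_of_real x)) = of_real (exp (- (pi^2 / x)))"
    by (subst exp_of_real[symmetric]) simp
  also have "csqrt (complex_of_real pi / complex_of_real x) = of_real (sqrt (pi / x))"
    using x by (simp flip: of_real_divide)
  also have "theta4 (of_real (exp (- x)) :: complex) = of_real (theta4 (exp (- x)))"
    using x by (intro theta4_of_real) simp
  also have "theta_psi (of_real (exp (- (pi^2 / x))) :: complex) = of_real (theta_psi (exp (- (pi^2 / x))))"
    using x by (intro theta_psi_of_real) simp
  finally have "complex_of_real (theta4 (exp (- x))) = of_real (2 * sqrt (pi / x) * exp (- (pi^2 / (4 * x))) * theta_psi (exp (- (pi^2 / x))))"
    by simp
  thus ?thesis by (simp only: of_real_eq_iff)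
qed

lemma inverse_theta4_real_le:
  assumes x: "0 < x" "x \<le> 1"
  shows "1 / theta4 (exp (- x)) \<le> exp (pi^2 / (4 * x))"
proof -
  have "1 \<le> sqrt (pi / x)" using x pi_gt3 by simp
  moreover have "1 \<le> theta_psi (exp (- (pi^2 / x)))" using x by (intro theta_psi_ge_one) auto
  ultimately have "2 * 1 * exp (- (pi^2 / (4 * x))) * 1 \<le> theta4 (exp (- x))"
    unfolding theta4_inversion_real[OF x(1)] by (intro mult_mono) auto
  moreover have "0 < exp (- (pi^2 / (4 * x)))" by simp
  ultimately have "exp (- (pi^2 / (4 * x))) \<le> theta4 (exp (- x))" by linarith
  hence "1 / theta4 (exp (- x)) \<le> 1 / exp (- (pi^2 / (4 * x)))"
    by (intro frac_le) simp_all
  thus ?thesis by (simp add: exp_minus inverse_eq_divide)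
qed

text \<open>
  The square of the left-hand side is (exp x - 1)^2 + 4 exp(x) sin(y/2)^2, which is smallest at
  |y| = x, and about 2 x^2 there if x is small. The constant satisfies 1 / 0.76^2 \<le> 1 + 4 * 0.43^2.
\<close>
lemma norm_exp_minus_one_ge:
  assumes x: "0 < x" "x \<le> 1" and y: "x \<le> \<bar>y\<bar>" "\<bar>y\<bar> \<le> pi"
  shows "norm (exp (Complex x y) - 1) \<ge> x / 0.76"
proof -
  define s where "s = sin (\<bar>y\<bar> / 2)"
  have s: "s \<ge> 0.43 * x"
  proof -
    have "0.43 * x \<le> sin (x / 2)"
    proof -
      define a where "a = x / 2"
      have a: "0 \<le> a" "a \<le> 1 / 2" using x by (auto simp: a_def)
      have "a < pi / 2" using a pi_gt3 by linarith
      have "cos a > 0" using a \<open>a < pi / 2\<close> by (intro cos_gt_zero_pi) auto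
      have "a \<le> tan a"
        using abs_tan_ge[of a] a \<open>a < pi / 2\<close> tan_pos_pi2_le[of a] by simp
      hence "a * cos a \<le> sin a" using \<open>cos a > 0\<close> by (simp add: tan_def field_simps)
      moreover have "0.86 \<le> cos a"
      proof -
        have "sin (a / 2) \<le> 1 / 4" using sin_x_le_x[of "a / 2"] a by simp
        moreover have "sin (a / 2) \<ge> 0" using a pi_gt3 by (intro sin_ge_zero) auto
        ultimately have "(sin (a / 2))^2 \<le> (1 / 4)^2" by (intro power_mono)
        thus ?thesis using cos_double_sin[of "a / 2"] by (simp add: power_divide)
      qed
      hence "a * 0.86 \<le> a * cos a" using a by (intro mult_left_mono)
      moreover have "0.43 * x = a * 0.86" by (simp add: a_def)
      ultimately have "0.43 * x \<le> sin a" by linarith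
      also have "... = sin (x / 2)" by (simp add: a_def)
      finally show ?thesis .
    qed
    also have "... \<le> s" unfolding s_def using x y by (intro sin_monotone_2pi_le) auto
    finally show ?thesis .
  qed
  have norm_eq: "(norm (exp (Complex x y) - 1))^2 = (exp x * cos y - 1)^2 + (exp x * sin y)^2"
    by (simp add: cmod_power2 Re_exp Im_exp)
  have alg: "(e * c - 1)^2 + (e * d)^2 = e^2 * (c^2 + d^2) - 2 * e * c + 1" for e c d :: real
    by (simp add: power2_eq_square algebra_simps)
  note norm_eq
  also have "(exp x * cos y - 1)^2 + (exp x * sin y)^2 = (exp x)^2 * ((cos y)^2 + (sin y)^2) - 2 * exp x * cos y + 1"
    by (rule alg)
  also have "... = (exp x)^2 - 2 * exp x * cos y + 1"
    by (simp only: sin_cos_squared_add2 mult_1_right)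
  also have "cos y = 1 - 2 * s^2"
    unfolding s_def using cos_double_sin[of "\<bar>y\<bar> / 2"] by simp
  also have "(exp x)^2 - 2 * exp x * (1 - 2 * s^2) + 1 = (exp x - 1)^2 + 4 * exp x * s^2"
    by (simp add: power2_eq_square algebra_simps)
  finally have eq: "(norm (exp (Complex x y) - 1))^2 = (exp x - 1)^2 + 4 * exp x * s^2" .
  have "x \<le> exp x - 1" using exp_ge_add_one_self[of x] by linarith
  hence "x^2 \<le> (exp x - 1)^2" by (rule power_mono) (use x in simp)
  moreover have "(0.43 * x)^2 \<le> s^2" by (rule power_mono[OF s]) (use x in simp)
  hence "1 * (0.43 * x)^2 \<le> exp x * s^2"
    by (rule mult_mono[rotated]) (use x in simp_all)
  moreover have "(x / 0.76)^2 \<le> x^2 + 4 * (1 * (0.43 * x)^2)"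
  proof -
    have "(1 / 0.76)^2 \<le> 1 + 4 * (0.43^2 :: real)" by (simp add: power2_eq_square)
    hence "(1 / 0.76)^2 * x^2 \<le> (1 + 4 * 0.43^2) * x^2" by (rule mult_right_mono) simp
    thus ?thesis by (simp only: power_mult_distrib power_divide distrib_right mult_1_left mult.assoc times_divide_eq_left power_one)
  qed
  ultimately have "(x / 0.76)^2 \<le> (norm (exp (Complex x y) - 1))^2" unfolding eq by linarith
  thus ?thesis by (rule power2_le_imp_le) simp
qed

text \<open>
  On the real axis q / (1 - q) is at least 1/x - 1, while off the axis its modulus is at most 0.76 / x.
  Twice the difference, about 0.48 / x, is gained in the exponent.
\<close>
lemma inverse_theta4_minor_arc:
  assumes x: "0 < x" "x \<le> 1" and y: "x \<le> \<bar>y\<bar>" "\<bar>y\<bar> \<le> pi"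
  shows "norm (1 / theta4 (exp (- Complex x y))) \<le> exp (pi^2 / (4 * x) + 2 - 0.48 / x)"
proof -
  define q where "q = exp (- Complex x y)"
  have nq: "norm q = exp (- x)" by (simp add: q_def)
  have q: "norm q < 1" using x by (simp add: nq)
  have e: "q / (1 - q) = 1 / (exp (Complex x y) - 1)"
  proof -
    have "exp (Complex x y) \<noteq> 1" 
    proof
      assume "exp (Complex x y) = 1"
      hence "norm (exp (Complex x y)) = 1" by simp
      thus False using x by simp
    qed
    thus ?thesis by (simp add: q_def exp_minus field_simps)
  qed
  have "Re (q / (1 - q)) \<le> norm (1 / (exp (Complex x y) - 1))"
    unfolding e by (rule complex_Re_le_cmod)
  also have "... = 1 / norm (exp (Complex x y) - 1)" by (simp add: norm_divide)
  also have "... \<le> 1 / (x / 0.76)"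
    using norm_exp_minus_one_ge[OF assms] x by (intro divide_left_mono) (auto intro!: mult_pos_pos)
  finally have 1: "Re (q / (1 - q)) \<le> 0.76 * (1 / x)" by simp
  have 2: "norm q / (1 - norm q) \<ge> 1 / x - 1"
  proof -
    have "1 + x \<le> exp x" by (rule exp_ge_add_one_self)
    have "exp x - 1 > 0" using x by simp
    have "norm q / (1 - norm q) = 1 / (exp x - 1)"
      using x by (simp add: nq exp_minus field_simps)
    moreover have "(1 - x) * exp x \<le> 1"
    proof -
      have "1 - x \<le> exp (- x)" using exp_ge_add_one_self[of "-x"] by simp
      hence "(1 - x) * exp x \<le> exp (- x) * exp x" by (intro mult_right_mono) auto
      thus ?thesis by (simp add: exp_minus)
    qed
    hence "(1 / x - 1) * (exp x - 1) \<le> 1" using x by (simp add: field_simps)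
    hence "1 / x - 1 \<le> 1 / (exp x - 1)" using \<open>exp x - 1 > 0\<close> by (simp add: le_divide_eq)
    ultimately show ?thesis by simp
  qed
  have "norm (1 / theta4 q) \<le> 1 / theta4 (norm q) * exp (2 * (Re (q / (1 - q)) - norm q / (1 - norm q)))"
    by (rule inverse_theta4_le_exp[OF q])
  also have "... \<le> exp (pi^2 / (4 * x)) * exp (2 - 0.48 / x)"
  proof (intro mult_mono)
    show "1 / theta4 (norm q) \<le> exp (pi^2 / (4 * x))" unfolding nq by (rule inverse_theta4_real_le[OF x])
    have "2 * (Re (q / (1 - q)) - norm q / (1 - norm q)) \<le> 2 * (0.76 * (1 / x) - (1 / x - 1))"
      by (intro mult_left_mono diff_mono 1 2) auto
    also have "... = 2 - 0.48 / x" by (simp add: field_simps)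
    finally show "exp (2 * (Re (q / (1 - q)) - norm q / (1 - norm q))) \<le> exp (2 - 0.48 / x)" by simp
  qed auto
  also have "... = exp (pi^2 / (4 * x) + 2 - 0.48 / x)"
    by (simp only: exp_add[symmetric] add_diff_eq)
  finally show ?thesis unfolding q_def .
qed

section \<open>The Gaussian integral near the saddle point\<close>

lemma power_le_fact_exp:
  assumes "y \<ge> (0::real)"
  shows "y ^ k \<le> fact k * exp y"
proof -
  have "(\<Sum>n\<in>{k}. inverse (fact n) *\<^sub>R y ^ n) \<le> (\<Sum>n. inverse (fact n) *\<^sub>R y ^ n)"
    using assms by (intro sum_le_suminf summable_exp_generic) auto
  hence "inverse (fact k) * y ^ k \<le> exp y" by (simp add: exp_def)
  hence "fact k * (inverse (fact k) * y ^ k) \<le> fact k * exp y" by (intro mult_left_mono) auto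
  thus ?thesis by (simp add: mult.assoc[symmetric])
qed

lemma power_times_exp_le:
  assumes "v \<ge> (0::real)" "c > 0"
  shows "v ^ k * exp (- (v / c)) \<le> fact k * c ^ k"
proof -
  have "(v / c) ^ k \<le> fact k * exp (v / c)" using assms by (intro power_le_fact_exp) auto
  hence "v ^ k \<le> fact k * c ^ k * exp (v / c)" using assms by (simp add: power_divide field_simps)
  hence "v ^ k * exp (- (v / c)) \<le> fact k * c ^ k * exp (v / c) * exp (- (v / c))"
    by (intro mult_right_mono) auto
  thus ?thesis by (simp add: mult.assoc exp_add[symmetric])
qed

text \<open>
  M u^2 / (1 + iu) is the drop of the exponent N z + A / z from its value 2 M at the saddle point x to z = x (1 + iu).
\<close>
lemma saddle_exponent:
  "exp (- (of_real (M * u^2) / (1 + \<i> * of_real u)))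
   = of_real (exp (- (M * u^2 / (1 + u^2)))) * cis (M * u ^ 3 / (1 + u^2))"
proof -
  have 1: "1 + \<i> * of_real u \<noteq> 0" by (auto simp: complex_eq_iff)
  have 2: "1 + u^2 > 0" by (intro add_pos_nonneg) auto
  have "(1 + \<i> * of_real u) * (1 - \<i> * of_real u) = of_real (1 + u^2)"
    by (simp add: complex_eq_iff power2_eq_square)
  moreover have "(of_real (1 + u^2) :: complex) \<noteq> 0" using 2 by (metis less_irrefl of_real_eq_0_iff)
  moreover have "c / a = c * b / d" if "a * b = d" "d \<noteq> 0" for a b c d :: complex
    using that by (auto simp: field_simps)
  ultimately have "of_real (M * u^2) / (1 + \<i> * of_real u) = of_real (M * u^2) * (1 - \<i> * of_real u) / of_real (1 + u^2)"
    by blast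
  also have "- ... = of_real (- (M * u^2 / (1 + u^2))) + \<i> * of_real (M * u ^ 3 / (1 + u^2))"
    using 2 by (simp add: complex_eq_iff power2_eq_square power3_eq_cube)
  finally show ?thesis
    by (simp only: exp_add exp_of_real cis_conv_exp)
qed

lemma abs_cos_minus_one_le: "\<bar>cos (\<phi>::real) - 1\<bar> \<le> \<phi>^2 / 2"
proof -
  have "(sin (\<phi> / 2))^2 \<le> (\<phi> / 2)^2"
    using abs_sin_x_le_abs_x[of "\<phi> / 2"] by (simp only: abs_le_square_iff)
  thus ?thesis using cos_double_sin[of "\<phi> / 2"] by (simp add: power_divide)
qed

text \<open>
  Put v = M u^2. The phase is at most M |u|^3, so its square, its product with the first order term of
  g, and the u^2 errors are all of the form (polynomial in v) / M; the polynomial is absorbed by a part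
  of the Gaussian. The factor P is allowed to be off by as much as exp(8/9 ...) because one ninth of
  the decay still remains.
\<close>
lemma major_arc_pointwise:
  fixes M u C K :: real and P g :: complex
  assumes M: "M > 0" and u: "\<bar>u\<bar> \<le> 1" and g: "near_one C u g" and C: "C \<ge> 0" and K: "K \<ge> 0"
    and P: "norm (P - 1) \<le> K / M * exp (8 / 9 * (M * u^2 / (1 + u^2)))"
  shows "\<bar>Re (exp (- (of_real (M * u^2) / (1 + \<i> * of_real u))) * P * g) - exp (- (M * u^2))\<bar>
         \<le> (224 + 36 * C + (1 + 2 * C) * K) / M * exp (- (M * u^2 / 36))"
proof -
  define v where "v = M * u^2"
  define E where "E = exp (- (M * u^2 / (1 + u^2)))"
  define \<phi> where "\<phi> = M * u ^ 3 / (1 + u^2)"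
  obtain \<beta> :: real where \<beta>: "\<bar>\<beta>\<bar> \<le> C * \<bar>u\<bar>" "norm (g - 1 - \<i> * of_real \<beta>) \<le> C * u^2"
    using g unfolding near_one_def by blast
  define \<rho> where "\<rho> = g - 1 - \<i> * of_real \<beta>"
  have v: "v \<ge> 0" using M by (simp add: v_def)
  have u2: "0 \<le> u^2" "u^2 \<le> 1" using u by (auto simp: abs_square_le_1)
  have u2': "0 < 1 + u^2" using u2 by linarith
  have u4: "u ^ 4 = u^2 * u^2" by (simp add: power2_eq_square power4_eq_xxxx)
  have \<phi>: "\<bar>\<phi>\<bar> \<le> M * \<bar>u\<bar> ^ 3"
  proof -
    have "\<bar>\<phi>\<bar> = M * \<bar>u\<bar> ^ 3 / (1 + u^2)" using M by (simp add: \<phi>_def abs_mult power_abs)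
    also have "... \<le> M * \<bar>u\<bar> ^ 3 / 1" using M by (intro divide_left_mono mult_pos_pos u2') auto
    finally show ?thesis by simp
  qed
  have E_pos: "E > 0" by (simp add: E_def)
  have E2: "E \<le> exp (- (v / 2))"
  proof -
    have "v / 2 \<le> v / (1 + u^2)" using v u2 u2' by (intro divide_left_mono mult_pos_pos) auto
    thus ?thesis by (simp add: E_def v_def)
  qed
  have Ev: "\<bar>E - exp (- v)\<bar> \<le> E * (v^2 / M)"
  proof -
    have "u^2 / (1 + u^2) \<ge> u^2 - u ^ 4"
    proof -
      have "(u^2 - u^2 * u^2) * (1 + u^2) = u^2 - u^2 * u^2 * u^2" by (simp add: algebra_simps)
      also have "... \<le> u^2" by simp
      finally have "u^2 - u^2 * u^2 \<le> u^2 / (1 + u^2)" by (simp only: pos_le_divide_eq[OF u2'])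
      thus ?thesis by (simp only: u4)
    qed
    hence "M * (u^2 - u ^ 4) \<le> M * (u^2 / (1 + u^2))" using M by (intro mult_left_mono) auto
    moreover have "M * (u^2 - u ^ 4) = v - v^2 / M"
      unfolding v_def u4 using M by (simp add: right_diff_distrib power2_eq_square)
    ultimately have 1: "M * u^2 / (1 + u^2) \<ge> v - v^2 / M" by simp
    have 2: "M * u^2 / (1 + u^2) \<le> v"
    proof -
      have "M * u^2 / (1 + u^2) \<le> M * u^2 / 1"
        using M u2 u2' by (intro divide_left_mono mult_pos_pos) auto
      thus ?thesis by (simp add: v_def)
    qed
    have "E - exp (- v) = E * (1 - exp (M * u^2 / (1 + u^2) - v))"
      by (simp add: E_def algebra_simps exp_add[symmetric])
    moreover have "1 - exp (M * u^2 / (1 + u^2) - v) \<le> v^2 / M"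
      using exp_ge_add_one_self[of "M * u^2 / (1 + u^2) - v"] 1 by linarith
    hence "E * (1 - exp (M * u^2 / (1 + u^2) - v)) \<le> E * (v^2 / M)"
      using E_pos by (intro mult_left_mono) auto
    moreover have "1 - exp (M * u^2 / (1 + u^2) - v) \<ge> 0" using 2 by simp
    hence "E * (1 - exp (M * u^2 / (1 + u^2) - v)) \<ge> 0" using E_pos by simp
    ultimately show ?thesis by linarith
  qed
  have R1: "\<bar>Re (cis \<phi> * g) - 1\<bar> \<le> (v ^ 3 / 2 + C * v^2 + C * v) / M"
  proof -
    have g_eq: "g = 1 + \<i> * of_real \<beta> + \<rho>" by (simp add: \<rho>_def)
    have "Re (cis \<phi> * g) - 1 = (cos \<phi> - 1) - \<beta> * sin \<phi> + Re (cis \<phi> * \<rho>)"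
      unfolding g_eq by (simp add: algebra_simps)
    moreover have "\<bar>Re (cis \<phi> * \<rho>)\<bar> \<le> C * u^2"
      using abs_Re_le_cmod[of "cis \<phi> * \<rho>"] \<beta>(2) by (simp add: norm_mult \<rho>_def)
    moreover have "\<bar>cos \<phi> - 1\<bar> \<le> (M * \<bar>u\<bar> ^ 3)^2 / 2"
    proof -
      have "\<phi>^2 \<le> (M * \<bar>u\<bar> ^ 3)^2" using \<phi> M by (intro abs_le_square_iff[THEN iffD1]) (simp add: abs_mult power_abs)
      thus ?thesis using abs_cos_minus_one_le[of \<phi>] by linarith
    qed
    moreover have "\<bar>\<beta> * sin \<phi>\<bar> \<le> C * \<bar>u\<bar> * (M * \<bar>u\<bar> ^ 3)"
      unfolding abs_mult using \<beta>(1) \<phi> abs_sin_x_le_abs_x[of \<phi>] C by (intro mult_mono) auto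
    ultimately have "\<bar>Re (cis \<phi> * g) - 1\<bar> \<le> (M * \<bar>u\<bar> ^ 3)^2 / 2 + C * \<bar>u\<bar> * (M * \<bar>u\<bar> ^ 3) + C * u^2"
      by linarith
    also have "(M * \<bar>u\<bar> ^ 3)^2 = v ^ 3 / M"
    proof -
      have "(\<bar>u\<bar> ^ 3)^2 = (u^2) ^ 3" by (simp only: power_mult[symmetric] mult.commute[of 3 2]) (simp only: power_mult power2_abs)
      thus ?thesis using M by (simp add: v_def power_mult_distrib power2_eq_square power3_eq_cube)
    qed
    also have "C * \<bar>u\<bar> * (M * \<bar>u\<bar> ^ 3) = C * v^2 / M"
    proof -
      have "\<bar>u\<bar> * \<bar>u\<bar> ^ 3 = u^2 * u^2" by (simp add: power3_eq_cube power2_eq_square flip: abs_mult)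
      hence "C * \<bar>u\<bar> * (M * \<bar>u\<bar> ^ 3) = C * M * (u^2 * u^2)" by (metis mult.assoc mult.left_commute)
      thus ?thesis using M by (simp add: v_def power2_eq_square)
    qed
    also have "C * u^2 = C * v / M" using M by (simp add: v_def)
    finally show ?thesis by (simp add: add_divide_distrib)
  qed
  have g_norm: "norm g \<le> 1 + 2 * C"
  proof -
    have "norm (g - 1) \<le> 2 * C * \<bar>u\<bar>" by (rule near_one_norm[OF g u C])
    also have "... \<le> 2 * C * 1" using u C by (intro mult_left_mono) auto
    finally show ?thesis using norm_triangle_ineq[of "g - 1" 1] by simp
  qed
  have T3: "\<bar>E * Re (cis \<phi> * g * (P - 1))\<bar> \<le> (1 + 2 * C) * K / M * exp (- (v / 36))"
  proof -
    have "\<bar>E * Re (cis \<phi> * g * (P - 1))\<bar> \<le> E * norm (cis \<phi> * g * (P - 1))"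
      unfolding abs_mult using E_pos by (intro mult_mono abs_Re_le_cmod) auto
    also have "... = E * (norm g * norm (P - 1))" by (simp add: norm_mult)
    also have "... \<le> E * ((1 + 2 * C) * (K / M * exp (8 / 9 * (M * u^2 / (1 + u^2)))))"
      using E_pos g_norm P C by (intro mult_left_mono mult_mono) auto
    also have "... = (1 + 2 * C) * K / M * (E * exp (8 / 9 * (M * u^2 / (1 + u^2))))" by simp
    also have "E * exp (8 / 9 * (M * u^2 / (1 + u^2))) = exp (- (v / (1 + u^2) / 9))"
    proof -
      have "exp (- y) * exp (8 / 9 * y) = exp (- (y / 9))" for y :: real by (simp add: exp_add[symmetric])
      from this[of "M * u^2 / (1 + u^2)"] show ?thesis by (simp only: E_def v_def)
    qed
    also have "(1 + 2 * C) * K / M * exp (- (v / (1 + u^2) / 9)) \<le> (1 + 2 * C) * K / M * exp (- (v / 36))"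
    proof (intro mult_left_mono)
      have "v / 4 \<le> v / (1 + u^2)" using v u2 u2' by (intro divide_left_mono mult_pos_pos) auto
      hence "v / 4 / 9 \<le> v / (1 + u^2) / 9" by (rule divide_right_mono) simp
      moreover have "v / 36 = v / 4 / 9" by simp
      ultimately show "exp (- (v / (1 + u^2) / 9)) \<le> exp (- (v / 36))"
        by (simp only: exp_le_cancel_iff neg_le_iff_le)
    qed (use C K M in auto)
    finally show ?thesis .
  qed
  have T12: "E * ((v ^ 3 / 2 + (C + 1) * v^2 + C * v) / M) \<le> (224 + 36 * C) / M * exp (- (v / 36))"
  proof -
    have "exp (- (v / 2)) = exp (- (v / 4)) * exp (- (v / 4))" by (simp add: exp_add[symmetric])
    hence "E * ((v ^ 3 / 2 + (C + 1) * v^2 + C * v) / M) \<le> exp (- (v / 4)) * exp (- (v / 4)) * ((v ^ 3 / 2 + (C + 1) * v^2 + C * v) / M)"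
      using E2 v C M by (intro mult_right_mono) auto
    also have "... = exp (- (v / 4)) * ((v ^ 3 * exp (- (v / 4)) / 2 + (C + 1) * (v^2 * exp (- (v / 4))) + C * (v ^ 1 * exp (- (v / 4)))) / M)"
      by (simp add: algebra_simps add_divide_distrib)
    also have "... \<le> exp (- (v / 4)) * ((fact 3 * 4 ^ 3 / 2 + (C + 1) * (fact 2 * 4 ^ 2) + C * (fact 1 * 4 ^ 1)) / M)"
      using v C M by (intro mult_left_mono divide_right_mono add_mono mult_left_mono power_times_exp_le) auto
    also have "... = (224 + 36 * C) / M * exp (- (v / 4))" by (simp add: fact_numeral algebra_simps)
    also have "... \<le> (224 + 36 * C) / M * exp (- (v / 36))" using v C M by (intro mult_left_mono) auto
    finally show ?thesis .
  qed
  have "Re (exp (- (of_real (M * u^2) / (1 + \<i> * of_real u))) * P * g) - exp (- (M * u^2))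
      = E * (Re (cis \<phi> * g) - 1) + (E - exp (- v)) + E * Re (cis \<phi> * g * (P - 1))"
  proof -
    have "exp (- (of_real (M * u^2) / (1 + \<i> * of_real u))) * P * g = of_real E * (cis \<phi> * g + cis \<phi> * g * (P - 1))"
      unfolding saddle_exponent by (simp add: E_def \<phi>_def algebra_simps)
    moreover have "Re (of_real E * c) = E * Re c" for c :: complex by simp
    ultimately have "Re (exp (- (of_real (M * u^2) / (1 + \<i> * of_real u))) * P * g) = E * (Re (cis \<phi> * g) + Re (cis \<phi> * g * (P - 1)))"
      by (simp only: plus_complex.sel)
    thus ?thesis by (simp add: v_def algebra_simps)
  qed
  moreover have "\<bar>E * (Re (cis \<phi> * g) - 1)\<bar> \<le> E * ((v ^ 3 / 2 + C * v^2 + C * v) / M)"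
    unfolding abs_mult using R1 E_pos by (intro mult_mono) auto
  ultimately have "\<bar>Re (exp (- (of_real (M * u^2) / (1 + \<i> * of_real u))) * P * g) - exp (- (M * u^2))\<bar>
      \<le> E * ((v ^ 3 / 2 + C * v^2 + C * v) / M) + E * (v^2 / M) + (1 + 2 * C) * K / M * exp (- (v / 36))"
    using Ev T3 by linarith
  also have "E * ((v ^ 3 / 2 + C * v^2 + C * v) / M) + E * (v^2 / M) = E * ((v ^ 3 / 2 + (C + 1) * v^2 + C * v) / M)"
    by (simp add: add_divide_distrib algebra_simps)
  also have "... + (1 + 2 * C) * K / M * exp (- (v / 36)) \<le> (224 + 36 * C) / M * exp (- (v / 36)) + (1 + 2 * C) * K / M * exp (- (v / 36))"
    using T12 by simp
  also have "... = (224 + 36 * C + (1 + 2 * C) * K) / M * exp (- (M * u^2 / 36))"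
    by (simp add: v_def add_divide_distrib algebra_simps)
  finally show ?thesis .
qed

lemma has_integral_gaussian:
  assumes a: "a > (0::real)"
  shows "((\<lambda>u. exp (- (a * u^2))) has_integral sqrt (pi / a)) UNIV"
proof -
  define s where "s = sqrt (1 / (2 * a))"
  have s: "s > 0" "s^2 = 1 / (2 * a)" using a by (simp_all add: s_def)
  have "(normal_density 0 s has_integral (\<integral>x. normal_density 0 s x \<partial>lborel)) UNIV"
    by (rule has_integral_integral_lborel) (use s in simp)
  hence "((\<lambda>u. sqrt (pi / a) * normal_density 0 s u) has_integral sqrt (pi / a) * 1) UNIV"
    using s by (intro has_integral_mult_right) simp
  moreover have "sqrt (pi / a) * normal_density 0 s u = exp (- (a * u^2))" for u
    using a by (simp add: normal_density_def s power_divide field_simps real_sqrt_divide)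
  ultimately show ?thesis by simp
qed

text \<open>
  Outside [-1, 1] the integrand is taken to be 0; there the Gaussian itself is at most (2 / M) times a wider Gaussian.
\<close>
lemma gaussian_comparison:
  fixes k :: "real \<Rightarrow> complex"
  assumes M: "M > 0" and K: "K \<ge> 2"
    and k: "(k has_integral J) {-1..1}"
    and bound: "\<And>u. \<bar>u\<bar> \<le> 1 \<Longrightarrow> \<bar>Re (k u) - exp (- (M * u^2))\<bar> \<le> K / M * exp (- (M * u^2 / 36))"
  shows "\<bar>Re J - sqrt (pi / M)\<bar> \<le> K / M * sqrt (36 * pi / M)"
proof -
  define h where "h u = (if u \<in> {-1..1} then Re (k u) else 0)" for u
  have "((\<lambda>u. Re (k u)) has_integral Re J) {-1..1}" by (rule has_integral_Re[OF k])
  hence "(h has_integral Re J) UNIV" unfolding h_def by (simp only: has_integral_restrict_UNIV)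
  hence d: "((\<lambda>u. h u - exp (- (M * u^2))) has_integral (Re J - sqrt (pi / M))) UNIV"
    by (intro has_integral_diff has_integral_gaussian M)
  have "((\<lambda>u. K / M * exp (- (M / 36 * u^2))) has_integral K / M * sqrt (pi / (M / 36))) UNIV"
    using M by (intro has_integral_mult_right has_integral_gaussian) simp
  hence e: "((\<lambda>u. K / M * exp (- (M * u^2 / 36))) has_integral K / M * sqrt (36 * pi / M)) UNIV"
    by (simp add: mult.commute)
  have le: "\<bar>h u - exp (- (M * u^2))\<bar> \<le> K / M * exp (- (M * u^2 / 36))" for u
  proof (cases "\<bar>u\<bar> \<le> 1")
    case True
    thus ?thesis using bound[OF True] by (auto simp: h_def)
  next
    case False
    hence "u \<notin> {-1..1}" by auto
    hence "h u = 0" unfolding h_def by (rule if_not_P)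
    hence "\<bar>h u - exp (- (M * u^2))\<bar> = exp (- (M * u^2))" by simp
    also have "... = exp (- (M * u^2 / 2)) * exp (- (M * u^2 / 2))" by (simp add: exp_add[symmetric])
    also have "... \<le> K / M * exp (- (M * u^2 / 36))"
    proof (intro mult_mono)
      have "1 \<le> u^2" using False abs_square_le_1[of u] by linarith
      hence "M / 2 * 1 \<le> M / 2 * u^2" using M by (intro mult_left_mono) auto
      moreover have "M / 2 < exp (M / 2)" using exp_ge_add_one_self[of "M / 2"] by linarith
      ultimately have "exp (- (M * u^2 / 2)) \<le> exp (- (M / 2))" by simp
      also have "... \<le> 1 / (M / 2)"
        unfolding exp_minus inverse_eq_divide using M \<open>M / 2 < exp (M / 2)\<close> by (intro divide_left_mono) auto
      also have "... \<le> K / M" using M K by (simp add: divide_right_mono)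
      finally show "exp (- (M * u^2 / 2)) \<le> K / M" .
      show "exp (- (M * u^2 / 2)) \<le> exp (- (M * u^2 / 36))" using M by simp
    qed (use M K in auto)
    finally show ?thesis .
  qed
  have "Re J - sqrt (pi / M) \<le> K / M * sqrt (36 * pi / M)"
    by (rule has_integral_le[OF d e]) (use le in \<open>simp add: abs_le_iff\<close>)
  moreover have "- (K / M * sqrt (36 * pi / M)) \<le> Re J - sqrt (pi / M)"
  proof (rule has_integral_le[OF has_integral_neg[OF e] d])
    fix u :: real
    show "- (K / M * exp (- (M * u^2 / 36))) \<le> h u - exp (- (M * u^2))" using le[of u] by linarith
  qed
  ultimately show ?thesis by linarith
qed

lemma csqrt_divide_of_real:
  assumes "t > 0"
  shows "csqrt (w / of_real t) = csqrt w / of_real (sqrt t)"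
proof (rule csqrt_unique)
  show "(csqrt w / of_real (sqrt t))^2 = w / of_real t"
    using assms by (simp add: power_divide flip: of_real_power)
  show "0 < Re (csqrt w / of_real (sqrt t)) \<or> Re (csqrt w / of_real (sqrt t)) = 0 \<and> 0 \<le> Im (csqrt w / of_real (sqrt t))"
    using csqrt_principal[of w] assms by (auto simp: Re_divide_of_real Im_divide_of_real)
qed

text \<open>
  The two inversion formulas have the same square root factor up to sqrt t, so no branch of sqrt z is left.
\<close>
lemma theta4_quotient_inversion:
  assumes z: "Re z > 0" and t: "t > (0::real)"
    and nz: "theta_psi (exp (- (of_real (pi^2) / z))) \<noteq> 0"
  shows "theta4 (exp (- (of_real t * z))) / theta4 (exp (- z))
       = of_real (1 / sqrt t) * exp (of_real (pi^2 / 4 * (1 - 1 / t)) / z)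
         * (theta_psi (exp (- (of_real (pi^2) / (of_real t * z)))) / theta_psi (exp (- (of_real (pi^2) / z))))"
proof -
  have z0: "z \<noteq> 0" using z by auto
  define s where "s = csqrt (of_real pi / z)"
  have s: "s \<noteq> 0" using z0 by (simp add: s_def)
  have st: "csqrt (of_real pi / (of_real t * z)) = s / of_real (sqrt t)"
    using csqrt_divide_of_real[OF t, of "of_real pi / z"] by (simp add: s_def field_simps)
  have zt: "Re (of_real t * z) > 0" using z t by simp
  have "exp (- (of_real (pi^2 / 4) / (of_real t * z))) / exp (- (of_real (pi^2 / 4) / z))
      = exp (of_real (pi^2 / 4 * (1 - 1 / t)) / z)"
    unfolding exp_diff[symmetric] using z0 t by (intro arg_cong[of _ _ exp]) (simp add: field_simps)
  hence e: "exp (- (of_real (pi^2 / 4) / (of_real t * z))) = exp (of_real (pi^2 / 4 * (1 - 1 / t)) / z) * exp (- (of_real (pi^2 / 4) / z))"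
    by (simp add: divide_eq_eq)
  show ?thesis
    unfolding theta4_inversion[OF z] theta4_inversion[OF zt] st s_def[symmetric] e
    using s nz t by (simp add: divide_simps)
qed

section \<open>The generating function on the major arc\<close>

lemma theta4_small:
  fixes q :: "'a::{real_normed_field,banach}"
  assumes q: "norm q \<le> 1 / 6"
  shows "1 / 2 \<le> norm (theta4 q)" "norm (theta4 q) \<le> 2"
proof -
  have "norm (theta4 q - 1) \<le> 2 * norm q / (1 - norm q)" by (rule theta4_near_one) (use q in auto)
  also have "... \<le> 1 / 2" using q by (subst pos_divide_le_eq) auto
  finally have *: "norm (theta4 q - 1) \<le> 1 / 2" .
  show "1 / 2 \<le> norm (theta4 q)" using * norm_triangle_ineq2[of 1 "1 - theta4 q"] by (simp add: norm_minus_commute)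
  show "norm (theta4 q) \<le> 2" using * norm_triangle_ineq[of "theta4 q - 1" 1] by simp
qed

lemma exp_minus_le_sixth:
  assumes "\<sigma> \<ge> (5::real)"
  shows "exp (- \<sigma>) \<le> 1 / 6"
proof -
  have "6 \<le> exp \<sigma>" using exp_ge_add_one_self[of \<sigma>] assms by linarith
  thus ?thesis by (simp add: exp_minus field_simps)
qed

text \<open>
  The quotient \<theta>_4(exp(-a(1 + iu))) / \<theta>_4(exp(-b(1 + iu))), divided by its value at u = 0.
\<close>
definition theta4_ratio :: "real \<Rightarrow> real \<Rightarrow> real \<Rightarrow> complex" where
  "theta4_ratio a b u = (theta4 (exp (- (of_real a * (1 + \<i> * of_real u)))) / of_real (theta4 (exp (- a))))
     / (theta4 (exp (- (of_real b * (1 + \<i> * of_real u)))) / of_real (theta4 (exp (- b))))"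

text \<open>
  The constant is C + D + 4 C D for C = 32 and D = 32 + 16 * 32^2, by the rules for products and inverses.
\<close>
lemma theta4_ratio_near_one:
  assumes a: "a \<ge> 5" and b: "b \<ge> 5" and u: "\<bar>u\<bar> \<le> 1"
  shows "near_one 2117696 u (theta4_ratio a b u)"
proof -
  define A where "A c = theta4 (exp (- (of_real c * (1 + \<i> * of_real u)))) / of_real (theta4 (exp (- c)))" for c :: real
  have nb: "norm (A b) \<ge> 1 / 4"
  proof -
    have "norm (exp (- (of_real b * (1 + \<i> * of_real u)))) \<le> 1 / 6"
      using exp_minus_le_sixth[OF b] by simp
    hence "norm (theta4 (exp (- (of_real b * (1 + \<i> * of_real u))))) \<ge> 1 / 2" by (rule theta4_small)
    moreover have "norm (theta4 (exp (- b))) \<le> 2" by (rule theta4_small) (use exp_minus_le_sixth[OF b] in simp)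
    moreover have "theta4 (exp (- b)) > 0" using b by (intro theta4_real_pos) auto
    ultimately have "(1 / 2) / 2 \<le> norm (A b)" unfolding A_def norm_divide by (intro frac_le) auto
    thus ?thesis by simp
  qed
  have "near_one (32 + 16 * 32^2) u (1 / A b)"
    by (rule near_one_inverse[OF _ u _ nb]) (use theta4_vertical_expansion[OF b] in \<open>auto simp: A_def\<close>)
  moreover have "near_one 32 u (A a)" using theta4_vertical_expansion[OF a] by (simp add: A_def)
  ultimately have "near_one (32 + (32 + 16 * 32^2) + 4 * (32 * (32 + 16 * 32^2))) u (A a * (1 / A b))"
    by (intro near_one_mult u) auto
  thus ?thesis by (simp add: theta4_ratio_def A_def)
qed

lemma norm_exp_minus_div_vertical:
  assumes x: "x > 0"
  shows "norm (exp (- (of_real c / (of_real x * (1 + \<i> * of_real u))))) = exp (- (c / (x * (1 + u^2))))"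
proof -
  have "Re (of_real c / (of_real x * (1 + \<i> * of_real u))) = c * x / (x^2 * (1 + u^2))"
    by (simp add: Re_divide power2_eq_square algebra_simps)
  also have "... = c / (x * (1 + u^2))" using x by (simp add: power2_eq_square)
  finally show ?thesis by simp
qed

text \<open>
  With b = 2 \<pi>^2 / (t x), the numerator differs from 1 by a multiple of
  exp(-b / (1 + u^2)) = exp(-b) exp(b u^2 / (1 + u^2)). Here exp(-b) is at most n^(-1/2), and b is at
  most 8 M / 9 as soon as 9 \<le> t - 1, so the growth in u is slower than the decay of the Gaussian.
\<close>
lemma theta_psi_quotient_near_one:
  fixes x t M n :: real
  assumes x: "0 < x" "x \<le> 1" and t: "t \<ge> 10" and u: "\<bar>u\<bar> \<le> 1"
    and M: "M * x = pi^2 / 4 * (1 - 1 / t)" and n: "n \<ge> 256" "M \<le> 2 * sqrt n"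
    and B: "ln n / 2 \<le> 2 * pi^2 / (t * x)"
  defines "z \<equiv> of_real x * (1 + \<i> * of_real u)"
  shows "theta_psi (exp (- (of_real (pi^2) / z))) \<noteq> 0"
    and "norm (theta_psi (exp (- (of_real (pi^2) / (of_real t * z)))) / theta_psi (exp (- (of_real (pi^2) / z))) - 1)
         \<le> 12 / M * exp (8 / 9 * (M * u^2 / (1 + u^2)))"
proof -
  define w where "w = exp (- (of_real (pi^2) / z))"
  define w' where "w' = exp (- (of_real (pi^2) / (of_real t * z)))"
  define b where "b = 2 * pi^2 / (t * x)"
  have u2: "0 \<le> u^2" "u^2 \<le> 1" using u by (auto simp: abs_square_le_1)
  have u2': "1 + u^2 > 0" using u2 by linarith
  have pi2: "pi^2 \<ge> 9" using power_mono[of 3 pi 2] pi_gt3 by simp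
  have Mpos: "M > 0"
  proof -
    have "M * x > 0" unfolding M using t by (intro mult_pos_pos) (auto simp: field_simps)
    thus ?thesis using x by (simp add: zero_less_mult_iff)
  qed
  have MA: "M = pi^2 / 4 * (1 - 1 / t) / x" using M x by (simp add: eq_divide_eq)
  have nw: "norm w = exp (- (pi^2 / (x * (1 + u^2))))"
    unfolding w_def z_def by (rule norm_exp_minus_div_vertical[OF x(1)])
  have nw': "norm w' = exp (- (pi^2 / (t * x * (1 + u^2))))"
  proof -
    have tz: "of_real t * z = of_real (t * x) * (1 + \<i> * of_real u)" by (simp add: z_def)
    show ?thesis unfolding w'_def tz by (rule norm_exp_minus_div_vertical) (use x t in simp)
  qed
  have wx: "pi^2 / (x * (1 + u^2)) \<ge> pi^2 / (2 * x)"
  proof (rule divide_left_mono)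
    have "x * (1 + u^2) \<le> x * 2" using x u2 by (intro mult_left_mono) auto
    thus "x * (1 + u^2) \<le> 2 * x" by simp
    show "0 < 2 * x * (x * (1 + u^2))" using x u2' by (intro mult_pos_pos) auto
  qed auto
  have w_half: "norm w \<le> 1 / 2"
  proof -
    have "1 \<le> pi^2 / (2 * x)" using x pi2 by (simp add: le_divide_eq)
    hence "norm w \<le> exp (- 1)" using wx by (simp add: nw)
    also have "... \<le> 1 / 2" using exp_ge_add_one_self[of 1] by (simp add: exp_minus field_simps)
    finally show ?thesis .
  qed
  have w_sq: "norm w ^ 2 \<le> 1 / M"
  proof -
    have "norm w ^ 2 = exp (- (2 * (pi^2 / (x * (1 + u^2)))))"
      unfolding nw by (simp add: exp_of_nat_mult[symmetric])
    also have "... \<le> exp (- M)"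
    proof -
      have "pi^2 / 4 * (1 - 1 / t) \<le> pi^2 * 1" using t by (intro mult_mono) auto
      hence "M \<le> pi^2 / x" unfolding MA using x by (intro divide_right_mono) auto
      also have "... = 2 * (pi^2 / (2 * x))" by simp
      also have "... \<le> 2 * (pi^2 / (x * (1 + u^2)))" using wx by simp
      finally show ?thesis by simp
    qed
    also have "... \<le> 1 / M"
    proof -
      have "M \<le> exp M" using exp_ge_add_one_self[of M] by linarith
      thus ?thesis unfolding exp_minus inverse_eq_divide using Mpos by (intro divide_left_mono) auto
    qed
    finally show ?thesis .
  qed
  have w'_sq_eq: "norm w' ^ 2 = exp (- (b / (1 + u^2)))"
    unfolding nw' b_def by (simp add: exp_of_nat_mult[symmetric])
  \<comment> \<open>The bound 256 on n is used here: a quarter of its logarithm is ln 4.\<close>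
  have ln4: "ln 4 \<le> b / 2"
  proof -
    have "ln (256::real) = 4 * ln 4" using ln_realpow[of 4 4] by simp
    moreover have "ln 256 \<le> ln n" using n by simp
    moreover have "ln n / 2 \<le> b" using B by (simp only: b_def)
    ultimately show ?thesis by linarith
  qed
  have w'_half: "norm w' \<le> 1 / 2"
  proof -
    have "b / 2 \<le> b / (1 + u^2)"
      using u2 u2' x t by (intro divide_left_mono mult_pos_pos) (auto simp: b_def)
    from order_trans[OF ln4 this] have "norm w' ^ 2 \<le> exp (- ln 4)"
      unfolding w'_sq_eq by (simp only: exp_le_cancel_iff neg_le_iff_le)
    also have "... = (1 / 2)^2" by (simp add: exp_minus power2_eq_square)
    finally show ?thesis by (rule power2_le_imp_le) simp
  qed
  have w'_sq: "norm w' ^ 2 \<le> 2 / M * exp (8 / 9 * (M * u^2 / (1 + u^2)))"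
  proof -
    have "b / (1 + u^2) = b - b * u^2 / (1 + u^2)" using u2' by (simp add: field_simps)
    hence "norm w' ^ 2 = exp (- b) * exp (b * u^2 / (1 + u^2))"
      unfolding w'_sq_eq by (simp add: exp_add[symmetric])
    also have "... \<le> 2 / M * exp (8 / 9 * (M * u^2 / (1 + u^2)))"
    proof (intro mult_mono)
      have "sqrt n > 0" using n by simp
      have "exp (- b) \<le> exp (- (ln n / 2))" using B by (simp add: b_def)
      also have "... = 1 / sqrt n"
      proof -
        have "exp (ln n / 2) = exp (ln (sqrt n))" using n by (simp add: ln_sqrt)
        also have "... = sqrt n" using \<open>sqrt n > 0\<close> by (rule exp_ln)
        finally have "exp (ln n / 2) = sqrt n" .
        thus ?thesis by (simp add: exp_minus inverse_eq_divide)
      qed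
      also have "... = 2 / (2 * sqrt n)" by simp
      also have "... \<le> 2 / M" by (rule divide_left_mono[OF n(2)]) (use Mpos \<open>sqrt n > 0\<close> in auto)
      finally show "exp (- b) \<le> 2 / M" .
      have "b \<le> 8 / 9 * M"
      proof -
        have "2 / t \<le> 8 / 9 * (1 / 4 * (1 - 1 / t))" using t by (simp add: field_simps)
        hence "pi^2 * (2 / t) \<le> pi^2 * (8 / 9 * (1 / 4 * (1 - 1 / t)))" by (intro mult_left_mono) auto
        hence "pi^2 * (2 / t) / x \<le> pi^2 * (8 / 9 * (1 / 4 * (1 - 1 / t))) / x" using x by (intro divide_right_mono) auto
        moreover have "8 / 9 * (A / 4 * r / x) = A * (8 / 9 * (1 / 4 * r)) / x" for A r by simp
        moreover have "b = pi^2 * (2 / t) / x" by (simp add: b_def)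
        ultimately show ?thesis unfolding MA by (simp only:)
      qed
      hence "b * (u^2 / (1 + u^2)) \<le> 8 / 9 * M * (u^2 / (1 + u^2))" using u2 u2' by (intro mult_right_mono) auto
      thus "exp (b * u^2 / (1 + u^2)) \<le> exp (8 / 9 * (M * u^2 / (1 + u^2)))" by simp
    qed (use Mpos in auto)
    finally show ?thesis .
  qed
  have n1: "norm (theta_psi w - 1) \<le> 2 * norm w ^ 2" by (rule theta_psi_near_one[OF w_half])
  have n2: "norm (theta_psi w' - 1) \<le> 2 * norm w' ^ 2" by (rule theta_psi_near_one[OF w'_half])
  have low: "norm (theta_psi w) \<ge> 1 / 2"
  proof -
    have "norm w ^ 2 \<le> (1 / 2) ^ 2" by (rule power_mono[OF w_half]) simp
    thus ?thesis using n1 norm_triangle_ineq2[of 1 "1 - theta_psi w"] by (simp add: norm_minus_commute power2_eq_square)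
  qed
  show nz: "theta_psi (exp (- (of_real (pi^2) / z))) \<noteq> 0" using low by (auto simp: w_def)
  have e1: "1 \<le> exp (8 / 9 * (M * u^2 / (1 + u^2)))" using Mpos u2 by simp
  have "theta_psi w' / theta_psi w - 1 = ((theta_psi w' - 1) - (theta_psi w - 1)) / theta_psi w"
  proof -
    have "theta_psi w \<noteq> 0" using low by auto
    thus ?thesis by (simp add: field_simps)
  qed
  also have "norm ... \<le> (2 * norm w' ^ 2 + 2 * norm w ^ 2) / (1 / 2)"
    unfolding norm_divide using n1 n2 low norm_triangle_ineq4[of "theta_psi w' - 1" "theta_psi w - 1"]
    by (intro frac_le) auto
  also have "... = 4 * norm w' ^ 2 + 4 * norm w ^ 2" by simp
  also have "... \<le> 4 * (2 / M * exp (8 / 9 * (M * u^2 / (1 + u^2)))) + 4 * (1 / M * exp (8 / 9 * (M * u^2 / (1 + u^2))))"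
  proof -
    have "1 / M * 1 \<le> 1 / M * exp (8 / 9 * (M * u^2 / (1 + u^2)))" using e1 Mpos by (intro mult_left_mono) auto
    thus ?thesis using w_sq w'_sq by linarith
  qed
  also have "... = 12 / M * exp (8 / 9 * (M * u^2 / (1 + u^2)))" by (simp add: field_simps)
  finally show "norm (theta_psi (exp (- (of_real (pi^2) / (of_real t * z)))) / theta_psi (exp (- (of_real (pi^2) / z))) - 1)
         \<le> 12 / M * exp (8 / 9 * (M * u^2 / (1 + u^2)))" by (simp add: w_def w'_def)
qed

text \<open>
  The closed form of the generating function found in \<open>pbar_sums\<close>.
\<close>
definition pbar_gf :: "nat \<Rightarrow> nat \<Rightarrow> complex \<Rightarrow> complex" where
  "pbar_gf s t q = theta4 (q ^ s) * theta4 (q ^ t) / (theta4 q * theta4 (q ^ (s * t)))"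

text \<open>
  As M x = A and M = N x, at z = x (1 + iu) the exponent A / z + N z is M / (1 + iu) + M (1 + iu) = 2 M - M u^2 / (1 + iu).
\<close>
lemma pbar_gf_saddle_form:
  fixes x M :: real and s t N :: nat
  assumes x: "0 < x" and t: "t > 0" and s: "s > 0" 
    and M: "M = real N * x" "M * x = pi^2 / 4 * (1 - 1 / real t)"
    and nz: "theta_psi (exp (- (of_real (pi^2) / (of_real x * (1 + \<i> * of_real u))))) \<noteq> 0"
  defines "z \<equiv> of_real x * (1 + \<i> * of_real u)"
  shows "pbar_gf s t (exp (- z)) * exp (of_nat N * z)
    = of_real (exp (2 * M) / sqrt (real t) * (theta4 (exp (- (real s * x))) / theta4 (exp (- (real s * real t * x)))))
      * (exp (- (of_real (M * u^2) / (1 + \<i> * of_real u)))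
         * (theta_psi (exp (- (of_real (pi^2) / (of_real (real t) * z)))) / theta_psi (exp (- (of_real (pi^2) / z))))
         * theta4_ratio (real s * x) (real s * real t * x) u)"
proof -
  have pw: "exp (- z) ^ k = exp (- (of_real (real k) * z))" for k
    by (simp add: exp_of_nat_mult[symmetric])
  have zre: "Re z > 0" using x by (simp add: z_def)
  have u1: "1 + \<i> * of_real u \<noteq> 0" by (auto simp: complex_eq_iff)
  have nz': "theta_psi (exp (- (of_real (pi^2) / z))) \<noteq> 0" using nz by (simp add: z_def)
  have p0: "theta4 (exp (- (real s * x))) > 0" "theta4 (exp (- (real s * real t * x))) > 0"
    using x s t by (auto intro!: theta4_real_pos)
  define P where "P = theta_psi (exp (- (of_real (pi^2) / (of_real (real t) * z)))) / theta_psi (exp (- (of_real (pi^2) / z)))"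
  define a where "a = real s * x"
  define b where "b = real s * real t * x"
  have q: "theta4 (exp (- (of_real (real t) * z))) / theta4 (exp (- z))
       = of_real (1 / sqrt (real t)) * exp (of_real (pi^2 / 4 * (1 - 1 / real t)) / z) * P"
    unfolding P_def by (rule theta4_quotient_inversion[OF zre _ nz']) (use t in simp)
  have ez: "exp (of_real (pi^2 / 4 * (1 - 1 / real t)) / z) * exp (of_nat N * z)
      = of_real (exp (2 * M)) * exp (- (of_real (M * u^2) / (1 + \<i> * of_real u)))"
  proof -
    have "of_real (pi^2 / 4 * (1 - 1 / real t)) / z = of_real M / (1 + \<i> * of_real u)"
    proof -
      have "of_real (M * x) / (of_real x * v) = of_real M / v" for v :: complex
        using x by simp
      thus ?thesis unfolding M(2)[symmetric] z_def .
    qed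
    moreover have "of_nat N * z = of_real M * (1 + \<i> * of_real u)" by (simp add: M(1) z_def)
    moreover have "c / v + c * v = 2 * c - (c * w) / v" if "v \<noteq> 0" "- w = (v - 1)^2" for c v w :: complex
    proof -
      have w: "w = - ((v - 1)^2)" using that(2) by (metis minus_minus)
      show ?thesis unfolding w using that(1) by (simp add: field_simps power2_eq_square)
    qed
    from this[OF u1, of "of_real (u^2)" "of_real M"]
    have "of_real M / (1 + \<i> * of_real u) + of_real M * (1 + \<i> * of_real u) = 2 * of_real M - (of_real M * of_real (u^2)) / (1 + \<i> * of_real u)"
      by (simp add: power_mult_distrib)
    ultimately have "of_real (pi^2 / 4 * (1 - 1 / real t)) / z + of_nat N * z = of_real (2 * M) + (- (of_real (M * u^2) / (1 + \<i> * of_real u)))"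
      by simp
    thus ?thesis unfolding exp_add[symmetric] exp_of_real[symmetric] by (simp only:)
  qed
  have ab: "of_real (real s) * z = of_real a * (1 + \<i> * of_real u)" "of_real (real (s * t)) * z = of_real b * (1 + \<i> * of_real u)"
    by (simp_all add: z_def a_def b_def)
  have r: "theta4 (exp (- (of_real (real s) * z))) / theta4 (exp (- (of_real (real (s * t)) * z)))
      = of_real (theta4 (exp (- a)) / theta4 (exp (- b))) * theta4_ratio a b u"
    unfolding ab theta4_ratio_def using p0 by (simp add: a_def b_def)
  have "pbar_gf s t (exp (- z)) = (theta4 (exp (- (of_real (real t) * z))) / theta4 (exp (- z)))
      * (theta4 (exp (- (of_real (real s) * z))) / theta4 (exp (- (of_real (real (s * t)) * z))))"
    unfolding pbar_gf_def pw by simp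
  hence "pbar_gf s t (exp (- z)) * exp (of_nat N * z) = of_real (1 / sqrt (real t))
     * (exp (of_real (pi^2 / 4 * (1 - 1 / real t)) / z) * exp (of_nat N * z)) * P
     * (of_real (theta4 (exp (- a)) / theta4 (exp (- b))) * theta4_ratio a b u)"
    unfolding q r by (simp only: mult_ac)
  thus ?thesis unfolding ez P_def[symmetric] a_def[symmetric] b_def[symmetric]
    by simp
qed

section \<open>The saddle point estimate\<close>

lemma pbar_coefficient_integral:
  assumes st: "coprime s t" "s > 0" "t > 0" and x: "x > 0"
  shows "((\<lambda>y. pbar_gf s t (exp (- Complex x y)) * exp (of_nat N * Complex x y)) has_integral
           of_real (2 * pi * real (pbar s t N))) {-pi..pi}"
proof -
  have 1: "summable (\<lambda>n. \<bar>real (pbar s t n)\<bar> * exp (- x) ^ n)"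
    using pbar_sums(1)[of "exp (- x)" s t] st x by simp
  have 2: "(\<lambda>n. of_real (real (pbar s t n)) * exp (- Complex x y) ^ n) sums pbar_gf s t (exp (- Complex x y))" for y
    using pbar_sums(2)[of "exp (- Complex x y)" s t] st x by (simp add: pbar_gf_def)
  show ?thesis using coefficient_integral[OF 1 2] by simp
qed

text \<open>
  Since \<pi>^2 / (4x) + M = 2 M + \<pi>^2 / (4 t x) and \<pi>^2 / (4 t x) \<le> 16 / (40 x), the gain 0.48 / x leaves
  exp(2 M - 0.08 / x). The factor exp(-0.08 / x) beats any power of x; the fourth power, one of which
  pays for the bound 4 / x of \<theta>_4(q^t), leaves x^3.
\<close>
lemma pbar_gf_minor_arc:
  fixes x M :: real and s t N :: nat
  assumes x: "0 < x" "x \<le> 1" and t: "t \<ge> 10" and s: "real s * x \<ge> 5"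
    and M: "M = real N * x" "M * x = pi^2 / 4 * (1 - 1 / real t)"
    and y: "x \<le> \<bar>y\<bar>" "\<bar>y\<bar> \<le> pi"
  shows "norm (pbar_gf s t (exp (- Complex x y)) * exp (of_nat N * Complex x y))
         \<le> 16 * 9 * (24 * 12.5 ^ 4) * (x ^ 3 * exp (2 * M))"
proof -
  define q where "q = exp (- Complex x y)"
  have nq: "norm (q ^ k) = exp (- (real k * x))" for k
    by (simp add: q_def norm_power exp_of_nat_mult[symmetric])
  have a1: "norm (1 / theta4 q) \<le> exp (pi^2 / (4 * x) + 2 - 0.48 / x)"
    unfolding q_def by (rule inverse_theta4_minor_arc[OF x y])
  have a2: "norm (theta4 (q ^ t)) \<le> 4 / x"
  proof -
    have tx: "x \<le> real t * x" using t x by simp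
    have "exp (- (real t * x)) \<le> exp (- x)" using tx by simp
    also have "exp (- x) \<le> 1 / (1 + x)"
      unfolding exp_minus inverse_eq_divide using x exp_ge_add_one_self[of x] by (intro divide_left_mono) auto
    also have "... \<le> 1 - x / 2" using x by (simp add: field_simps)
    finally have e: "exp (- (real t * x)) \<le> 1 - x / 2" .
    have "norm (theta4 (q ^ t)) \<le> 2 / (1 - norm (q ^ t))" using tx x by (intro norm_theta4_le) (simp add: nq)
    also have "... \<le> 2 / (x / 2)" unfolding nq by (rule frac_le) (use e x in auto)
    finally show ?thesis by simp
  qed
  have a3: "norm (theta4 (q ^ s)) \<le> 2"
    using exp_minus_le_sixth[OF s] by (intro theta4_small) (simp add: nq)
  have a4: "norm (1 / theta4 (q ^ (s * t))) \<le> 2"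
  proof -
    have "real s * x * 1 \<le> real s * x * real t" using t x by (intro mult_left_mono) auto
    hence "real (s * t) * x \<ge> 5" using s by (simp add: mult_ac)
    hence "1 / 2 \<le> norm (theta4 (q ^ (s * t)))"
      using exp_minus_le_sixth by (intro theta4_small) (simp only: nq)
    hence "1 / norm (theta4 (q ^ (s * t))) \<le> 1 / (1 / 2)" by (intro frac_le) auto
    thus ?thesis by (simp add: norm_divide)
  qed
  have eN: "norm (exp (of_nat N * Complex x y)) = exp M" by (simp add: M(1))
  have ineq: "pi^2 / (4 * x) + 2 - 0.48 / x + M \<le> 2 * M + 2 + - (1 / x / 12.5)"
  proof -
    have f1: "M + pi^2 / (4 * x) = 2 * M + pi^2 / (4 * real t * x)"
    proof -
      have "M = pi^2 / 4 * (1 - 1 / real t) / x" using M(2) x by (simp add: eq_divide_eq)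
      also have "... = pi^2 / (4 * x) - pi^2 / (4 * real t * x)" using t x by (simp add: field_simps)
      finally show ?thesis by linarith
    qed
    have f2: "pi^2 / (4 * real t * x) \<le> 16 / (40 * x)"
    proof (rule frac_le)
      show "pi^2 \<le> 16" using power_mono[of pi 4 2] pi_less_4 by simp
      show "40 * x \<le> 4 * real t * x" using t x by (intro mult_right_mono) auto
    qed (use x in auto)
    define v where "v = 1 / x"
    have e1: "16 / (40 * x) = 2 / 5 * v" and e2: "0.48 / x = 12 / 25 * v" and e3: "1 / x / 12.5 = 2 / 25 * v"
      by (simp_all add: v_def)
    show ?thesis using f1 f2 unfolding e1 e2 e3 by linarith
  qed
  have "norm (pbar_gf s t q * exp (of_nat N * Complex x y))
      = norm (1 / theta4 q) * norm (theta4 (q ^ t)) * (norm (theta4 (q ^ s)) * norm (1 / theta4 (q ^ (s * t)))) * exp M"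
    unfolding pbar_gf_def norm_mult eN by (simp add: norm_mult norm_divide)
  also have "... \<le> exp (pi^2 / (4 * x) + 2 - 0.48 / x) * (4 / x) * (2 * 2) * exp M"
    using a1 a2 a3 a4 x by (intro mult_right_mono mult_mono) auto
  also have "... = 16 / x * exp (pi^2 / (4 * x) + 2 - 0.48 / x + M)"
    by (simp only: exp_add) simp
  also have "... \<le> 16 / x * exp (2 * M + 2 + - (1 / x / 12.5))"
  proof (intro mult_left_mono)
    from ineq show "exp (pi^2 / (4 * x) + 2 - 0.48 / x + M) \<le> exp (2 * M + 2 + - (1 / x / 12.5))"
      by (simp only: exp_le_cancel_iff)
  qed (use x in auto)
  also have "... = 16 * exp 2 * (exp (2 * M) * (x ^ 3 * ((1 / x) ^ 4 * exp (- (1 / x / 12.5)))))"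
  proof -
    have "x ^ 3 * (1 / x) ^ 4 = 1 / x" using x by (simp add: power_divide eval_nat_numeral)
    hence "16 / x * (exp (2 * M) * exp 2 * e) = 16 * exp 2 * (exp (2 * M) * (x ^ 3 * ((1 / x) ^ 4 * e)))" for e
      by (simp add: mult.assoc[symmetric])
    thus ?thesis unfolding exp_add .
  qed
  also have "... \<le> 16 * 9 * (exp (2 * M) * (x ^ 3 * (24 * 12.5 ^ 4)))"
  proof (rule mult_mono)
    have "exp (1::real) * exp 1 \<le> 3 * 3" using exp_le by (intro mult_mono) auto
    thus "16 * exp (2::real) \<le> 16 * 9" by (simp flip: exp_add)
    have "(1 / x) ^ 4 * exp (- (1 / x / 12.5)) \<le> 24 * 12.5 ^ 4"
      using power_times_exp_le[of "1 / x" "12.5" 4] x by (simp add: fact_numeral)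
    thus "exp (2 * M) * (x ^ 3 * ((1 / x) ^ 4 * exp (- (1 / x / 12.5)))) \<le> exp (2 * M) * (x ^ 3 * (24 * 12.5 ^ 4))"
      using x by (intro mult_left_mono) auto
  qed (use x in auto)
  finally show ?thesis by (simp add: q_def mult_ac)
qed

text \<open>
  On |y| \<le> x the substitution y = x u leads to the Gaussian integral. The remaining part, of size
  x^3 exp(2 M), is smaller than the error term because t x and M x are bounded.
\<close>
lemma pbar_saddle_point:
  fixes x M :: real and s t N :: nat
  assumes st: "coprime s t" and t: "t \<ge> 10" and x: "0 < x" "x \<le> 1" and s: "real s * x \<ge> 5"
    and M: "M = real N * x" "M * x = pi^2 / 4 * (1 - 1 / real t)"
    and N: "N \<ge> 256" and B: "ln (real N) / 2 \<le> 2 * pi^2 / (real t * x)"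
  defines "T \<equiv> exp (2 * M) / sqrt (real t) * (theta4 (exp (- (real s * x))) / theta4 (exp (- (real s * real t * x))))"
  shows "\<bar>2 * pi * real (pbar s t N) - x * T * sqrt (pi / M)\<bar> \<le> 3 * 10 ^ 11 * (x * T / (M * sqrt M))"
proof -
  define h where "h y = pbar_gf s t (exp (- Complex x y)) * exp (of_nat N * Complex x y)" for y
  have s0: "s > 0" using s by (cases s) auto
  have pi2: "pi^2 \<le> 16" using power_mono[of pi 4 2] pi_less_4 by simp
  have sN: "sqrt (real N) > 0" using N by simp
  have Mpos: "M > 0" using N x by (simp add: M(1))
  have Mx: "M * x \<le> 4"
  proof -
    have "M * x \<le> pi^2 / 4 * 1" unfolding M(2) using t by (intro mult_left_mono) auto
    thus ?thesis using pi2 by simp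
  qed
  have MN: "M \<le> 2 * sqrt (real N)"
  proof (rule power2_le_imp_le)
    have "M^2 = real N * (M * x)" by (simp add: M(1) power2_eq_square)
    also have "... \<le> real N * 4" using Mx by (intro mult_left_mono) auto
    finally show "M^2 \<le> (2 * sqrt (real N))^2" by (simp add: power_mult_distrib)
  qed simp
  have stx: "real s * real t * x \<ge> 5"
  proof -
    have "real s * x * 1 \<le> real s * x * real t" using t x by (intro mult_left_mono) auto
    thus ?thesis using s by (simp add: mult_ac)
  qed
  have T0: "theta4 (exp (- (real s * x))) \<ge> 1 / 2" "0 < theta4 (exp (- (real s * real t * x)))" "theta4 (exp (- (real s * real t * x))) \<le> 2"
  proof -
    have p: "theta4 (exp (- c)) > 0" if "c \<ge> 5" for c :: real using that by (intro theta4_real_pos) auto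
    have "norm (exp (- (real s * x))) \<le> 1 / 6" "norm (exp (- (real s * real t * x))) \<le> 1 / 6"
      using exp_minus_le_sixth[OF s] exp_minus_le_sixth[OF stx] by simp_all
    from theta4_small[OF this(1)] theta4_small[OF this(2)] p[OF s] p[OF stx]
    show "theta4 (exp (- (real s * x))) \<ge> 1 / 2" "0 < theta4 (exp (- (real s * real t * x)))" "theta4 (exp (- (real s * real t * x))) \<le> 2"
      by simp_all
  qed
  have T_ge: "exp (2 * M) \<le> 4 * (sqrt (real t) * T)"
  proof -
    have "(1 / 2) / 2 \<le> theta4 (exp (- (real s * x))) / theta4 (exp (- (real s * real t * x)))"
      using T0 by (intro frac_le) auto
    hence "exp (2 * M) * (1 / 4) \<le> exp (2 * M) * (theta4 (exp (- (real s * x))) / theta4 (exp (- (real s * real t * x))))"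
      by (intro mult_left_mono) auto
    also have "... = sqrt (real t) * T" using t by (simp add: T_def)
    finally show ?thesis by simp
  qed
  have T: "T > 0" using T0 t unfolding T_def by (intro mult_pos_pos divide_pos_pos) auto
  have xpi: "x \<le> pi" using x pi_gt3 by linarith
  have hI: "(h has_integral of_real (2 * pi * real (pbar s t N))) {-pi..pi}"
    unfolding h_def using st s0 t x by (intro pbar_coefficient_integral) auto
  have sub: "h integrable_on {a..b}" if "-pi \<le> a" "b \<le> pi" for a b
    by (rule integrable_on_subinterval[OF has_integral_integrable[OF hI]]) (use that in auto)
  define J1 where "J1 = integral {-pi..-x} h"
  define J2 where "J2 = integral {-x..x} h"
  define J3 where "J3 = integral {x..pi} h"
  have J: "(h has_integral J1) {-pi..-x}" "(h has_integral J2) {-x..x}" "(h has_integral J3) {x..pi}"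
    unfolding J1_def J2_def J3_def by (rule integrable_integral, rule sub; use x xpi in linarith)+
  have J12: "(h has_integral (J1 + J2)) {-pi..x}" by (rule has_integral_combine[OF _ _ J(1) J(2)]) (use x xpi in linarith)+
  have "(h has_integral (J1 + J2 + J3)) {-pi..pi}" by (rule has_integral_combine[OF _ _ J12 J(3)]) (use x xpi in linarith)+
  hence "J1 + J2 + J3 = of_real (2 * pi * real (pbar s t N))" using hI by (rule has_integral_unique)
  hence "Re (J1 + J2 + J3) = Re (of_real (2 * pi * real (pbar s t N)))" by (rule arg_cong)
  hence total: "Re J1 + Re J2 + Re J3 = 2 * pi * real (pbar s t N)" by simp
  \<comment> \<open>K3 bounds the integrand on the two outer intervals, whose lengths are at most 4.\<close>
  define K3 :: real where "K3 = 16 * 9 * (24 * 12.5 ^ 4)"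
  have minor: "norm (h y) \<le> K3 * (x ^ 3 * exp (2 * M))" if "x \<le> \<bar>y\<bar>" "\<bar>y\<bar> \<le> pi" for y
    unfolding h_def K3_def by (rule pbar_gf_minor_arc[OF x t s M that])
  have K3x: "0 \<le> K3 * (x ^ 3 * exp (2 * M))" using x by (simp add: K3_def)
  have len: "pi - x \<le> 4" "-x - - pi \<le> 4" using x pi_less_4 by auto
  have nJ1: "norm J1 \<le> K3 * (x ^ 3 * exp (2 * M)) * 4"
  proof -
    have "norm J1 \<le> K3 * (x ^ 3 * exp (2 * M)) * (-x - - pi)"
      using has_integral_bound_real[OF K3x finite.emptyI, of h J1 "-pi" "-x"] J(1) minor x xpi by auto
    also have "... \<le> K3 * (x ^ 3 * exp (2 * M)) * 4" using K3x len by (intro mult_left_mono) auto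
    finally show ?thesis .
  qed
  have nJ3: "norm J3 \<le> K3 * (x ^ 3 * exp (2 * M)) * 4"
  proof -
    have "norm J3 \<le> K3 * (x ^ 3 * exp (2 * M)) * (pi - x)"
      using has_integral_bound_real[OF K3x finite.emptyI, of h J3 x pi] J(3) minor x xpi by auto
    also have "... \<le> K3 * (x ^ 3 * exp (2 * M)) * 4" using K3x len by (intro mult_left_mono) auto
    finally show ?thesis .
  qed
  have sM: "sqrt M > 0" "M * sqrt M > 0" using Mpos by auto
  have small: "x ^ 3 * exp (2 * M) \<le> 256 * (x * T / (M * sqrt M))"
  proof -
    have tx: "real t * x \<le> 64"
    proof -
      have "exp (1::real) \<le> real N" using exp_le N by linarith
      hence "1 \<le> ln (real N)" using N by (subst ln_ge_iff) auto
      hence "1 / 2 \<le> 2 * pi^2 / (real t * x)" using B by linarith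
      hence "real t * x \<le> 4 * pi^2" using t x by (simp add: le_divide_eq)
      thus ?thesis using pi2 by linarith
    qed
    have "x^2 * sqrt (real t) * (M * sqrt M) \<le> 64"
    proof (rule power2_le_imp_le)
      have "(x^2 * sqrt (real t) * (M * sqrt M))^2 = (real t * x) * (M * x) ^ 3"
      proof -
        have "(sqrt (real t))^2 = real t" "(sqrt M)^2 = M" using Mpos by simp_all
        thus ?thesis by (simp only: power_mult_distrib) (simp add: eval_nat_numeral)
      qed
      also have "... \<le> 64 * 4 ^ 3"
        using tx Mx x Mpos by (intro mult_mono power_mono) auto
      finally show "(x^2 * sqrt (real t) * (M * sqrt M))^2 \<le> 64^2" by simp
    qed simp
    hence a: "x^2 * sqrt (real t) \<le> 64 / (M * sqrt M)" using sM by (simp add: le_divide_eq)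
    have "x ^ 3 * exp (2 * M) \<le> x ^ 3 * (4 * (sqrt (real t) * T))" using T_ge x by (intro mult_left_mono) auto
    also have "... = 4 * (x * T) * (x^2 * sqrt (real t))" by (simp add: power2_eq_square power3_eq_cube)
    also have "... \<le> 4 * (x * T) * (64 / (M * sqrt M))" using a x T by (intro mult_left_mono) auto
    finally show ?thesis by simp
  qed
  define C :: real where "C = 2117696"
  define K1 where "K1 = 224 + 36 * C + (1 + 2 * C) * 12"
  define z where "z u = of_real x * (1 + \<i> * of_real u)" for u :: real
  define P where "P u = theta_psi (exp (- (of_real (pi^2) / (of_real (real t) * z u)))) / theta_psi (exp (- (of_real (pi^2) / z u)))" for u
  define k where "k u = exp (- (of_real (M * u^2) / (1 + \<i> * of_real u))) * P u * theta4_ratio (real s * x) (real s * real t * x) u" for u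
  have Pb: "theta_psi (exp (- (of_real (pi^2) / z u))) \<noteq> 0" 
      "norm (P u - 1) \<le> 12 / M * exp (8 / 9 * (M * u^2 / (1 + u^2)))" if "\<bar>u\<bar> \<le> 1" for u
    using theta_psi_quotient_near_one[OF x _ that M(2) _ MN B] t N unfolding P_def z_def by auto
  have hk: "h (x * u) = of_real T * k u" if "\<bar>u\<bar> \<le> 1" for u
  proof -
    have "Complex x (x * u) = z u" by (simp add: z_def complex_eq_iff)
    thus ?thesis unfolding h_def k_def P_def T_def z_def
      using pbar_gf_saddle_form[OF x(1) _ s0 M Pb(1)[OF that, unfolded z_def]] t by simp
  qed
  have "((\<lambda>u. h (x *\<^sub>R u + 0)) has_integral J2 /\<^sub>R x ^ DIM(real)) (cbox ((- x - 0) /\<^sub>R x) ((x - 0) /\<^sub>R x))"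
    by (rule has_integral_affinity') (use J(2) x in auto)
  hence "((\<lambda>u. h (x * u)) has_integral J2 / of_real x) {-1..1}"
    using x by (simp add: scaleR_conv_of_real divide_inverse mult.commute)
  hence "((\<lambda>u. h (x * u) / of_real T) has_integral J2 / of_real x / of_real T) {-1..1}"
    by (rule has_integral_divide)
  moreover have "h (x * u) / of_real T = k u" if "u \<in> {-1..1}" for u
    using hk[of u] that T by (simp add: abs_le_iff)
  ultimately have kI: "(k has_integral J2 / of_real x / of_real T) {-1..1}"
    using has_integral_cong[of "{-1..1}" "\<lambda>u. h (x * u) / of_real T" k] by blast
  have kb: "\<bar>Re (k u) - exp (- (M * u^2))\<bar> \<le> K1 / M * exp (- (M * u^2 / 36))" if "\<bar>u\<bar> \<le> 1" for u
    unfolding k_def K1_def C_def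
    by (rule major_arc_pointwise[OF Mpos that theta4_ratio_near_one[OF s stx that] _ _ Pb(2)[OF that]]) auto
  have "\<bar>Re (J2 / of_real x / of_real T) - sqrt (pi / M)\<bar> \<le> K1 / M * sqrt (36 * pi / M)"
    by (rule gaussian_comparison[OF Mpos _ kI kb]) (auto simp: K1_def C_def)
  hence "\<bar>Re J2 / (x * T) - sqrt (pi / M)\<bar> \<le> K1 / M * sqrt (36 * pi / M)" by simp
  also have "sqrt (36 * pi / M) \<le> 12 / sqrt M"
  proof -
    have "sqrt (36 * pi) \<le> sqrt (12^2)" using pi_less_4 by (subst real_sqrt_le_iff) simp
    hence "sqrt (36 * pi) / sqrt M \<le> 12 / sqrt M" using sM by (intro divide_right_mono) auto
    thus ?thesis by (simp add: real_sqrt_divide)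
  qed
  hence "K1 / M * sqrt (36 * pi / M) \<le> K1 / M * (12 / sqrt M)" using Mpos by (intro mult_left_mono) (auto simp: K1_def C_def)
  finally have "\<bar>Re J2 / (x * T) - sqrt (pi / M)\<bar> \<le> K1 / M * (12 / sqrt M)" .
  hence "x * T * \<bar>Re J2 / (x * T) - sqrt (pi / M)\<bar> \<le> x * T * (K1 / M * (12 / sqrt M))"
    using x T by (intro mult_left_mono) auto
  moreover have "x * T * \<bar>Re J2 / (x * T) - sqrt (pi / M)\<bar> = \<bar>Re J2 - x * T * sqrt (pi / M)\<bar>"
  proof -
    have "x * T * \<bar>Re J2 / (x * T) - sqrt (pi / M)\<bar> = \<bar>x * T * (Re J2 / (x * T) - sqrt (pi / M))\<bar>"
      unfolding abs_mult using x T by simp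
    also have "x * T * (Re J2 / (x * T) - sqrt (pi / M)) = Re J2 - x * T * sqrt (pi / M)"
      using x T by (simp add: right_diff_distrib)
    finally show ?thesis .
  qed
  moreover have "x * T * (K1 / M * (12 / sqrt M)) = 12 * K1 * (x * T / (M * sqrt M))" by simp
  ultimately have major: "\<bar>Re J2 - x * T * sqrt (pi / M)\<bar> \<le> 12 * K1 * (x * T / (M * sqrt M))"
    by (simp only:)
  have "K3 * (x ^ 3 * exp (2 * M)) * 4 \<le> K3 * (256 * (x * T / (M * sqrt M))) * 4"
    using small by (intro mult_right_mono mult_left_mono) (auto simp: K3_def)
  moreover have "K * (256 * W) * 4 = 1024 * K * W" for K W :: real by simp
  ultimately have "K3 * (x ^ 3 * exp (2 * M)) * 4 \<le> 1024 * K3 * (x * T / (M * sqrt M))" by (simp only:)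
  hence r: "\<bar>Re J1\<bar> \<le> 1024 * K3 * (x * T / (M * sqrt M))" "\<bar>Re J3\<bar> \<le> 1024 * K3 * (x * T / (M * sqrt M))"
    using nJ1 nJ3 abs_Re_le_cmod[of J1] abs_Re_le_cmod[of J3] by linarith+
  have "\<bar>2 * pi * real (pbar s t N) - x * T * sqrt (pi / M)\<bar> \<le> 12 * K1 * (x * T / (M * sqrt M)) + 1024 * K3 * (x * T / (M * sqrt M)) + 1024 * K3 * (x * T / (M * sqrt M))"
  proof -
    have "\<bar>S - c\<bar> \<le> A + B + B'" if "a + b + d = S" "\<bar>b - c\<bar> \<le> A" "\<bar>a\<bar> \<le> B" "\<bar>d\<bar> \<le> B'" for a b c d S A B B' :: real
      using that by linarith
    from this[OF total major r] show ?thesis .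
  qed
  also have "... = (12 * K1 + 2048 * K3) * (x * T / (M * sqrt M))" by (simp add: algebra_simps)
  also have "... \<le> 3 * 10 ^ 11 * (x * T / (M * sqrt M))"
  proof (rule mult_right_mono)
    show "12 * K1 + 2048 * K3 \<le> 3 * 10 ^ 11" by (simp add: K1_def K3_def C_def power_divide)
  qed (use x T sM in simp)
  finally show ?thesis .
qed

lemma theta4_two_terms:
  fixes q :: real
  assumes q: "0 \<le> q" "q \<le> 1 / 3"
  shows "\<bar>theta4 q - (1 - 2 * q)\<bar> \<le> 3 * q ^ 4"
proof -
  define f where "f n = (if n = 0 then 1 else 2) * (-1) ^ n * q ^ (n^2)" for n :: nat
  have sf: "summable f" unfolding f_def using q by (intro summable_norm_cancel[OF summable_theta4]) auto
  have "suminf f - sum f {..<2} = (\<Sum>n. f (n + 2))" using suminf_minus_initial_segment[OF sf, of 2] by simp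
  hence "theta4 q - (1 - 2 * q) = (\<Sum>n. f (n + 2))" by (simp add: theta4_def f_def[abs_def] numeral_2_eq_2)
  also have "norm ... \<le> (\<Sum>n. 2 * q ^ 4 * q ^ n)"
  proof (rule norm_suminf_le)
    fix n :: nat
    have "q ^ ((n + 2)^2) \<le> q ^ (4 + n)" using q by (intro power_decreasing) (auto simp: power2_eq_square)
    thus "norm (f (n + 2)) \<le> 2 * q ^ 4 * q ^ n" using q by (simp add: f_def abs_mult power_abs power_add)
  next
    show "summable (\<lambda>n. 2 * q ^ 4 * q ^ n)" using q by (intro summable_mult summable_geometric) auto
  qed
  also have "... = 2 * q ^ 4 * (1 / (1 - q))" using q by (subst suminf_mult) (auto simp: suminf_geometric summable_geometric)
  also have "... \<le> 2 * q ^ 4 * (3 / 2)" using q by (intro mult_left_mono) (auto simp: field_simps)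
  finally show ?thesis by simp
qed

text \<open>
  To second order log \<theta>_4(q) is -2 q - 2 q^2, so the coefficient 1.005 of q^2 forces d to be
  1 + 1.5025 q + O(q^2), which lies between 1 and 1.01 for q \<le> 1/256.
\<close>
lemma theta4_exponential_form:
  fixes q :: real
  assumes q: "0 < q" "q \<le> 1 / 256"
  obtains d where "d \<in> {1<..<1.01}" "theta4 q = exp (1.005 * q^2 - 2 * d * q)"
proof -
  define L where "L = ln (theta4 q)"
  have pos: "theta4 q > 0" using q by (intro theta4_real_pos) auto
  have tt: "\<bar>theta4 q - (1 - 2 * q)\<bar> \<le> 3 * q ^ 4" by (rule theta4_two_terms) (use q in auto)
  have q2: "q^2 \<le> 1 / 256 * q" using q by (simp add: power2_eq_square)
  have q3: "q ^ 3 \<le> (1 / 256) ^ 3" by (rule power_mono) (use q in auto)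
  have q4: "q ^ 4 = q ^ 3 * q" by (simp add: eval_nat_numeral)
  have q4': "q ^ 4 \<le> (1 / 256) ^ 3 * q" unfolding q4 using q3 q by (intro mult_right_mono) auto
  define d where "d = (1.005 * q^2 - L) / (2 * q)"
  have up: "L \<le> - 2 * q + 3 * q ^ 4" using ln_le_minus_one[OF pos] tt by (simp add: L_def abs_le_iff)
  have lo: "- L \<le> 252 / 125 * q"
  proof -
    have "- L = ln (1 / theta4 q)" using pos by (simp add: L_def ln_div)
    also have "... \<le> 1 / theta4 q - 1" using pos by (intro ln_le_minus_one) auto
    also have "... = (1 - theta4 q) / theta4 q" using pos by (simp add: field_simps)
    also have "... \<le> 252 / 125 * q"
    proof -
      define D where "D = 1 - 2 * q - 3 * q ^ 4"
      have D: "D \<ge> 1 - 2.001 / 256" using q q4' unfolding D_def by (simp add: power3_eq_cube)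
      have "1 - theta4 q \<le> 2 * q + 3 * q ^ 4" "D \<le> theta4 q" using tt by (auto simp: D_def abs_le_iff)
      moreover have "2 * q + 3 * q ^ 4 \<le> 20001 / 10000 * q" using q q4' by (simp add: power3_eq_cube)
      moreover have "20001 / 10000 * q \<le> 252 / 125 * D * q" using D q by (intro mult_right_mono) auto
      moreover have "252 / 125 * D * q \<le> 252 / 125 * q * theta4 q" using \<open>D \<le> theta4 q\<close> q by (simp add: mult_ac)
      ultimately have "1 - theta4 q \<le> 252 / 125 * q * theta4 q" by linarith
      thus ?thesis using pos by (simp add: pos_divide_le_eq)
    qed
    finally show ?thesis .
  qed
  show ?thesis
  proof (rule that)
    have "q ^ 4 = q^2 * q^2" by (simp add: eval_nat_numeral)
    also have "... \<le> q^2 * (1 / 256)" using q q2 by (intro mult_left_mono) auto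
    finally have "q ^ 4 \<le> q^2 * (1 / 256)" .
    moreover have "q^2 > 0" using q by simp
    ultimately have "2 * q < q^2 - L" using up by linarith
    also have "q^2 - L \<le> 1.005 * q^2 - L" by simp
    finally have "2 * q < 1.005 * q^2 - L" .
    hence "1 < d" using q by (simp add: d_def less_divide_eq)
    moreover have "1.005 * q^2 - L < 2.02 * q"
    proof -
      have "1.005 * q^2 = 201 / 200 * q^2" "2.02 * q = 101 / 50 * q" by simp_all
      thus ?thesis using lo q2 q by linarith
    qed
    hence "d < 1.01" using q by (simp add: d_def divide_less_eq)
    ultimately show "d \<in> {1<..<1.01}" by simp
    have "2 * (y / (2 * q)) * q = y" for y using q by simp
    from this[of "1.005 * q^2 - L"] have "2 * d * q = 1.005 * q^2 - L" by (simp only: d_def)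
    hence "1.005 * q^2 - 2 * d * q = L" by simp
    thus "theta4 q = exp (1.005 * q^2 - 2 * d * q)" using pos by (simp add: L_def)
  qed
qed

text \<open>
  5.68 = 16 * 0.355, and the sixteenth power of the quadratic Taylor bound of exp 0.355 exceeds 256.
\<close>
lemma exp_minus_le_256:
  assumes "\<sigma> \<ge> (5.68::real)"
  shows "exp (- \<sigma>) \<le> 1 / 256"
proof -
  have "1.418 \<le> exp (0.355::real)"
    using exp_lower_Taylor_quadratic[of "0.355"] by (simp add: power2_eq_square)
  hence "1.418 ^ 16 \<le> exp (0.355::real) ^ 16" by (rule power_mono) simp
  also have "... = exp 5.68" by (simp add: exp_of_nat_mult[symmetric])
  also have "... \<le> exp \<sigma>" using assms by simp
  finally have "256 \<le> exp \<sigma>" by (rule order_trans[rotated]) (simp add: eval_nat_numeral)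
  thus ?thesis by (simp add: exp_minus field_simps)
qed

lemma main_term_identity:
  fixes n r :: real
  assumes n: "n > 0" and r: "r > 0"
  defines "x \<equiv> pi / 2 * sqrt (r / n)"
  shows "x * sqrt (pi / (n * x)) / (2 * pi) = 1 / (2 * sqrt 2) * n powr (- (3 / 4)) * r powr (1 / 4)"
proof (rule power2_eq_imp_eq)
  have x: "x > 0" using n r by (simp add: x_def)
  have "(x * sqrt (pi / (n * x)) / (2 * pi))^2 = x^2 * (pi / (n * x)) / (4 * pi^2)"
    using x n by (simp add: power_mult_distrib power_divide)
  also have "... = x / (4 * pi * n)" using x n by (simp add: power2_eq_square)
  also have "... = sqrt r / sqrt n / (8 * n)" by (simp add: x_def real_sqrt_divide)
  also have "... = r powr (1 / 2) * n powr (- (3 / 2)) / 8"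
  proof -
    have "n powr (- (3 / 2)) = n powr (- (1 / 2)) * n powr (- 1)"
      by (subst powr_add[symmetric]) simp
    also have "... = 1 / sqrt n * (1 / n)" using n by (simp add: powr_minus_divide powr_half_sqrt)
    finally show ?thesis using r by (simp add: powr_half_sqrt)
  qed
  also have "... = (1 / (2 * sqrt 2) * n powr (- (3 / 4)) * r powr (1 / 4))^2"
  proof -
    have "(y powr c)^2 = y powr (2 * c)" for y c :: real by (simp add: power2_eq_square powr_add[symmetric])
    thus ?thesis by (simp add: power_mult_distrib power_divide)
  qed
  finally show "(x * sqrt (pi / (n * x)) / (2 * pi))^2 = (1 / (2 * sqrt 2) * n powr (- (3 / 4)) * r powr (1 / 4))^2" .
  show "0 \<le> x * sqrt (pi / (n * x)) / (2 * pi)" using x n by simp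
qed simp

section \<open>The asymptotic formula\<close>

text \<open>
  With x the saddle point, the four inner exponentials of E5 are Q, Q^2, q^2 and q for q = exp(-s x) and
  Q = exp(-s t x). Hence E5 has the shape of \<open>theta4_exponential_form\<close> at q, divided by the same at Q.
\<close>
lemma E5_eq_theta4_quotient:
  fixes N s t :: nat
  assumes N: "N \<ge> 1" and t: "t \<ge> 10" and s: "s > 0"
  defines "x \<equiv> pi / 2 * sqrt ((1 - 1 / real t) / real N)"
  assumes sx: "real s * x \<ge> 5.68"
  obtains d7 d8 d9 d10 where "d7 \<in> {1<..<1.01}" "d8 \<in> {1<..<1.01}" "d9 \<in> {1<..<1.01}" "d10 \<in> {1<..<1.01}"
    "E5 N s t d7 d8 d9 d10 0 0 0 0 = theta4 (exp (- (real s * x))) / theta4 (exp (- (real s * real t * x)))"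
proof -
  define q where "q = exp (- (real s * x))"
  define Q where "Q = exp (- (real s * real t * x))"
  have "real s * x * 1 \<le> real s * x * real t" using t sx by (intro mult_left_mono) auto
  hence stx: "real s * real t * x \<ge> 5.68" using sx by (simp add: mult_ac)
  have q: "0 < q" "q \<le> 1 / 256" using exp_minus_le_256[OF sx] by (simp_all add: q_def)
  have Q: "0 < Q" "Q \<le> 1 / 256" using exp_minus_le_256[OF stx] by (simp_all add: Q_def)
  \<comment> \<open>The constants d8 and d9 are both 1.005; d10 and d7 are then determined by q and Q.\<close>
  obtain d10 where d10: "d10 \<in> {1<..<1.01}" "theta4 q = exp (1.005 * q^2 - 2 * d10 * q)"
    using theta4_exponential_form[OF q] by blast
  obtain d7 where d7: "d7 \<in> {1<..<1.01}" "theta4 Q = exp (1.005 * Q^2 - 2 * d7 * Q)"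
    using theta4_exponential_form[OF Q] by blast
  have r1: "sqrt ((real t - 1) / (real t * real N)) = 2 * x / pi"
  proof -
    have "(real t - 1) / (real t * real N) = (1 - 1 / real t) / real N" using t by (simp add: field_simps)
    thus ?thesis by (simp add: x_def)
  qed
  have r2: "sqrt (real t * (real t - 1) / real N) = real t * (2 * x / pi)"
  proof -
    have "real t * (real t - 1) / real N = (real t)^2 * ((real t - 1) / (real t * real N))"
      using t by (simp add: power2_eq_square)
    hence "sqrt (real t * (real t - 1) / real N) = sqrt ((real t)^2) * (2 * x / pi)"
      by (simp only: real_sqrt_mult r1)
    thus ?thesis by simp
  qed
  have e1: "exp (- (pi * real s / 2) * sqrt (real t * (real t - 1) / real N) * (1 + 0)) = Q"
    unfolding r2 Q_def by (simp add: mult_ac)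
  have e2: "exp (- (pi * real s) * sqrt (real t * (real t - 1) / real N) * (1 + 0)) = Q^2"
    unfolding r2 Q_def by (simp add: exp_of_nat_mult[symmetric] mult_ac)
  have e3: "exp (- (pi * real s) * sqrt ((real t - 1) / (real t * real N)) * (1 + 0)) = q^2"
    unfolding r1 q_def by (simp add: exp_of_nat_mult[symmetric] mult_ac)
  have e4: "exp (- (pi * real s / 2) * sqrt ((real t - 1) / (real t * real N)) * (1 + 0)) = q"
    unfolding r1 q_def by (simp add: mult_ac)
  have "E5 N s t d7 1.005 1.005 d10 0 0 0 0 = exp (2 * d7 * Q - 1.005 * Q^2) * exp (1.005 * q^2 - 2 * d10 * q)"
    unfolding E5_def e1 e2 e3 e4 by (rule refl)
  also have "... = theta4 q / theta4 Q"
    unfolding d7(2) d10(2) exp_diff[symmetric] exp_add[symmetric] by simp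
  finally show ?thesis using that[of d7 "1.005" "1.005" d10] d7(1) d10(1) by (simp add: q_def Q_def)
qed

text \<open>
  The lower bound on s enters here: s x > 4 sqrt N (\<pi> / 2) sqrt((1 - 1/t) / N) = 2 \<pi> sqrt(1 - 1/t), and t \<ge> 10.
\<close>
lemma saddle_parameters:
  fixes N s t :: nat
  assumes N: "N \<ge> 1" and t: "t \<ge> 10" and sN: "real s > 4 * sqrt (real N)"
  defines "x \<equiv> pi / 2 * sqrt ((1 - 1 / real t) / real N)"
  shows "x > 0" "real s * x \<ge> 5.68" "real N * x * x = pi^2 / 4 * (1 - 1 / real t)"
    "2 * (real N * x) = pi * sqrt (real N * (1 - 1 / real t))" "sqrt (real N) \<le> real N * x"
    "N \<ge> 256 \<Longrightarrow> x \<le> 1"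
proof -
  define r where "r = 1 - 1 / real t"
  define n where "n = real N"
  \<comment> \<open>The numerical margin: 2 * 3 * sqrt 0.9 exceeds 5.68.\<close>
  have r: "0.9 \<le> r" "r \<le> 1" using t by (auto simp: r_def field_simps)
  have n: "n \<ge> 1" using N by (simp add: n_def)
  have x: "x = pi / 2 * (sqrt r / sqrt n)" by (simp add: x_def r_def n_def real_sqrt_divide)
  have sr: "0.947 \<le> sqrt r"
  proof (rule real_le_rsqrt)
    have "(0.947::real)^2 \<le> 0.9" by (simp add: power2_eq_square)
    thus "0.947^2 \<le> r" using r by linarith
  qed
  have sn: "sqrt n > 0" "sqrt n * sqrt n = n" using n by auto
  have srr: "sqrt r * sqrt r = r" using r by simp
  show "x > 0" using r sn unfolding x by (intro mult_pos_pos divide_pos_pos) auto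
  have "5.68 \<le> 2 * 3 * (0.947 :: real)" by simp
  also have "... \<le> 2 * pi * sqrt r" using pi_gt3 sr by (intro mult_mono) auto
  also have "... = 4 * sqrt n * x" using sn by (simp add: x)
  also have "... \<le> real s * x" using sN \<open>x > 0\<close> by (intro mult_right_mono) (auto simp: n_def)
  finally show "real s * x \<ge> 5.68" .
  have "n * x * x = pi^2 / 4 * (sqrt r * sqrt r) * (n / (sqrt n * sqrt n))"
    by (simp add: x power2_eq_square)
  also have "... = pi^2 / 4 * r" unfolding srr sn(2) using n by simp
  finally show "real N * x * x = pi^2 / 4 * (1 - 1 / real t)" by (simp add: n_def r_def)
  have nx: "n * x = pi / 2 * (sqrt n * sqrt r)"
  proof -
    have "n * x = sqrt n * sqrt n * (pi / 2 * (sqrt r / sqrt n))" by (simp only: x sn(2))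
    moreover have "a * a * (b * (c / a)) = b * (a * c)" if "a > 0" for a b c :: real using that by simp
    note this[OF sn(1), of "pi / 2" "sqrt r"]
    ultimately have "n * x = pi / 2 * (sqrt n * sqrt r)" by (simp only:)
    thus ?thesis .
  qed
  thus "2 * (real N * x) = pi * sqrt (real N * (1 - 1 / real t))"
    by (simp add: n_def r_def real_sqrt_mult)
  have "1 * sqrt n \<le> (pi / 2 * sqrt r) * sqrt n"
  proof (rule mult_right_mono)
    have "(1::real) \<le> 3 / 2 * 0.947" by simp
    also have "... \<le> pi / 2 * sqrt r" using pi_gt3 sr by (intro mult_mono) auto
    finally show "1 \<le> pi / 2 * sqrt r" .
  qed (use sn in simp)
  thus "sqrt (real N) \<le> real N * x" using nx by (simp add: n_def mult_ac)
  assume "N \<ge> 256"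
  hence "2^2 \<le> n" by (simp add: n_def)
  hence "2 \<le> sqrt n" by (rule real_le_rsqrt)
  have "x = pi * sqrt r / (2 * sqrt n)" by (simp add: x)
  also have "... \<le> 4 * 1 / (2 * 2)"
    using pi_less_4 r sr \<open>2 \<le> sqrt n\<close> by (intro frac_le mult_mono) auto
  finally show "x \<le> 1" by simp
qed

text \<open>
  The outer error term is defined as the one that makes the formula exact, so only its size for
  N \<ge> 256 has to be estimated. The bound on t becomes ln N / 2 \<le> 2 \<pi>^2 / (t x), which turns the
  saddle point estimate into a relative error O(1 / M), and M \<ge> sqrt N.
\<close>
theorem theorem1p4:
  fixes eps1 :: real
  assumes "eps1 > 0"
  shows "\<exists>(C::real) (N0::nat). \<forall>(N::nat) (s::nat) (t::nat).
    N \<ge> 1 \<and> coprime s t \<and> s > t \<and> t \<ge> 10 \<and>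
    real s > 4 * sqrt (real N) \<and>
    2 * real t \<le> 8 * pi / ((1 / 2 + eps1) * ln (real N)) * sqrt (real t * real N / (real t - 1))
    \<longrightarrow>
    (\<exists>d7 \<in> {1<..<1.01::real}. \<exists>d8 \<in> {1<..<1.01::real}.
     \<exists>d9 \<in> {1<..<1.01::real}. \<exists>d10 \<in> {1<..<1.01::real}.
     \<exists>(e0::real) (e1::real) (e2::real) (e3::real) (e4::real).
       (N \<ge> N0 \<longrightarrow> (\<forall>e \<in> {e0, e1, e2, e3, e4}. \<bar>e\<bar> \<le> C * real N powr (- (1 / 2)))) \<and>
       real (pbar s t N) =
         1 / (2 * sqrt (2 * real t) * real N powr (3 / 4)) * (1 - 1 / real t) powr (1 / 4)
         * exp (pi * sqrt (real N * (1 - 1 / real t)))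
         * E5 N s t d7 d8 d9 d10 e1 e2 e3 e4 * (1 + e0))"
proof (rule exI[of _ "3 * 10 ^ 11"], rule exI[of _ 256], intro allI impI, elim conjE)
  fix N s t :: nat
  assume N: "N \<ge> 1" and st: "coprime s t" "s > t" and t: "t \<ge> 10" and sN: "real s > 4 * sqrt (real N)"
    and tN: "2 * real t \<le> 8 * pi / ((1 / 2 + eps1) * ln (real N)) * sqrt (real t * real N / (real t - 1))"
  define x where "x = pi / 2 * sqrt ((1 - 1 / real t) / real N)"
  define M where "M = real N * x"
  note par = saddle_parameters[OF N t sN, folded x_def]
  have s0: "s > 0" using st t by simp
  have Mpos: "M > 0" using par(1) N by (simp add: M_def)
  obtain d7 d8 d9 d10 where d: "d7 \<in> {1<..<1.01}" "d8 \<in> {1<..<1.01}" "d9 \<in> {1<..<1.01}" "d10 \<in> {1<..<1.01}"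
    and E5: "E5 N s t d7 d8 d9 d10 0 0 0 0 = theta4 (exp (- (real s * x))) / theta4 (exp (- (real s * real t * x)))"
    using E5_eq_theta4_quotient[OF N t s0, folded x_def, OF par(2)] by blast
  define T where "T = exp (2 * M) / sqrt (real t) * (theta4 (exp (- (real s * x))) / theta4 (exp (- (real s * real t * x))))"
  have T: "T > 0"
    unfolding T_def using par(1) s0 t by (intro mult_pos_pos divide_pos_pos theta4_real_pos) auto
  define A where "A = 1 / (2 * sqrt (2 * real t) * real N powr (3 / 4)) * (1 - 1 / real t) powr (1 / 4)
         * exp (pi * sqrt (real N * (1 - 1 / real t))) * E5 N s t d7 d8 d9 d10 0 0 0 0"
  have A_eq: "A = x * T * sqrt (pi / M) / (2 * pi)"
  proof -
    have B: "x * sqrt (pi / M) / (2 * pi) = 1 / (2 * sqrt 2) * real N powr (- (3 / 4)) * (1 - 1 / real t) powr (1 / 4)"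
      unfolding M_def x_def by (rule main_term_identity) (use N t in auto)
    have M2: "pi * sqrt (real N * (1 - 1 / real t)) = 2 * M" using par(4) by (simp add: M_def)
    have "1 / (2 * (a * b) * c) * r * e * G = (1 / (2 * a) * (1 / c) * r) * (e / b * G)" for a b c r e G :: real
      by (simp add: mult_ac)
    hence "A = (x * sqrt (pi / M) / (2 * pi)) * T"
      unfolding A_def T_def E5 B M2 real_sqrt_mult[of 2] powr_minus_divide by blast
    thus ?thesis by simp
  qed
  have Apos: "A > 0" unfolding A_eq using par(1) T Mpos by simp
  define e0 where "e0 = real (pbar s t N) / A - 1"
  have bound: "\<bar>e0\<bar> \<le> 3 * 10 ^ 11 * real N powr (- (1 / 2))" if N0: "N \<ge> 256"
  proof -
    have x1: "x \<le> 1" by (rule par(6)[OF N0])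
    have B: "ln (real N) / 2 \<le> 2 * pi^2 / (real t * x)"
    proof -
      have lnN: "ln (real N) > 0" using N0 by simp
      have "sqrt (real t * real N / (real t - 1)) = pi / (2 * x)"
      proof -
        have "real t * real N / (real t - 1) = 1 / ((1 - 1 / real t) / real N)" using t N by (simp add: field_simps)
        thus ?thesis using t N by (simp add: x_def real_sqrt_divide)
      qed
      hence "2 * real t \<le> 8 * pi / ((1 / 2 + eps1) * ln (real N)) * (pi / (2 * x))" using tN by simp
      also have "... = 4 * pi^2 / (((1 / 2 + eps1) * ln (real N)) * x)" by (simp add: power2_eq_square)
      also have "... \<le> 4 * pi^2 / ((1 / 2 * ln (real N)) * x)"
        using assms lnN par(1) by (intro divide_left_mono mult_right_mono mult_pos_pos) auto
      finally have "2 * real t * (1 / 2 * ln (real N) * x) \<le> 4 * pi^2"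
        using lnN par(1) by (subst (asm) pos_le_divide_eq) auto
      hence "ln (real N) / 2 * (real t * x) \<le> 2 * pi^2" by (simp add: mult_ac)
      thus ?thesis using t par(1) by (subst pos_le_divide_eq) auto
    qed
    have "\<bar>2 * pi * real (pbar s t N) - x * T * sqrt (pi / M)\<bar> \<le> 3 * 10 ^ 11 * (x * T / (M * sqrt M))"
      unfolding T_def
      by (rule pbar_saddle_point[OF st(1) t par(1) x1 _ M_def _ N0 B]) (use par(2,3) in \<open>auto simp: M_def\<close>)
    moreover have "2 * pi * real (pbar s t N) - x * T * sqrt (pi / M) = x * T * sqrt (pi / M) * e0"
      using par(1) T Mpos by (simp add: e0_def A_eq field_simps)
    moreover have "sqrt (pi / M) \<ge> 1 / sqrt M"
      using pi_gt3 Mpos by (simp add: real_sqrt_divide divide_right_mono)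
    hence "x * T * (1 / sqrt M) * \<bar>e0\<bar> \<le> x * T * sqrt (pi / M) * \<bar>e0\<bar>"
      using par(1) T by (intro mult_right_mono mult_left_mono) auto
    ultimately have "x * T * (1 / sqrt M) * \<bar>e0\<bar> \<le> 3 * 10 ^ 11 * (x * T / (M * sqrt M))"
      using par(1) T Mpos by (simp add: abs_mult)
    also have "... = x * T * (1 / sqrt M) * (3 * 10 ^ 11 * (1 / M))" by (simp add: mult_ac)
    finally have "\<bar>e0\<bar> \<le> 3 * 10 ^ 11 * (1 / M)"
      by (rule mult_left_le_imp_le) (use par(1) T Mpos in simp)
    also have "... \<le> 3 * 10 ^ 11 * (1 / sqrt (real N))"
    proof -
      have "0 < sqrt (real N)" using N by simp
      hence "1 / M \<le> 1 / sqrt (real N)"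
        using par(5) Mpos by (intro divide_left_mono mult_pos_pos) (auto simp: M_def)
      thus ?thesis by simp
    qed
    also have "1 / sqrt (real N) = real N powr (- (1 / 2))" using N by (simp add: powr_minus_divide powr_half_sqrt)
    finally show ?thesis .
  qed
  show "\<exists>d7 \<in> {1<..<1.01::real}. \<exists>d8 \<in> {1<..<1.01::real}.
     \<exists>d9 \<in> {1<..<1.01::real}. \<exists>d10 \<in> {1<..<1.01::real}.
     \<exists>(e0::real) (e1::real) (e2::real) (e3::real) (e4::real).
       (N \<ge> 256 \<longrightarrow> (\<forall>e \<in> {e0, e1, e2, e3, e4}. \<bar>e\<bar> \<le> 3 * 10 ^ 11 * real N powr (- (1 / 2)))) \<and>
       real (pbar s t N) =
         1 / (2 * sqrt (2 * real t) * real N powr (3 / 4)) * (1 - 1 / real t) powr (1 / 4)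
         * exp (pi * sqrt (real N * (1 - 1 / real t)))
         * E5 N s t d7 d8 d9 d10 e1 e2 e3 e4 * (1 + e0)"
  proof (rule bexI[OF _ d(1)], rule bexI[OF _ d(2)], rule bexI[OF _ d(3)], rule bexI[OF _ d(4)],
      rule exI[of _ e0], (rule exI[of _ 0])+, intro conjI impI)
    show "\<forall>e \<in> {e0, 0, 0, 0, 0}. \<bar>e\<bar> \<le> 3 * 10 ^ 11 * real N powr (- (1 / 2))" if "N \<ge> 256"
      using bound[OF that] by auto
    have "real (pbar s t N) = A * (1 + e0)" using Apos by (simp add: e0_def)
    thus "real (pbar s t N) =
         1 / (2 * sqrt (2 * real t) * real N powr (3 / 4)) * (1 - 1 / real t) powr (1 / 4)
         * exp (pi * sqrt (real N * (1 - 1 / real t)))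
         * E5 N s t d7 d8 d9 d10 0 0 0 0 * (1 + e0)" by (simp only: A_def)
  qed
qed

end
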